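(* Let $q\colon E\to M$ be a tangent display map in a tangent category $(\mathbb X,\mathbb T)$, and let $R\colon TE\to Vq$ and $H\colon Fq\to TE$ be morphisms. The following are equivalent: (1) $(R,H)$ is an Ehresmann connection on $q$; (2) $(R,H)$ is a splitting, in the category $\mathsf{DB}(E)$, of the fundamental short sequence $\mathbf 0_E\to\mathbf q^V\xrightarrow{\iota_q}\mathbf p_E\xrightarrow{\pi_q}\mathbf q^F\to\mathbf 0_E$ of $q$.
   Context: Composition is diagrammatic: $fg$ is $f$ followed by $g$; $\langle f,g\rangle$ denotes pairing into a (fibred) product, with projections $\pi_1,\pi_2$. A tangent category $(\mathbb X,\mathbb T)$ is a category $\mathbb X$ with an endofunctor $T$ and natural transformations $p_M\colon TM\to M$, $z_M\colon M\to TM$, $s_M\colon T_2M\to TM$, $l_M\colon TM\to T^2M$, $c_M\colon T^2M\to T^2M$, where the $n$-fold pullback $T_nM$ of $p_M$ along itself exists and is preserved by all $T^m$, such that: $(p_M,z_M,s_M)$ is an additive bundle (a commutative monoid in the category over $M$); $(z_M,l_M)\colon p_M\to Tp_M$ and $(\mathrm{id}_{TM},c_M)\colon Tp_M\to p_{TM}$ are additive bundle morphisms (commutative squares preserving zero and sum); $c_Mc_M=\mathrm{id}$, $l_Mc_M=l_M$, $l_M\,Tl_M=l_M\,l_{TM}$, $Tc_M\,c_{TM}\,Tc_M=c_{TM}\,Tc_M\,c_{TM}$, $l_{TM}\,Tc_M\,c_{TM}=c_M\,Tl_M$; and, with $\xi_M=\langle\pi_1l_M,\pi_2z_{TM}\rangle\,Ts_M\colon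 T_2M\to T^2M$, the square $\xi_M\,Tp_M=\pi_1p_Mz_M$ is a tangent pullback. A tangent pullback is a pullback preserved by $T^m$ for all $m\ge0$. A tangent display map is a morphism $q\colon E\to M$ such that for all $n\ge0$ and all $f\colon N\to T^nM$ the pullback of $T^nq$ along $f$ exists and is a tangent pullback. A differential bundle $\mathbf q\colon E\to M$ consists of $q\colon E\to M$, $z_q\colon M\to E$, $s_q\colon E_2\to E$, $l_q\colon E\to TE$ ($E_n$ the $n$-fold pullback of $q$ along itself, required to exist and be preserved by all $T^m$) such that $(q,z_q,s_q)$ is an additive bundle, $(z_M,l_q)\colon q\to Tq$ and $(z_q,l_q)\colon q\to p_E$ are additive bundle morphisms, $l_ql_E=l_q\,Tl_q$, and with $\xi_q=\langle\pi_1l_q,\pi_2z_E\rangle\,Ts_q\colon E_2\to TE$ the square $\xi_q\,Tq=\pi_1qz_M$ is a tangent pullback. Convention: all differential bundles are assumed display, i.e. $q$ is a tangent display map. A morphism $(f,g)\colon\mathbf q\to\mathbf q'$ (with $qf=gq'$) is linear if $g\,l_{q'}=l_q\,Tg$. $\mathsf{DB}(E)$ is the category of differential bundles over $E$ and linear morphisms over $\mathrm{id}_E$; it has finite biproducts (fibre products over $E$), with zero object the trivial bundle $\mathbf 0_E=(\mathrm{id}_E,\mathrm{id}_E,\mathrm{id}_E,z_E)$. $\mathbf p_E=(p_E,z_E,s_E,l_E)$ is the tangent bundle. For a tangent display map $q\colon E\to M$: the vertical bundle $\mathbf q^V\colon Vq\to E$ is given by the tangent pullback $Vq$ of $Tq$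 along $z_M$, with projections $\iota_q\colon Vq\to TE$ and $T^Vq\colon Vq\to M$; $q^V=\iota_qp_E$, and its zero $z_q^V$, sum $s^V_q$, lift $l_q^V$ are determined by $z_q^V\iota_q=z_E$, $s_q^V\iota_q=(\iota_q\times\iota_q)s_E$, $l_q^V\,T\iota_q=\iota_ql_E$. The Finsler bundle $\mathbf q^F\colon Fq\to E$ is given by the tangent pullback $Fq$ of $q$ along $p_M$, with projections $q^F\colon Fq\to E$ and $T^Fq\colon Fq\to TM$, its zero $z_q^F$, sum $s_q^F$, lift $l_q^F$ determined by $z_q^Fq^F=\mathrm{id}_E$, $z_q^F\,T^Fq=qz_M$; $s_q^Fq^F=\pi_1q^F$, $s_q^F\,T^Fq=(T^Fq\times T^Fq)s_M$; $l_q^F\,Tq^F=q^Fz_E$, $l_q^F\,T(T^Fq)=T^Fq\,l_M$. The horizontal descent $\pi_q\colon TE\to Fq$ is the unique morphism with $\pi_qq^F=p_E$ and $\pi_q\,T^Fq=Tq$. Both $\iota_q\colon\mathbf q^V\to\mathbf p_E$ and $\pi_q\colon\mathbf p_E\to\mathbf q^F$ are linear over $E$. A vertical connection on $q$ is $R\colon TE\to Vq$ with $\iota_qR=\mathrm{id}_{Vq}$ and $R\colon\mathbf p_E\to\mathbf q^V$ linear over $E$ ($Rq^V=p_E$, $Rl_q^V=l_E\,TR$). A horizontal connection on $q$ is $H\colon Fq\to TE$ with $H\pi_q=\mathrm{id}_{Fq}$ and $H\colon\mathbf q^F\to\mathbf p_E$ linear over $E$ ($Hp_E=q^F$, $Hl_E=l_q^F\,TH$).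 An Ehresmann connection on $q$ is a pair $(R,H)$ of a vertical and a horizontal connection with $HR=q^Fz_q^V$ and $\langle R\iota_q,\pi_qH\rangle s_E=\mathrm{id}_{TE}$. A splitting of a short (not necessarily exact) sequence $0\to A\xrightarrow{\iota}B\xrightarrow{\pi}C\to0$ in a category with finite biproducts is a pair of morphisms $\rho\colon B\to A$, $\sigma\colon C\to B$ with $\iota\rho=\mathrm{id}_A$, $\sigma\pi=\mathrm{id}_C$, $\sigma\rho=0$ and $\rho\iota+\pi\sigma=\mathrm{id}_B$. Here $R$ plays the role of $\rho$ and $H$ of $\sigma$. *)

theory Defs
  imports Main
begin

section \<open>Categories\<close>

text \<open>
  Composition is diagrammatic.  Hom-sets are not required to be disjoint, so that an arrow of
  a tangent category may itself serve as an arrow of the category \<open>DB\<close> below; for the same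
  reason the (co)domains are explicit arguments of the universal properties.
\<close>

record ('o, 'm) category =
  ob  :: "'o set"
  hom :: "'o \<Rightarrow> 'o \<Rightarrow> 'm set"
  ide :: "'o \<Rightarrow> 'm"
  seq :: "'m \<Rightarrow> 'm \<Rightarrow> 'm"  (infixl "\<cdot>\<index>" 70)

locale category =
  fixes C :: "('o, 'm, 'x) category_scheme" (structure)
  assumes hom_ob: "f \<in> hom C A B \<Longrightarrow> A \<in> ob C \<and> B \<in> ob C"
    and ide_hom: "A \<in> ob C \<Longrightarrow> ide C A \<in> hom C A A"
    and seq_hom: "f \<in> hom C A B \<Longrightarrow> g \<in> hom C B D \<Longrightarrow> f \<cdot> g \<in> hom C A D"
    and ide_seq: "f \<in> hom C A B \<Longrightarrow> ide C A \<cdot> f = f"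
    and seq_ide: "f \<in> hom C A B \<Longrightarrow> f \<cdot> ide C B = f"
    and seq_assoc: "f \<in> hom C A B \<Longrightarrow> g \<in> hom C B D \<Longrightarrow> h \<in> hom C D E \<Longrightarrow>
      (f \<cdot> g) \<cdot> h = f \<cdot> (g \<cdot> h)"

text \<open>\<open>P\<close>, with projections \<open>a\<close> and \<open>b\<close>, is a pullback of
  \<open>f : A \<rightarrow> D\<close> and \<open>g : B \<rightarrow> D\<close>.\<close>

definition pullback ::
  "('o, 'm, 'x) category_scheme \<Rightarrow> 'o \<Rightarrow> 'o \<Rightarrow> 'o \<Rightarrow> 'm \<Rightarrow> 'm \<Rightarrow> 'o \<Rightarrow> 'm \<Rightarrow> 'm \<Rightarrow> bool" where
  "pullback C A B D f g P a b \<longleftrightarrow>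
     f \<in> hom C A D \<and> g \<in> hom C B D \<and> a \<in> hom C P A \<and> b \<in> hom C P B \<and> a \<cdot> f = b \<cdot> g \<and>
     (\<forall>Y u v. u \<in> hom C Y A \<longrightarrow> v \<in> hom C Y B \<longrightarrow> u \<cdot> f = v \<cdot> g \<longrightarrow>
        (\<exists>!h. h \<in> hom C Y P \<and> h \<cdot> a = u \<and> h \<cdot> b = v))"
  for C (structure)

text \<open>The arrow \<open>\<langle>u, v\<rangle> : Y \<rightarrow> P\<close> into a pullback \<open>P\<close> with projections
  \<open>a\<close> and \<open>b\<close>.\<close>

definition pairing ::
  "('o, 'm, 'x) category_scheme \<Rightarrow> 'o \<Rightarrow> 'o \<Rightarrow> 'm \<Rightarrow> 'm \<Rightarrow> 'm \<Rightarrow> 'm \<Rightarrow> 'm" where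
  "pairing C Y P a b u v = (THE h. h \<in> hom C Y P \<and> h \<cdot> a = u \<and> h \<cdot> b = v)"
  for C (structure)

text \<open>The \<open>n\<close>-fold pullback of \<open>q : E \<rightarrow> M\<close> along itself, with projections
  \<open>pr i\<close> for \<open>i < n\<close> and structure arrow \<open>w\<close> to \<open>M\<close>; for
  \<open>n = 0\<close> it is \<open>M\<close>.\<close>

definition fibre_power ::
  "('o, 'm, 'x) category_scheme \<Rightarrow> 'o \<Rightarrow> 'o \<Rightarrow> 'm \<Rightarrow> nat \<Rightarrow> 'o \<Rightarrow> 'm \<Rightarrow> (nat \<Rightarrow> 'm) \<Rightarrow> bool" where
  "fibre_power C E M q n P w pr \<longleftrightarrow>
     q \<in> hom C E M \<and> w \<in> hom C P M \<and> (\<forall>i<n. pr i \<in> hom C P E \<and> pr i \<cdot> q = w) \<and>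
     (\<forall>Y u v. u \<in> hom C Y M \<longrightarrow> (\<forall>i<n. v i \<in> hom C Y E \<and> v i \<cdot> q = u) \<longrightarrow>
        (\<exists>!h. h \<in> hom C Y P \<and> h \<cdot> w = u \<and> (\<forall>i<n. h \<cdot> pr i = v i)))"
  for C (structure)


section \<open>Splittings of short sequences\<close>

definition zero_object :: "('o, 'm, 'x) category_scheme \<Rightarrow> 'o \<Rightarrow> bool" where
  "zero_object C Z \<longleftrightarrow> Z \<in> ob C \<and>
     (\<forall>A \<in> ob C. (\<exists>!f. f \<in> hom C A Z) \<and> (\<exists>!f. f \<in> hom C Z A))"

definition zero_arrow :: "('o, 'm, 'x) category_scheme \<Rightarrow> 'o \<Rightarrow> 'o \<Rightarrow> 'm \<Rightarrow> bool" where
  "zero_arrow C A B f \<longleftrightarrow>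
     (\<exists>Z u v. zero_object C Z \<and> u \<in> hom C A Z \<and> v \<in> hom C Z B \<and> f = u \<cdot> v)"
  for C (structure)

definition biproduct ::
  "('o, 'm, 'x) category_scheme \<Rightarrow> 'o \<Rightarrow> 'o \<Rightarrow> 'o \<Rightarrow> 'm \<Rightarrow> 'm \<Rightarrow> 'm \<Rightarrow> 'm \<Rightarrow> bool" where
  "biproduct C A B P i1 i2 p1 p2 \<longleftrightarrow>
     i1 \<in> hom C A P \<and> i2 \<in> hom C B P \<and> p1 \<in> hom C P A \<and> p2 \<in> hom C P B \<and>
     (\<forall>Y u v. u \<in> hom C Y A \<longrightarrow> v \<in> hom C Y B \<longrightarrow>
        (\<exists>!h. h \<in> hom C Y P \<and> h \<cdot> p1 = u \<and> h \<cdot> p2 = v)) \<and>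
     (\<forall>Y u v. u \<in> hom C A Y \<longrightarrow> v \<in> hom C B Y \<longrightarrow>
        (\<exists>!h. h \<in> hom C P Y \<and> i1 \<cdot> h = u \<and> i2 \<cdot> h = v)) \<and>
     i1 \<cdot> p1 = ide C A \<and> i2 \<cdot> p2 = ide C B \<and>
     zero_arrow C A B (i1 \<cdot> p2) \<and> zero_arrow C B A (i2 \<cdot> p1)"
  for C (structure)

text \<open>\<open>h = f + g : A \<rightarrow> B\<close> for the addition induced by biproducts: \<open>h\<close> is the
  composite of \<open>\<langle>f, g\<rangle> : A \<rightarrow> B \<oplus> B\<close> and the codiagonal \<open>B \<oplus> B \<rightarrow> B\<close>.\<close>

definition arrow_sum ::
  "('o, 'm, 'x) category_scheme \<Rightarrow> 'o \<Rightarrow> 'o \<Rightarrow> 'm \<Rightarrow> 'm \<Rightarrow> 'm \<Rightarrow> bool" where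
  "arrow_sum C A B f g h \<longleftrightarrow>
     (\<exists>P i1 i2 p1 p2 u d. biproduct C B B P i1 i2 p1 p2 \<and>
        u \<in> hom C A P \<and> u \<cdot> p1 = f \<and> u \<cdot> p2 = g \<and>
        d \<in> hom C P B \<and> i1 \<cdot> d = ide C B \<and> i2 \<cdot> d = ide C B \<and>
        h = u \<cdot> d)"
  for C (structure)

text \<open>The sequence \<open>Z \<rightarrow> A \<rightarrow> B \<rightarrow> D \<rightarrow> Z\<close>, with middle arrows \<open>i\<close> and \<open>p\<close>, where
  \<open>Z\<close> is a zero object; exactness is not required.\<close>

definition short_sequence ::
  "('o, 'm, 'x) category_scheme \<Rightarrow> 'o \<Rightarrow> 'o \<Rightarrow> 'm \<Rightarrow> 'o \<Rightarrow> 'm \<Rightarrow> 'o \<Rightarrow> bool" where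
  "short_sequence C Z A i B p D \<longleftrightarrow> zero_object C Z \<and> i \<in> hom C A B \<and> p \<in> hom C B D"

definition splitting ::
  "('o, 'm, 'x) category_scheme \<Rightarrow> 'o \<Rightarrow> 'o \<Rightarrow> 'm \<Rightarrow> 'o \<Rightarrow> 'm \<Rightarrow> 'o \<Rightarrow> 'm \<Rightarrow> 'm \<Rightarrow> bool" where
  "splitting C Z A i B p D r s \<longleftrightarrow> short_sequence C Z A i B p D \<and>
     r \<in> hom C B A \<and> s \<in> hom C D B \<and>
     i \<cdot> r = ide C A \<and> s \<cdot> p = ide C D \<and>
     zero_arrow C D A (s \<cdot> r) \<and>
     arrow_sum C B B (r \<cdot> i) (p \<cdot> s) (ide C B)"
  for C (structure)


section \<open>Additive bundles\<close>

text \<open>The data of a bundle include the chosen pullback \<open>totB2\<close> of \<open>projB\<close> along itself,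
  on which the sum is defined.\<close>

record ('o, 'm) add_bundle =
  totB  :: 'o
  baseB :: 'o
  projB :: 'm
  totB2 :: 'o
  prB1  :: 'm
  prB2  :: 'm
  zeroB :: 'm
  sumB  :: 'm

record ('o, 'm) diff_bundle = "('o, 'm) add_bundle" +
  liftB :: 'm

text \<open>\<open>fib_sum C b Y u v\<close> is \<open>\<langle>u, v\<rangle> s\<close>, the sum of
  \<open>u, v : Y \<rightarrow> totB b\<close> over the same arrow to the base.\<close>

definition fib_sum ::
  "('o, 'm, 'x) category_scheme \<Rightarrow> ('o, 'm, 'y) add_bundle_scheme \<Rightarrow> 'o \<Rightarrow> 'm \<Rightarrow> 'm \<Rightarrow> 'm" where
  "fib_sum C b Y u v = pairing C Y (totB2 b) (prB1 b) (prB2 b) u v \<cdot> sumB b"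
  for C (structure)

text \<open>The axioms of a commutative monoid in the category over the base are stated on
  generalized elements.\<close>

definition additive_bundle ::
  "('o, 'm, 'x) category_scheme \<Rightarrow> ('o, 'm, 'y) add_bundle_scheme \<Rightarrow> bool" where
  "additive_bundle C b \<longleftrightarrow>
     pullback C (totB b) (totB b) (baseB b) (projB b) (projB b) (totB2 b) (prB1 b) (prB2 b) \<and>
     zeroB b \<in> hom C (baseB b) (totB b) \<and> zeroB b \<cdot> projB b = ide C (baseB b) \<and>
     sumB b \<in> hom C (totB2 b) (totB b) \<and> sumB b \<cdot> projB b = prB1 b \<cdot> projB b \<and>
     (\<forall>Y. \<forall>u \<in> hom C Y (totB b). \<forall>v \<in> hom C Y (totB b). \<forall>w \<in> hom C Y (totB b).
        u \<cdot> projB b = v \<cdot> projB b \<longrightarrow> v \<cdot> projB b = w \<cdot> projB b \<longrightarrow>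
        fib_sum C b Y (fib_sum C b Y u v) w = fib_sum C b Y u (fib_sum C b Y v w)) \<and>
     (\<forall>Y. \<forall>u \<in> hom C Y (totB b). \<forall>v \<in> hom C Y (totB b).
        u \<cdot> projB b = v \<cdot> projB b \<longrightarrow> fib_sum C b Y u v = fib_sum C b Y v u) \<and>
     (\<forall>Y. \<forall>u \<in> hom C Y (totB b). fib_sum C b Y u (u \<cdot> projB b \<cdot> zeroB b) = u)"
  for C (structure)

definition additive_bundle_morphism ::
  "('o, 'm, 'x) category_scheme \<Rightarrow> ('o, 'm, 'y) add_bundle_scheme \<Rightarrow> ('o, 'm, 'w) add_bundle_scheme \<Rightarrow>
    'm \<Rightarrow> 'm \<Rightarrow> bool" where
  "additive_bundle_morphism C b b' f g \<longleftrightarrow>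
     f \<in> hom C (baseB b) (baseB b') \<and> g \<in> hom C (totB b) (totB b') \<and>
     projB b \<cdot> f = g \<cdot> projB b' \<and>
     zeroB b \<cdot> g = f \<cdot> zeroB b' \<and>
     sumB b \<cdot> g = fib_sum C b' (totB2 b) (prB1 b \<cdot> g) (prB2 b \<cdot> g)"
  for C (structure)


section \<open>Tangent categories\<close>

text \<open>\<open>tan_2 M\<close>, with projections \<open>tan_pr1 M\<close> and \<open>tan_pr2 M\<close>, is the chosen
  pullback \<open>T\<^sub>2M\<close> on which the sum \<open>tan_s M\<close> is defined.\<close>

record ('o, 'm) tangent = "('o, 'm) category" +
  T_ob    :: "'o \<Rightarrow> 'o"  ("T\<^sub>o\<index>")
  T_ar    :: "'m \<Rightarrow> 'm"  ("T\<^sub>a\<index>")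
  tan_p   :: "'o \<Rightarrow> 'm"  ("\<pp>\<index>")
  tan_z   :: "'o \<Rightarrow> 'm"  ("\<zz>\<index>")
  tan_2   :: "'o \<Rightarrow> 'o"
  tan_pr1 :: "'o \<Rightarrow> 'm"
  tan_pr2 :: "'o \<Rightarrow> 'm"
  tan_s   :: "'o \<Rightarrow> 'm"  ("\<ss>\<index>")
  tan_l   :: "'o \<Rightarrow> 'm"  ("\<ll>\<index>")
  tan_c   :: "'o \<Rightarrow> 'm"  ("\<cc>\<index>")

definition tangent_pullback ::
  "('o, 'm) tangent \<Rightarrow> 'o \<Rightarrow> 'o \<Rightarrow> 'o \<Rightarrow> 'm \<Rightarrow> 'm \<Rightarrow> 'o \<Rightarrow> 'm \<Rightarrow> 'm \<Rightarrow> bool" where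
  "tangent_pullback X A B D f g P a b \<longleftrightarrow>
     (\<forall>m. pullback X ((T\<^sub>o ^^ m) A) ((T\<^sub>o ^^ m) B) ((T\<^sub>o ^^ m) D) ((T\<^sub>a ^^ m) f) ((T\<^sub>a ^^ m) g)
        ((T\<^sub>o ^^ m) P) ((T\<^sub>a ^^ m) a) ((T\<^sub>a ^^ m) b))"
  for X (structure)

text \<open>All \<open>n\<close>-fold pullbacks of \<open>q : E \<rightarrow> M\<close> along itself exist and are preserved by all
  \<open>T\<^sup>m\<close>.\<close>

definition has_tangent_fibre_powers :: "('o, 'm) tangent \<Rightarrow> 'o \<Rightarrow> 'o \<Rightarrow> 'm \<Rightarrow> bool" where
  "has_tangent_fibre_powers X E M q \<longleftrightarrow>
     (\<forall>n. \<exists>P w pr. \<forall>m. fibre_power X ((T\<^sub>o ^^ m) E) ((T\<^sub>o ^^ m) M) ((T\<^sub>a ^^ m) q) n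
        ((T\<^sub>o ^^ m) P) ((T\<^sub>a ^^ m) w) (\<lambda>i. (T\<^sub>a ^^ m) (pr i)))"
  for X (structure)

definition T_bundle :: "('o, 'm) tangent \<Rightarrow> ('o, 'm, 'y) add_bundle_scheme \<Rightarrow> ('o, 'm) add_bundle" where
  "T_bundle X b = \<lparr>totB = T\<^sub>o (totB b), baseB = T\<^sub>o (baseB b), projB = T\<^sub>a (projB b),
     totB2 = T\<^sub>o (totB2 b), prB1 = T\<^sub>a (prB1 b), prB2 = T\<^sub>a (prB2 b),
     zeroB = T\<^sub>a (zeroB b), sumB = T\<^sub>a (sumB b)\<rparr>"
  for X (structure)

definition tangent_bundle :: "('o, 'm) tangent \<Rightarrow> 'o \<Rightarrow> ('o, 'm) diff_bundle" where
  "tangent_bundle X M = \<lparr>totB = T\<^sub>o M, baseB = M, projB = \<pp> M,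
     totB2 = tan_2 X M, prB1 = tan_pr1 X M, prB2 = tan_pr2 X M,
     zeroB = \<zz> M, sumB = \<ss> M, liftB = \<ll> M\<rparr>"
  for X (structure)

text \<open>\<open>\<xi>\<^sub>q = \<langle>\<pi>\<^sub>1 l\<^sub>q, \<pi>\<^sub>2 z\<^sub>E\<rangle> Ts\<^sub>q : E\<^sub>2 \<rightarrow> TE\<close>, and the requirement that
  \<open>\<xi>\<^sub>q Tq = \<pi>\<^sub>1 q z\<^sub>M\<close> be a tangent pullback.\<close>

definition bundle_xi :: "('o, 'm) tangent \<Rightarrow> ('o, 'm) diff_bundle \<Rightarrow> 'm" where
  "bundle_xi X b = fib_sum X (T_bundle X b) (totB2 b) (prB1 b \<cdot> liftB b) (prB2 b \<cdot> \<zz> (totB b))"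
  for X (structure)

definition universal_lift :: "('o, 'm) tangent \<Rightarrow> ('o, 'm) diff_bundle \<Rightarrow> bool" where
  "universal_lift X b \<longleftrightarrow>
     tangent_pullback X (T\<^sub>o (totB b)) (baseB b) (T\<^sub>o (baseB b)) (T\<^sub>a (projB b)) (\<zz> (baseB b))
       (totB2 b) (bundle_xi X b) (prB1 b \<cdot> projB b)"
  for X (structure)

locale tangent_category = category X
  for X :: "('o, 'm) tangent" (structure) +
  assumes T_obj: "M \<in> ob X \<Longrightarrow> T\<^sub>o M \<in> ob X"
    and T_hom: "f \<in> hom X M N \<Longrightarrow> T\<^sub>a f \<in> hom X (T\<^sub>o M) (T\<^sub>o N)"
    and T_ide: "M \<in> ob X \<Longrightarrow> T\<^sub>a (ide X M) = ide X (T\<^sub>o M)"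
    and T_seq: "f \<in> hom X M N \<Longrightarrow> g \<in> hom X N K \<Longrightarrow> T\<^sub>a (f \<cdot> g) = T\<^sub>a f \<cdot> T\<^sub>a g"
    and p_hom: "M \<in> ob X \<Longrightarrow> \<pp> M \<in> hom X (T\<^sub>o M) M"
    and z_hom: "M \<in> ob X \<Longrightarrow> \<zz> M \<in> hom X M (T\<^sub>o M)"
    and s_hom: "M \<in> ob X \<Longrightarrow> \<ss> M \<in> hom X (tan_2 X M) (T\<^sub>o M)"
    and l_hom: "M \<in> ob X \<Longrightarrow> \<ll> M \<in> hom X (T\<^sub>o M) (T\<^sub>o (T\<^sub>o M))"
    and c_hom: "M \<in> ob X \<Longrightarrow> \<cc> M \<in> hom X (T\<^sub>o (T\<^sub>o M)) (T\<^sub>o (T\<^sub>o M))"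
    and p_natural: "f \<in> hom X M N \<Longrightarrow> T\<^sub>a f \<cdot> \<pp> N = \<pp> M \<cdot> f"
    and z_natural: "f \<in> hom X M N \<Longrightarrow> f \<cdot> \<zz> N = \<zz> M \<cdot> T\<^sub>a f"
    and s_natural: "f \<in> hom X M N \<Longrightarrow>
      fib_sum X (tangent_bundle X N) (tan_2 X M) (tan_pr1 X M \<cdot> T\<^sub>a f) (tan_pr2 X M \<cdot> T\<^sub>a f) =
      \<ss> M \<cdot> T\<^sub>a f"
    and l_natural: "f \<in> hom X M N \<Longrightarrow> T\<^sub>a f \<cdot> \<ll> N = \<ll> M \<cdot> T\<^sub>a (T\<^sub>a f)"
    and c_natural: "f \<in> hom X M N \<Longrightarrow> T\<^sub>a (T\<^sub>a f) \<cdot> \<cc> N = \<cc> M \<cdot> T\<^sub>a (T\<^sub>a f)"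
    and tangent_2: "M \<in> ob X \<Longrightarrow>
      tangent_pullback X (T\<^sub>o M) (T\<^sub>o M) M (\<pp> M) (\<pp> M) (tan_2 X M) (tan_pr1 X M) (tan_pr2 X M)"
    and tangent_n: "M \<in> ob X \<Longrightarrow> has_tangent_fibre_powers X (T\<^sub>o M) M (\<pp> M)"
    and p_additive: "M \<in> ob X \<Longrightarrow> additive_bundle X (tangent_bundle X M)"
    and l_additive: "M \<in> ob X \<Longrightarrow>
      additive_bundle_morphism X (tangent_bundle X M) (T_bundle X (tangent_bundle X M)) (\<zz> M) (\<ll> M)"
    and c_additive: "M \<in> ob X \<Longrightarrow>
      additive_bundle_morphism X (T_bundle X (tangent_bundle X M)) (tangent_bundle X (T\<^sub>o M))
        (ide X (T\<^sub>o M)) (\<cc> M)"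
    and c_c: "M \<in> ob X \<Longrightarrow> \<cc> M \<cdot> \<cc> M = ide X (T\<^sub>o (T\<^sub>o M))"
    and l_c: "M \<in> ob X \<Longrightarrow> \<ll> M \<cdot> \<cc> M = \<ll> M"
    and l_l: "M \<in> ob X \<Longrightarrow> \<ll> M \<cdot> T\<^sub>a (\<ll> M) = \<ll> M \<cdot> \<ll> (T\<^sub>o M)"
    and c_yang_baxter: "M \<in> ob X \<Longrightarrow>
      T\<^sub>a (\<cc> M) \<cdot> \<cc> (T\<^sub>o M) \<cdot> T\<^sub>a (\<cc> M) = \<cc> (T\<^sub>o M) \<cdot> T\<^sub>a (\<cc> M) \<cdot> \<cc> (T\<^sub>o M)"
    and l_c_c: "M \<in> ob X \<Longrightarrow> \<ll> (T\<^sub>o M) \<cdot> T\<^sub>a (\<cc> M) \<cdot> \<cc> (T\<^sub>o M) = \<cc> M \<cdot> T\<^sub>a (\<ll> M)"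
    and l_universal: "M \<in> ob X \<Longrightarrow> universal_lift X (tangent_bundle X M)"


section \<open>Differential bundles\<close>

definition tangent_display :: "('o, 'm) tangent \<Rightarrow> 'o \<Rightarrow> 'o \<Rightarrow> 'm \<Rightarrow> bool" where
  "tangent_display X E M q \<longleftrightarrow> q \<in> hom X E M \<and>
     (\<forall>n N. \<forall>f \<in> hom X N ((T\<^sub>o ^^ n) M). \<exists>P a b.
        tangent_pullback X ((T\<^sub>o ^^ n) E) N ((T\<^sub>o ^^ n) M) ((T\<^sub>a ^^ n) q) f P a b)"
  for X (structure)

definition differential_bundle :: "('o, 'm) tangent \<Rightarrow> ('o, 'm) diff_bundle \<Rightarrow> bool" where
  "differential_bundle X b \<longleftrightarrow>
     additive_bundle X b \<and>
     tangent_pullback X (totB b) (totB b) (baseB b) (projB b) (projB b)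
       (totB2 b) (prB1 b) (prB2 b) \<and>
     has_tangent_fibre_powers X (totB b) (baseB b) (projB b) \<and>
     additive_bundle_morphism X b (T_bundle X b) (\<zz> (baseB b)) (liftB b) \<and>
     additive_bundle_morphism X b (tangent_bundle X (totB b)) (zeroB b) (liftB b) \<and>
     liftB b \<cdot> \<ll> (totB b) = liftB b \<cdot> T\<^sub>a (liftB b) \<and>
     universal_lift X b \<and>
     tangent_display X (totB b) (baseB b) (projB b)"
  for X (structure)

text \<open>\<open>f : b \<rightarrow> b'\<close> is linear over the identity of the common base.\<close>

definition linear_over ::
  "('o, 'm) tangent \<Rightarrow> ('o, 'm) diff_bundle \<Rightarrow> ('o, 'm) diff_bundle \<Rightarrow> 'm \<Rightarrow> bool" where
  "linear_over X b b' f \<longleftrightarrow> f \<in> hom X (totB b) (totB b') \<and>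
     f \<cdot> projB b' = projB b \<and> f \<cdot> liftB b' = liftB b \<cdot> T\<^sub>a f"
  for X (structure)

definition DB :: "('o, 'm) tangent \<Rightarrow> 'o \<Rightarrow> (('o, 'm) diff_bundle, 'm) category" where
  "DB X E = \<lparr>ob = {b. differential_bundle X b \<and> baseB b = E},
     hom = (\<lambda>b b'. {f. differential_bundle X b \<and> baseB b = E \<and>
       differential_bundle X b' \<and> baseB b' = E \<and> linear_over X b b' f}),
     ide = (\<lambda>b. ide X (totB b)),
     seq = seq X\<rparr>"

definition trivial_bundle :: "('o, 'm) tangent \<Rightarrow> 'o \<Rightarrow> ('o, 'm) diff_bundle" where
  "trivial_bundle X E = \<lparr>totB = E, baseB = E, projB = ide X E,
     totB2 = E, prB1 = ide X E, prB2 = ide X E,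
     zeroB = ide X E, sumB = ide X E, liftB = \<zz> E\<rparr>"
  for X (structure)

lemma (in tangent_category) category_DB: "category (DB X E)"
proof
  fix f b b'
  assume "f \<in> hom (DB X E) b b'"
  then show "b \<in> ob (DB X E) \<and> b' \<in> ob (DB X E)"
    and "ide (DB X E) b \<cdot>\<^bsub>DB X E\<^esub> f = f" and "f \<cdot>\<^bsub>DB X E\<^esub> ide (DB X E) b' = f"
    by (auto simp: DB_def linear_over_def ide_seq seq_ide)
next
  fix b
  assume "b \<in> ob (DB X E)"
  then have arrs: "projB b \<in> hom X (totB b) (baseB b)" "liftB b \<in> hom X (totB b) (T\<^sub>o (totB b))"
    and db: "differential_bundle X b" "baseB b = E"
    by (auto simp: DB_def differential_bundle_def tangent_display_def
        additive_bundle_morphism_def tangent_bundle_def T_bundle_def)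
  from arrs hom_ob have "totB b \<in> ob X" by blast
  with arrs db show "ide (DB X E) b \<in> hom (DB X E) b b"
    by (simp add: DB_def linear_over_def ide_hom T_ide ide_seq seq_ide)
next
  fix f g b b' b''
  assume f: "f \<in> hom (DB X E) b b'" and g: "g \<in> hom (DB X E) b' b''"
  have lin: "linear_over X b b' f" "linear_over X b' b'' g"
    and db: "differential_bundle X b" "differential_bundle X b'" "differential_bundle X b''"
    and base: "baseB b = E" "baseB b' = E" "baseB b'' = E"
    using f g by (auto simp: DB_def)
  have arrs: "projB d \<in> hom X (totB d) (baseB d) \<and> liftB d \<in> hom X (totB d) (T\<^sub>o (totB d))"
    if "differential_bundle X d" for d
    using that by (auto simp: differential_bundle_def tangent_display_def
        additive_bundle_morphism_def T_bundle_def)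
  have fh: "f \<in> hom X (totB b) (totB b')" and gh: "g \<in> hom X (totB b') (totB b'')"
    and fp: "f \<cdot> projB b' = projB b" and gp: "g \<cdot> projB b'' = projB b'"
    and fl: "f \<cdot> liftB b' = liftB b \<cdot> T\<^sub>a f" and gl: "g \<cdot> liftB b'' = liftB b' \<cdot> T\<^sub>a g"
    using lin by (auto simp: linear_over_def)
  have p: "(f \<cdot> g) \<cdot> projB b'' = projB b"
    using seq_assoc[OF fh gh conjunct1[OF arrs[OF db(3)]]] fp gp by simp
  have "(f \<cdot> g) \<cdot> liftB b'' = f \<cdot> (liftB b' \<cdot> T\<^sub>a g)"
    using seq_assoc[OF fh gh conjunct2[OF arrs[OF db(3)]]] gl by simp
  also have "\<dots> = (liftB b \<cdot> T\<^sub>a f) \<cdot> T\<^sub>a g"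
    using seq_assoc[OF fh conjunct2[OF arrs[OF db(2)]] T_hom[OF gh]] fl by simp
  also have "\<dots> = liftB b \<cdot> T\<^sub>a (f \<cdot> g)"
    using seq_assoc[OF conjunct2[OF arrs[OF db(1)]] T_hom[OF fh] T_hom[OF gh]] T_seq[OF fh gh] by simp
  finally show "f \<cdot>\<^bsub>DB X E\<^esub> g \<in> hom (DB X E) b b''"
    using p db base seq_hom[OF fh gh] by (simp add: DB_def linear_over_def)
next
  fix f g h b b' b'' b'''
  assume "f \<in> hom (DB X E) b b'" "g \<in> hom (DB X E) b' b''" "h \<in> hom (DB X E) b'' b'''"
  then show "f \<cdot>\<^bsub>DB X E\<^esub> g \<cdot>\<^bsub>DB X E\<^esub> h = f \<cdot>\<^bsub>DB X E\<^esub> (g \<cdot>\<^bsub>DB X E\<^esub> h)"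
    by (auto simp: DB_def linear_over_def intro: seq_assoc)
qed


section \<open>Vertical and Finsler bundles, and connections\<close>

text \<open>As pullbacks are determined only up to isomorphism, the vertical and Finsler bundles are
  described by predicates: \<open>V\<close> is a vertical bundle of \<open>q : E \<rightarrow> M\<close>, with
  \<open>\<iota> : Vq \<rightarrow> TE\<close> and \<open>t = T\<^sup>Vq : Vq \<rightarrow> M\<close>; \<open>F\<close> is a Finsler
  bundle of \<open>q\<close>, with \<open>t = T\<^sup>Fq : Fq \<rightarrow> TM\<close>.\<close>

definition vertical_bundle ::
  "('o, 'm) tangent \<Rightarrow> 'o \<Rightarrow> 'o \<Rightarrow> 'm \<Rightarrow> ('o, 'm) diff_bundle \<Rightarrow> 'm \<Rightarrow> 'm \<Rightarrow> bool" where
  "vertical_bundle X E M q V \<iota> t \<longleftrightarrow>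
     tangent_pullback X (T\<^sub>o E) M (T\<^sub>o M) (T\<^sub>a q) (\<zz> M) (totB V) \<iota> t \<and>
     baseB V = E \<and> projB V = \<iota> \<cdot> \<pp> E \<and>
     tangent_pullback X (totB V) (totB V) E (projB V) (projB V) (totB2 V) (prB1 V) (prB2 V) \<and>
     zeroB V \<in> hom X E (totB V) \<and> zeroB V \<cdot> \<iota> = \<zz> E \<and>
     sumB V \<in> hom X (totB2 V) (totB V) \<and>
     sumB V \<cdot> \<iota> = fib_sum X (tangent_bundle X E) (totB2 V) (prB1 V \<cdot> \<iota>) (prB2 V \<cdot> \<iota>) \<and>
     liftB V \<in> hom X (totB V) (T\<^sub>o (totB V)) \<and> liftB V \<cdot> T\<^sub>a \<iota> = \<iota> \<cdot> \<ll> E"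
  for X (structure)

definition finsler_bundle ::
  "('o, 'm) tangent \<Rightarrow> 'o \<Rightarrow> 'o \<Rightarrow> 'm \<Rightarrow> ('o, 'm) diff_bundle \<Rightarrow> 'm \<Rightarrow> bool" where
  "finsler_bundle X E M q F t \<longleftrightarrow>
     tangent_pullback X E (T\<^sub>o M) M q (\<pp> M) (totB F) (projB F) t \<and>
     baseB F = E \<and>
     tangent_pullback X (totB F) (totB F) E (projB F) (projB F) (totB2 F) (prB1 F) (prB2 F) \<and>
     zeroB F \<in> hom X E (totB F) \<and> zeroB F \<cdot> projB F = ide X E \<and> zeroB F \<cdot> t = q \<cdot> \<zz> M \<and>
     sumB F \<in> hom X (totB2 F) (totB F) \<and> sumB F \<cdot> projB F = prB1 F \<cdot> projB F \<and>
     sumB F \<cdot> t = fib_sum X (tangent_bundle X M) (totB2 F) (prB1 F \<cdot> t) (prB2 F \<cdot> t) \<and>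
     liftB F \<in> hom X (totB F) (T\<^sub>o (totB F)) \<and>
     liftB F \<cdot> T\<^sub>a (projB F) = projB F \<cdot> \<zz> E \<and> liftB F \<cdot> T\<^sub>a t = t \<cdot> \<ll> M"
  for X (structure)

definition horizontal_descent ::
  "('o, 'm) tangent \<Rightarrow> 'o \<Rightarrow> 'm \<Rightarrow> ('o, 'm) diff_bundle \<Rightarrow> 'm \<Rightarrow> 'm" where
  "horizontal_descent X E q F t = pairing X (T\<^sub>o E) (totB F) (projB F) t (\<pp> E) (T\<^sub>a q)"
  for X (structure)

definition vertical_connection ::
  "('o, 'm) tangent \<Rightarrow> 'o \<Rightarrow> ('o, 'm) diff_bundle \<Rightarrow> 'm \<Rightarrow> 'm \<Rightarrow> bool" where
  "vertical_connection X E V \<iota> R \<longleftrightarrow>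
     \<iota> \<cdot> R = ide X (totB V) \<and> linear_over X (tangent_bundle X E) V R"
  for X (structure)

text \<open>Here \<open>\<pi>\<close> is the horizontal descent.\<close>

definition horizontal_connection ::
  "('o, 'm) tangent \<Rightarrow> 'o \<Rightarrow> ('o, 'm) diff_bundle \<Rightarrow> 'm \<Rightarrow> 'm \<Rightarrow> bool" where
  "horizontal_connection X E F \<pi> H \<longleftrightarrow>
     H \<cdot> \<pi> = ide X (totB F) \<and> linear_over X F (tangent_bundle X E) H"
  for X (structure)

definition ehresmann_connection ::
  "('o, 'm) tangent \<Rightarrow> 'o \<Rightarrow> ('o, 'm) diff_bundle \<Rightarrow> 'm \<Rightarrow> ('o, 'm) diff_bundle \<Rightarrow> 'm \<Rightarrow>
    'm \<Rightarrow> 'm \<Rightarrow> bool" where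
  "ehresmann_connection X E V \<iota> F \<pi> R H \<longleftrightarrow>
     vertical_connection X E V \<iota> R \<and> horizontal_connection X E F \<pi> H \<and>
     H \<cdot> R = projB F \<cdot> zeroB V \<and>
     fib_sum X (tangent_bundle X E) (T\<^sub>o E) (R \<cdot> \<iota>) (\<pi> \<cdot> H) = ide X (T\<^sub>o E)"
  for X (structure)

end

theory Submission
  imports Defs
begin

text \<open>
  Both sides of the equivalence list the same data once two facts about the category \<open>DB(E)\<close> are
  known: its zero arrows are the composites \<open>q z\<close> of a projection with a zero section, and the
  addition induced by its biproducts is the fibrewise sum, so that \<open>\<rho>\<iota> + \<pi>\<sigma> = id\<close> is the
  condition \<open>\<langle>R\<iota>, \<pi>H\<rangle> s = id\<close>.  The rest is to see that the fundamental short sequence lives in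
  \<open>DB(E)\<close> at all.

  That the vertical and the Finsler bundle are differential bundles, and that \<open>DB(E)\<close> has
  biproducts, are three instances of a single statement, \<open>differential_structure_pullback\<close>: a
  pullback of differential bundles along linear maps over possibly different bases is again a
  differential bundle.  With \<open>0\<close> for trivial bundles, \<open>Vq\<close> is the pullback of
  \<open>p\<^sub>E \<rightarrow> p\<^sub>M \<leftarrow> 0\<^sub>M\<close>, \<open>Fq\<close> is the pullback of \<open>0\<^sub>E \<rightarrow> 0\<^sub>M \<leftarrow> p\<^sub>M\<close>, and the Whitney sum of two
  bundles over \<open>E\<close> is their pullback over \<open>0\<^sub>E\<close>.  All equational axioms are checked after the two
  projections, which are jointly monic; the universality of the lift follows because a pullback of
  pullback squares is a pullback square (\<open>pullback_of_pullbacks\<close>).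

  The identification of the addition of \<open>DB(E)\<close> rests on the fact that linear maps are additive
  (\<open>linear_additive\<close>), which in turn rests on the lift being monic.  In any biproduct
  \<open>p\<^sub>1 i\<^sub>1 + p\<^sub>2 i\<^sub>2 = id\<close> holds for the fibrewise sum (\<open>DB_product_identity\<close>), so the codiagonal is
  the fibrewise sum of the projections; conversely the Whitney sum is a biproduct.  Together these
  give \<open>arrow_sum_DB_iff\<close>.
\<close>

section \<open>Pullbacks and fibre powers in a category\<close>

definition commuting_square ::
  "('o, 'm, 'x) category_scheme \<Rightarrow> 'o \<Rightarrow> 'o \<Rightarrow> 'o \<Rightarrow> 'o \<Rightarrow> 'm \<Rightarrow> 'm \<Rightarrow> 'm \<Rightarrow> 'm \<Rightarrow> bool" where
  "commuting_square C P A B D a f b g \<longleftrightarrow>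
     a \<in> hom C P A \<and> f \<in> hom C A D \<and> b \<in> hom C P B \<and> g \<in> hom C B D \<and> a \<cdot> f = b \<cdot> g"
  for C (structure)

context category
begin

lemma commuting_square_flip:
  "commuting_square C P A B D a f b g \<Longrightarrow> commuting_square C P B A D b g a f"
  by (simp add: commuting_square_def)

lemma seq_square:
  assumes "commuting_square C P A B D a f b g" and "h \<in> hom C Y P"
  shows "(h \<cdot> a) \<cdot> f = (h \<cdot> b) \<cdot> g"
  using assms seq_assoc[of h Y P a A f D] seq_assoc[of h Y P b B g D]
  by (simp add: commuting_square_def)

lemma pullback_square:
  "pullback C A B D f g P a b \<Longrightarrow> commuting_square C P A B D a f b g"
  by (simp add: pullback_def commuting_square_def)

lemma pullback_unique:
  assumes "pullback C A B D f g P a b" and "h \<in> hom C Y P" and "h' \<in> hom C Y P"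
    and "h \<cdot> a = h' \<cdot> a" and "h \<cdot> b = h' \<cdot> b"
  shows "h = h'"
proof -
  have "h \<cdot> a \<in> hom C Y A" "h \<cdot> b \<in> hom C Y B" "(h \<cdot> a) \<cdot> f = (h \<cdot> b) \<cdot> g"
    using assms(1,2) seq_hom seq_square[OF pullback_square] by (auto simp: pullback_def)
  then have "\<exists>!k. k \<in> hom C Y P \<and> k \<cdot> a = h \<cdot> a \<and> k \<cdot> b = h \<cdot> b"
    using assms(1) by (simp add: pullback_def)
  then show ?thesis using assms(2-5) by auto
qed

lemma pullback_pairing:
  assumes "pullback C A B D f g P a b"
    and "u \<in> hom C Y A" and "v \<in> hom C Y B" and "u \<cdot> f = v \<cdot> g"
  shows "pairing C Y P a b u v \<in> hom C Y P"
    and "pairing C Y P a b u v \<cdot> a = u" and "pairing C Y P a b u v \<cdot> b = v"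
proof -
  have "\<exists>!h. h \<in> hom C Y P \<and> h \<cdot> a = u \<and> h \<cdot> b = v"
    using assms by (simp add: pullback_def)
  then have "pairing C Y P a b u v \<in> hom C Y P \<and>
      pairing C Y P a b u v \<cdot> a = u \<and> pairing C Y P a b u v \<cdot> b = v"
    unfolding pairing_def by (rule theI')
  then show "pairing C Y P a b u v \<in> hom C Y P"
    and "pairing C Y P a b u v \<cdot> a = u" and "pairing C Y P a b u v \<cdot> b = v" by auto
qed

lemma pairing_eqI:
  assumes "pullback C A B D f g P a b" and "h \<in> hom C Y P" and "h \<cdot> a = u" and "h \<cdot> b = v"
  shows "pairing C Y P a b u v = h"
proof -
  have "u \<in> hom C Y A" "v \<in> hom C Y B" "u \<cdot> f = v \<cdot> g"
    using assms seq_hom seq_square[OF pullback_square[OF assms(1)] assms(2)]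
    by (auto simp: pullback_def)
  then show ?thesis
    using pullback_pairing[OF assms(1)] pullback_unique[OF assms(1)] assms(2-4) by metis
qed

lemma pullbackI:
  assumes "commuting_square C P A B D a f b g"
    and "\<And>Y u v. u \<in> hom C Y A \<Longrightarrow> v \<in> hom C Y B \<Longrightarrow> u \<cdot> f = v \<cdot> g \<Longrightarrow>
      \<exists>h. h \<in> hom C Y P \<and> h \<cdot> a = u \<and> h \<cdot> b = v"
    and "\<And>Y h h'. h \<in> hom C Y P \<Longrightarrow> h' \<in> hom C Y P \<Longrightarrow> h \<cdot> a = h' \<cdot> a \<Longrightarrow> h \<cdot> b = h' \<cdot> b \<Longrightarrow> h = h'"
  shows "pullback C A B D f g P a b"
  using assms(1) unfolding pullback_def commuting_square_def
  by (auto intro!: ex_ex1I assms(2)) (metis assms(3))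

lemma pullback_flip:
  assumes "pullback C A B D f g P a b"
  shows "pullback C B A D g f P b a"
proof (rule pullbackI[OF commuting_square_flip[OF pullback_square[OF assms]]])
  fix Y u v
  assume "u \<in> hom C Y B" "v \<in> hom C Y A" "u \<cdot> g = v \<cdot> f"
  then show "\<exists>h. h \<in> hom C Y P \<and> h \<cdot> b = u \<and> h \<cdot> a = v"
    using pullback_pairing[OF assms, of v Y u] by auto
qed (rule pullback_unique[OF assms])

lemma pullback_of_identity:
  assumes "f \<in> hom C N A"
  shows "pullback C A N A (ide C A) f N f (ide C N)"
proof (rule pullbackI)
  show "commuting_square C N A N A f (ide C A) (ide C N) f"
    using assms hom_ob[OF assms] by (simp add: commuting_square_def ide_hom ide_seq seq_ide)
next
  fix Y u v
  assume "u \<in> hom C Y A" "v \<in> hom C Y N" "u \<cdot> ide C A = v \<cdot> f"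
  then show "\<exists>h. h \<in> hom C Y N \<and> h \<cdot> f = u \<and> h \<cdot> ide C N = v"
    by (auto simp: seq_ide)
qed (simp add: seq_ide)

text \<open>Limits commute with limits: in a cube of squares, a pullback of pullback squares is again a
  pullback square.  The suffixes \<open>A\<close>, \<open>B\<close>, \<open>D\<close> and \<open>P\<close> name four squares
  \<open>P\<^sub>i \<rightarrow> X\<^sub>i \<rightarrow> Z\<^sub>i\<close>, \<open>P\<^sub>i \<rightarrow> Y\<^sub>i \<rightarrow> Z\<^sub>i\<close>; at each of the four corners
  the objects with suffix \<open>P\<close> form the pullback of \<open>A \<rightarrow> D \<leftarrow> B\<close>.  A cone over the
  cospan \<open>X\<^sub>P \<rightarrow> Z\<^sub>P \<leftarrow> Y\<^sub>P\<close> is projected to the squares \<open>A\<close> and \<open>B\<close>, factored there, and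
  the two factorizations agree over \<open>D\<close> because \<open>P\<^sub>D\<close> is a pullback.\<close>

lemma pullback_of_pullbacks:
  assumes SA: "pullback C XA YA ZA mA nA PA xA yA"
    and SB: "pullback C XB YB ZB mB nB PB xB yB"
    and SD: "pullback C XD YD ZD mD nD PD xD yD"
    and CP: "pullback C PA PB PD gP kP PP aP bP"
    and CX: "pullback C XA XB XD gX kX XP aX bX"
    and CY: "pullback C YA YB YD gY kY YP aY bY"
    and CZ: "pullback C ZA ZB ZD gZ kZ ZP aZ bZ"
    and xg: "commuting_square C PA PD XA XD gP xD xA gX"
    and xk: "commuting_square C PB PD XB XD kP xD xB kX"
    and xa: "commuting_square C PP PA XP XA aP xA xP aX"
    and xb: "commuting_square C PP PB XP XB bP xB xP bX"
    and yg: "commuting_square C PA PD YA YD gP yD yA gY"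
    and yk: "commuting_square C PB PD YB YD kP yD yB kY"
    and ya: "commuting_square C PP PA YP YA aP yA yP aY"
    and yb: "commuting_square C PP PB YP YB bP yB yP bY"
    and ma: "commuting_square C XP XA ZP ZA aX mA mP aZ"
    and mb: "commuting_square C XP XB ZP ZB bX mB mP bZ"
    and na: "commuting_square C YP YA ZP ZA aY nA nP aZ"
    and nb: "commuting_square C YP YB ZP ZB bY nB nP bZ"
  shows "pullback C XP YP ZP mP nP PP xP yP"
proof (rule pullbackI)
  note sq = commuting_square_def
  have homs: "xP \<in> hom C PP XP" "yP \<in> hom C PP YP" "mP \<in> hom C XP ZP" "nP \<in> hom C YP ZP"
      "aP \<in> hom C PP PA" "bP \<in> hom C PP PB" "aZ \<in> hom C ZP ZA" "bZ \<in> hom C ZP ZB"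
      "aX \<in> hom C XP XA" "bX \<in> hom C XP XB" "aY \<in> hom C YP YA" "bY \<in> hom C YP YB"
      "xA \<in> hom C PA XA" "xB \<in> hom C PB XB" "yA \<in> hom C PA YA" "yB \<in> hom C PB YB"
      "gP \<in> hom C PA PD" "kP \<in> hom C PB PD"
    using xa xb ya yb ma na mb nb xg xk by (simp_all add: sq)
  have "(xP \<cdot> mP) \<cdot> aZ = (yP \<cdot> nP) \<cdot> aZ"
  proof -
    have "(xP \<cdot> mP) \<cdot> aZ = (xP \<cdot> aX) \<cdot> mA"
      using seq_square[OF ma homs(1)] by simp
    also have "\<dots> = (aP \<cdot> xA) \<cdot> mA" using xa by (simp add: sq)
    also have "\<dots> = (aP \<cdot> yA) \<cdot> nA" by (rule seq_square[OF pullback_square[OF SA] homs(5)])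
    also have "\<dots> = (yP \<cdot> aY) \<cdot> nA" using ya by (simp add: sq)
    also have "\<dots> = (yP \<cdot> nP) \<cdot> aZ"
      using seq_square[OF na homs(2)] by simp
    finally show ?thesis .
  qed
  moreover have "(xP \<cdot> mP) \<cdot> bZ = (yP \<cdot> nP) \<cdot> bZ"
  proof -
    have "(xP \<cdot> mP) \<cdot> bZ = (xP \<cdot> bX) \<cdot> mB"
      using seq_square[OF mb homs(1)] by simp
    also have "\<dots> = (bP \<cdot> xB) \<cdot> mB" using xb by (simp add: sq)
    also have "\<dots> = (bP \<cdot> yB) \<cdot> nB" by (rule seq_square[OF pullback_square[OF SB] homs(6)])
    also have "\<dots> = (yP \<cdot> bY) \<cdot> nB" using yb by (simp add: sq)
    also have "\<dots> = (yP \<cdot> nP) \<cdot> bZ"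
      using seq_square[OF nb homs(2)] by simp
    finally show ?thesis .
  qed
  ultimately show "commuting_square C PP XP YP ZP xP mP yP nP"
    using pullback_unique[OF CZ seq_hom[OF homs(1,3)] seq_hom[OF homs(2,4)]] homs
    by (simp add: sq)
next
  note sq = commuting_square_def
  fix Y u v
  assume u: "u \<in> hom C Y XP" and v: "v \<in> hom C Y YP" and uv: "u \<cdot> mP = v \<cdot> nP"
  have uA: "u \<cdot> aX \<in> hom C Y XA" "v \<cdot> aY \<in> hom C Y YA"
    and uB: "u \<cdot> bX \<in> hom C Y XB" "v \<cdot> bY \<in> hom C Y YB"
    using u v CX CY by (auto simp: pullback_def intro: seq_hom)
  have "(u \<cdot> aX) \<cdot> mA = (v \<cdot> aY) \<cdot> nA"
    using seq_square[OF ma u] seq_square[OF na v] uv by simp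
  with SA uA obtain hA where hA: "hA \<in> hom C Y PA" "hA \<cdot> xA = u \<cdot> aX" "hA \<cdot> yA = v \<cdot> aY"
    using pullback_pairing[OF SA uA] by blast
  have "(u \<cdot> bX) \<cdot> mB = (v \<cdot> bY) \<cdot> nB"
    using seq_square[OF mb u] seq_square[OF nb v] uv by simp
  with SB uB obtain hB where hB: "hB \<in> hom C Y PB" "hB \<cdot> xB = u \<cdot> bX" "hB \<cdot> yB = v \<cdot> bY"
    using pullback_pairing[OF SB uB] by blast
  have "hA \<cdot> gP = hB \<cdot> kP"
  proof (rule pullback_unique[OF SD])
    show "hA \<cdot> gP \<in> hom C Y PD" "hB \<cdot> kP \<in> hom C Y PD"
      using hA hB CP by (auto simp: pullback_def intro: seq_hom)
    show "(hA \<cdot> gP) \<cdot> xD = (hB \<cdot> kP) \<cdot> xD"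
      using seq_square[OF xg hA(1)] seq_square[OF xk hB(1)] seq_square[OF pullback_square[OF CX] u]
        hA(2) hB(2) by simp
    show "(hA \<cdot> gP) \<cdot> yD = (hB \<cdot> kP) \<cdot> yD"
      using seq_square[OF yg hA(1)] seq_square[OF yk hB(1)] seq_square[OF pullback_square[OF CY] v]
        hA(3) hB(3) by simp
  qed
  then obtain h where h: "h \<in> hom C Y PP" "h \<cdot> aP = hA" "h \<cdot> bP = hB"
    using pullback_pairing[OF CP hA(1) hB(1)] by blast
  have "h \<cdot> xP = u"
  proof (rule pullback_unique[OF CX _ u])
    show "h \<cdot> xP \<in> hom C Y XP" using h xa by (auto simp: sq intro: seq_hom)
    show "(h \<cdot> xP) \<cdot> aX = u \<cdot> aX" using seq_square[OF xa h(1)] h hA by simp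
    show "(h \<cdot> xP) \<cdot> bX = u \<cdot> bX" using seq_square[OF xb h(1)] h hB by simp
  qed
  moreover have "h \<cdot> yP = v"
  proof (rule pullback_unique[OF CY _ v])
    show "h \<cdot> yP \<in> hom C Y YP" using h ya by (auto simp: sq intro: seq_hom)
    show "(h \<cdot> yP) \<cdot> aY = v \<cdot> aY" using seq_square[OF ya h(1)] h hA by simp
    show "(h \<cdot> yP) \<cdot> bY = v \<cdot> bY" using seq_square[OF yb h(1)] h hB by simp
  qed
  ultimately show "\<exists>h. h \<in> hom C Y PP \<and> h \<cdot> xP = u \<and> h \<cdot> yP = v" using h by blast
next
  fix Y h h'
  assume h: "h \<in> hom C Y PP" and h': "h' \<in> hom C Y PP"
    and e: "h \<cdot> xP = h' \<cdot> xP" "h \<cdot> yP = h' \<cdot> yP"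
  have hom: "aP \<in> hom C PP PA" "bP \<in> hom C PP PB" using CP by (auto simp: pullback_def)
  show "h = h'"
  proof (rule pullback_unique[OF CP h h'])
    show "h \<cdot> aP = h' \<cdot> aP"
      using pullback_unique[OF SA seq_hom[OF h hom(1)] seq_hom[OF h' hom(1)]]
        seq_square[OF xa h] seq_square[OF xa h'] seq_square[OF ya h] seq_square[OF ya h'] e by simp
    show "h \<cdot> bP = h' \<cdot> bP"
      using pullback_unique[OF SB seq_hom[OF h hom(2)] seq_hom[OF h' hom(2)]]
        seq_square[OF xb h] seq_square[OF xb h'] seq_square[OF yb h] seq_square[OF yb h'] e by simp
  qed
qed

text \<open>The pullback of a composite can be formed in two steps, first along its second factor.\<close>

lemma pullback_paste:
  assumes lower: "pullback C N K D f' g Q c d" and upper: "pullback C A Q N f c R a b"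
  shows "pullback C A K D (f \<cdot> f') g R a (b \<cdot> d)"
proof (rule pullbackI)
  have homs: "f \<in> hom C A N" "f' \<in> hom C N D" "a \<in> hom C R A" "b \<in> hom C R Q" "c \<in> hom C Q N"
      "d \<in> hom C Q K" "g \<in> hom C K D" and eq: "c \<cdot> f' = d \<cdot> g" "a \<cdot> f = b \<cdot> c"
    using assms by (auto simp: pullback_def)
  have "a \<cdot> (f \<cdot> f') = (b \<cdot> d) \<cdot> g"
    using seq_assoc[OF homs(3,1,2)] seq_assoc[OF homs(4,5,2)] seq_assoc[OF homs(4,6,7)] eq by simp
  then show "commuting_square C R A K D a (f \<cdot> f') (b \<cdot> d) g"
    using homs seq_hom by (auto simp: commuting_square_def)
  fix Y u v
  assume u: "u \<in> hom C Y A" and v: "v \<in> hom C Y K" and "u \<cdot> (f \<cdot> f') = v \<cdot> g"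
  then have "(u \<cdot> f) \<cdot> f' = v \<cdot> g" using seq_assoc[OF u homs(1,2)] by simp
  then obtain h where h: "h \<in> hom C Y Q" "h \<cdot> c = u \<cdot> f" "h \<cdot> d = v"
    using pullback_pairing[OF lower seq_hom[OF u homs(1)] v] by blast
  then obtain k where k: "k \<in> hom C Y R" "k \<cdot> a = u" "k \<cdot> b = h"
    using pullback_pairing[OF upper u h(1)] by metis
  then show "\<exists>k. k \<in> hom C Y R \<and> k \<cdot> a = u \<and> k \<cdot> (b \<cdot> d) = v"
    using seq_assoc[OF k(1) homs(4,6)] h by auto
next
  have homs: "b \<in> hom C R Q" "c \<in> hom C Q N" "d \<in> hom C Q K"
    using assms by (auto simp: pullback_def)
  fix Y h h'
  assume h: "h \<in> hom C Y R" "h' \<in> hom C Y R" "h \<cdot> a = h' \<cdot> a" "h \<cdot> (b \<cdot> d) = h' \<cdot> (b \<cdot> d)"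
  show "h = h'"
  proof (rule pullback_unique[OF upper h(1-3)])
    show "h \<cdot> b = h' \<cdot> b"
      using pullback_unique[OF lower seq_hom[OF h(1) homs(1)] seq_hom[OF h(2) homs(1)]]
        seq_square[OF pullback_square[OF upper] h(1)] seq_square[OF pullback_square[OF upper] h(2)]
        h(3,4) seq_assoc[OF h(1) homs(1,3)] seq_assoc[OF h(2) homs(1,3)] by simp
  qed
qed

text \<open>Given the right-hand square \<open>P\<close>, the outer rectangle being a pullback makes the left-hand
  square one.\<close>

lemma pullback_cancel:
  assumes P: "pullback C A B D f g P a b" and k: "k \<in> hom C K A"
    and Q: "pullback C K B D (k \<cdot> f) g Q d c"
    and h: "h \<in> hom C Q P" and ha: "h \<cdot> a = d \<cdot> k" and hb: "h \<cdot> b = c"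
  shows "pullback C P K A a k Q h d"
proof (rule pullbackI)
  have homs: "f \<in> hom C A D" "a \<in> hom C P A" "b \<in> hom C P B" "g \<in> hom C B D" "d \<in> hom C Q K"
    and eq: "a \<cdot> f = b \<cdot> g"
    using P Q by (auto simp: pullback_def)
  show "commuting_square C Q P K A h a d k"
    using homs h k ha by (simp add: commuting_square_def)
  {
    fix Y u v
    assume u: "u \<in> hom C Y P" and v: "v \<in> hom C Y K" and uv: "u \<cdot> a = v \<cdot> k"
    have "v \<cdot> (k \<cdot> f) = (u \<cdot> b) \<cdot> g"
      using seq_assoc[OF v k homs(1)] seq_square[OF pullback_square[OF P] u] uv by simp
    then obtain w where w: "w \<in> hom C Y Q" "w \<cdot> d = v" "w \<cdot> c = u \<cdot> b"
      using pullback_pairing[OF Q v seq_hom[OF u homs(3)]] by blast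
    have "w \<cdot> h = u"
      using pullback_unique[OF P seq_hom[OF w(1) h] u] seq_assoc[OF w(1) h homs(2)]
        seq_assoc[OF w(1) h homs(3)] seq_assoc[OF w(1) homs(5) k] ha hb w uv by simp
    with w show "\<exists>w. w \<in> hom C Y Q \<and> w \<cdot> h = u \<and> w \<cdot> d = v" by blast
  }
  fix Y w w'
  assume w: "w \<in> hom C Y Q" "w' \<in> hom C Y Q" "w \<cdot> h = w' \<cdot> h" "w \<cdot> d = w' \<cdot> d"
  have "w \<cdot> c = w' \<cdot> c"
    using seq_assoc[OF w(1) h homs(3)] seq_assoc[OF w(2) h homs(3)] hb w(3) by simp
  then show "w = w'" by (rule pullback_unique[OF Q w(1,2,4)])
qed

lemma fibre_power_0:
  assumes "q \<in> hom C E M"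
  shows "fibre_power C E M q 0 M (ide C M) pr"
  using assms hom_ob[OF assms] by (auto simp: fibre_power_def ide_hom seq_ide)

lemma fibre_power_cong:
  assumes "\<And>i. i < n \<Longrightarrow> pr i = pr' i"
  shows "fibre_power C E M q n P w pr \<longleftrightarrow> fibre_power C E M q n P w pr'"
  using assms by (simp add: fibre_power_def cong: conj_cong imp_cong)

text \<open>The fibre power grows by one factor on pulling \<open>q\<close> back along the structure arrow of the
  previous one; the new factor is the last projection.\<close>

lemma fibre_power_Suc:
  assumes F: "fibre_power C E M q n P w pr" and Q: "pullback C E P M q w Q a b"
  shows "fibre_power C E M q (Suc n) Q (b \<cdot> w) (\<lambda>i. if i < n then b \<cdot> pr i else a)"
proof -
  have homs: "q \<in> hom C E M" "w \<in> hom C P M" "a \<in> hom C Q E" "b \<in> hom C Q P" and aq: "a \<cdot> q = b \<cdot> w"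
    using Q by (auto simp: pullback_def)
  have pr: "pr i \<in> hom C P E" "pr i \<cdot> q = w" if "i < n" for i
    using F that by (auto simp: fibre_power_def)
  have ex: "\<exists>!h. h \<in> hom C Y P \<and> h \<cdot> w = u \<and> (\<forall>i<n. h \<cdot> pr i = v i)"
    if "u \<in> hom C Y M" "\<And>i. i < n \<Longrightarrow> v i \<in> hom C Y E \<and> v i \<cdot> q = u" for Y u v
    using F that by (simp add: fibre_power_def)
  let ?pr = "\<lambda>i. if i < n then b \<cdot> pr i else a"
  have 1: "?pr i \<in> hom C Q E \<and> ?pr i \<cdot> q = b \<cdot> w" if "i < Suc n" for i
    using that homs pr[of i] aq seq_hom[of b Q P "pr i" E] seq_assoc[of b Q P "pr i" E q M] by auto
  have 2: "\<exists>!h. h \<in> hom C Y Q \<and> h \<cdot> (b \<cdot> w) = u \<and> (\<forall>i<Suc n. h \<cdot> ?pr i = v i)"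
    if u: "u \<in> hom C Y M" and v: "\<forall>i<Suc n. v i \<in> hom C Y E \<and> v i \<cdot> q = u" for Y u v
  proof (rule ex_ex1I)
    obtain h where h: "h \<in> hom C Y P" "h \<cdot> w = u" "\<forall>i<n. h \<cdot> pr i = v i"
      using ex[OF u, of v] v by auto
    obtain k where k: "k \<in> hom C Y Q" "k \<cdot> a = v n" "k \<cdot> b = h"
      using pullback_pairing[OF Q _ h(1), of "v n"] v h(2) by auto
    have "k \<cdot> ?pr i = v i" if "i < Suc n" for i
      using that h(3) k(2,3) seq_assoc[OF k(1) homs(4) pr(1)[of i]] by (auto simp: less_Suc_eq)
    then show "\<exists>h. h \<in> hom C Y Q \<and> h \<cdot> (b \<cdot> w) = u \<and> (\<forall>i<Suc n. h \<cdot> ?pr i = v i)"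
    proof (intro exI conjI)
      show "k \<in> hom C Y Q" by (rule k(1))
      show "k \<cdot> (b \<cdot> w) = u" using k(3) h(2) seq_assoc[OF k(1) homs(4,2)] by simp
    qed blast
  next
    fix h h'
    assume h: "h \<in> hom C Y Q \<and> h \<cdot> (b \<cdot> w) = u \<and> (\<forall>i<Suc n. h \<cdot> ?pr i = v i)"
      and h': "h' \<in> hom C Y Q \<and> h' \<cdot> (b \<cdot> w) = u \<and> (\<forall>i<Suc n. h' \<cdot> ?pr i = v i)"
    have *: "k \<cdot> b \<in> hom C Y P \<and> (k \<cdot> b) \<cdot> w = u \<and> (\<forall>i<n. (k \<cdot> b) \<cdot> pr i = v i)"
      if "k \<in> hom C Y Q \<and> k \<cdot> (b \<cdot> w) = u \<and> (\<forall>i<Suc n. k \<cdot> ?pr i = v i)" for k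
    proof (intro conjI allI impI)
      have k: "k \<in> hom C Y Q" using that by blast
      show "k \<cdot> b \<in> hom C Y P" by (rule seq_hom[OF k homs(4)])
      show "(k \<cdot> b) \<cdot> w = u" using that seq_assoc[OF k homs(4,2)] by simp
      fix i assume "i < n"
      then have "k \<cdot> ?pr i = v i" using that less_SucI by blast
      then show "(k \<cdot> b) \<cdot> pr i = v i"
        using \<open>i < n\<close> seq_assoc[OF k homs(4) pr(1)] by simp
    qed
    have "h \<cdot> b = h' \<cdot> b" using ex[OF u, of v] v *[OF h] *[OF h'] by auto
    moreover have "h \<cdot> a = h' \<cdot> a" using h[THEN conjunct2, THEN conjunct2, rule_format, of n]
        h'[THEN conjunct2, THEN conjunct2, rule_format, of n] by simp
    ultimately show "h = h'" using pullback_unique[OF Q, of h Y h'] h h' by auto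
  qed
  show ?thesis
    unfolding fibre_power_def using homs 1 2 seq_hom[OF homs(4,2)] by blast
qed

end

section \<open>Tangent pullbacks and display maps\<close>

context tangent_category
begin

lemma Tn_ob: "A \<in> ob X \<Longrightarrow> (T\<^sub>o ^^ m) A \<in> ob X"
  by (induction m) (auto intro: T_obj)

lemma Tn_hom: "f \<in> hom X A B \<Longrightarrow> (T\<^sub>a ^^ m) f \<in> hom X ((T\<^sub>o ^^ m) A) ((T\<^sub>o ^^ m) B)"
  by (induction m) (auto intro: T_hom)

lemma Tn_ide: "A \<in> ob X \<Longrightarrow> (T\<^sub>a ^^ m) (ide X A) = ide X ((T\<^sub>o ^^ m) A)"
  by (induction m) (auto simp: T_ide Tn_ob)

lemma Tn_seq:
  "f \<in> hom X A B \<Longrightarrow> g \<in> hom X B D \<Longrightarrow> (T\<^sub>a ^^ m) (f \<cdot> g) = (T\<^sub>a ^^ m) f \<cdot> (T\<^sub>a ^^ m) g"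
  by (induction m) (auto simp: T_seq[OF Tn_hom Tn_hom])

lemma Tn_square:
  assumes "commuting_square X P A B D a f b g"
  shows "commuting_square X ((T\<^sub>o ^^ m) P) ((T\<^sub>o ^^ m) A) ((T\<^sub>o ^^ m) B) ((T\<^sub>o ^^ m) D)
    ((T\<^sub>a ^^ m) a) ((T\<^sub>a ^^ m) f) ((T\<^sub>a ^^ m) b) ((T\<^sub>a ^^ m) g)"
proof -
  have homs: "a \<in> hom X P A" "f \<in> hom X A D" "b \<in> hom X P B" "g \<in> hom X B D" and "a \<cdot> f = b \<cdot> g"
    using assms by (auto simp: commuting_square_def)
  then show ?thesis
    using Tn_seq[OF homs(1,2), of m] Tn_seq[OF homs(3,4), of m]
    by (simp add: commuting_square_def Tn_hom)
qed

lemma tangent_pullback_at: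
  "tangent_pullback X A B D f g P a b \<Longrightarrow>
   pullback X ((T\<^sub>o ^^ m) A) ((T\<^sub>o ^^ m) B) ((T\<^sub>o ^^ m) D) ((T\<^sub>a ^^ m) f) ((T\<^sub>a ^^ m) g)
     ((T\<^sub>o ^^ m) P) ((T\<^sub>a ^^ m) a) ((T\<^sub>a ^^ m) b)"
  by (simp add: tangent_pullback_def)

lemma tangent_pullback_pullback:
  "tangent_pullback X A B D f g P a b \<Longrightarrow> pullback X A B D f g P a b"
  using tangent_pullback_at[of A B D f g P a b 0] by simp

lemma tangent_pullback_shift:
  assumes "tangent_pullback X A B D f g P a b"
  shows "tangent_pullback X ((T\<^sub>o ^^ n) A) ((T\<^sub>o ^^ n) B) ((T\<^sub>o ^^ n) D) ((T\<^sub>a ^^ n) f) ((T\<^sub>a ^^ n) g)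
     ((T\<^sub>o ^^ n) P) ((T\<^sub>a ^^ n) a) ((T\<^sub>a ^^ n) b)"
  unfolding tangent_pullback_def
proof
  fix m
  show "pullback X ((T\<^sub>o ^^ m) ((T\<^sub>o ^^ n) A)) ((T\<^sub>o ^^ m) ((T\<^sub>o ^^ n) B)) ((T\<^sub>o ^^ m) ((T\<^sub>o ^^ n) D))
     ((T\<^sub>a ^^ m) ((T\<^sub>a ^^ n) f)) ((T\<^sub>a ^^ m) ((T\<^sub>a ^^ n) g))
     ((T\<^sub>o ^^ m) ((T\<^sub>o ^^ n) P)) ((T\<^sub>a ^^ m) ((T\<^sub>a ^^ n) a)) ((T\<^sub>a ^^ m) ((T\<^sub>a ^^ n) b))"
    using tangent_pullback_at[OF assms, of "m + n"] by (simp add: funpow_add)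
qed

lemma tangent_pullback_T:
  assumes "tangent_pullback X A B D f g P a b"
  shows "tangent_pullback X (T\<^sub>o A) (T\<^sub>o B) (T\<^sub>o D) (T\<^sub>a f) (T\<^sub>a g) (T\<^sub>o P) (T\<^sub>a a) (T\<^sub>a b)"
  using tangent_pullback_shift[OF assms, of 1] by simp

lemma tangent_pullback_flip:
  "tangent_pullback X A B D f g P a b \<Longrightarrow> tangent_pullback X B A D g f P b a"
  by (simp add: tangent_pullback_def pullback_flip)

lemma tangent_pullback_of_identity:
  assumes "f \<in> hom X N A"
  shows "tangent_pullback X A N A (ide X A) f N f (ide X N)"
  unfolding tangent_pullback_def
  using hom_ob[OF assms] pullback_of_identity[OF Tn_hom[OF assms]] by (simp add: Tn_ide)

lemma tangent_pullback_of_pullbacks: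
  assumes "tangent_pullback X XA YA ZA mA nA PA xA yA"
    and "tangent_pullback X XB YB ZB mB nB PB xB yB"
    and "tangent_pullback X XD YD ZD mD nD PD xD yD"
    and "tangent_pullback X PA PB PD gP kP PP aP bP"
    and "tangent_pullback X XA XB XD gX kX XP aX bX"
    and "tangent_pullback X YA YB YD gY kY YP aY bY"
    and "tangent_pullback X ZA ZB ZD gZ kZ ZP aZ bZ"
    and "commuting_square X PA PD XA XD gP xD xA gX"
    and "commuting_square X PB PD XB XD kP xD xB kX"
    and "commuting_square X PP PA XP XA aP xA xP aX"
    and "commuting_square X PP PB XP XB bP xB xP bX"
    and "commuting_square X PA PD YA YD gP yD yA gY"
    and "commuting_square X PB PD YB YD kP yD yB kY"
    and "commuting_square X PP PA YP YA aP yA yP aY"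
    and "commuting_square X PP PB YP YB bP yB yP bY"
    and "commuting_square X XP XA ZP ZA aX mA mP aZ"
    and "commuting_square X XP XB ZP ZB bX mB mP bZ"
    and "commuting_square X YP YA ZP ZA aY nA nP aZ"
    and "commuting_square X YP YB ZP ZB bY nB nP bZ"
  shows "tangent_pullback X XP YP ZP mP nP PP xP yP"
  unfolding tangent_pullback_def
  by (intro allI pullback_of_pullbacks[OF assms(1-7)[THEN tangent_pullback_at]
        assms(8-19)[THEN Tn_square]])

lemma tangent_pullback_paste:
  assumes lower: "tangent_pullback X N K D f' g Q c d"
    and upper: "tangent_pullback X A Q N f c R a b"
  shows "tangent_pullback X A K D (f \<cdot> f') g R a (b \<cdot> d)"
proof -
  have homs: "f \<in> hom X A N" "f' \<in> hom X N D" "b \<in> hom X R Q" "d \<in> hom X Q K"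
    using assms[THEN tangent_pullback_pullback] by (auto simp: pullback_def)
  show ?thesis
    unfolding tangent_pullback_def Tn_seq[OF homs(1,2)] Tn_seq[OF homs(3,4)]
    using assms[THEN tangent_pullback_at] pullback_paste by blast
qed

lemma tangent_pullback_cancel:
  assumes P: "tangent_pullback X A B D f g P a b" and k: "k \<in> hom X K A"
    and Q: "tangent_pullback X K B D (k \<cdot> f) g Q d c"
    and h: "h \<in> hom X Q P" and ha: "h \<cdot> a = d \<cdot> k" and hb: "h \<cdot> b = c"
  shows "tangent_pullback X P K A a k Q h d"
  unfolding tangent_pullback_def
proof
  fix m
  have homs: "f \<in> hom X A D" "a \<in> hom X P A" "b \<in> hom X P B" "d \<in> hom X Q K"
    using P[THEN tangent_pullback_pullback] Q[THEN tangent_pullback_pullback]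
    by (auto simp: pullback_def)
  show "pullback X ((T\<^sub>o ^^ m) P) ((T\<^sub>o ^^ m) K) ((T\<^sub>o ^^ m) A) ((T\<^sub>a ^^ m) a) ((T\<^sub>a ^^ m) k)
     ((T\<^sub>o ^^ m) Q) ((T\<^sub>a ^^ m) h) ((T\<^sub>a ^^ m) d)"
  proof (rule pullback_cancel[OF tangent_pullback_at[OF P] Tn_hom[OF k]])
    show "pullback X ((T\<^sub>o ^^ m) K) ((T\<^sub>o ^^ m) B) ((T\<^sub>o ^^ m) D) ((T\<^sub>a ^^ m) k \<cdot> (T\<^sub>a ^^ m) f)
       ((T\<^sub>a ^^ m) g) ((T\<^sub>o ^^ m) Q) ((T\<^sub>a ^^ m) d) ((T\<^sub>a ^^ m) c)"
      using tangent_pullback_at[OF Q, of m] Tn_seq[OF k homs(1)] by simp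
    show "(T\<^sub>a ^^ m) h \<in> hom X ((T\<^sub>o ^^ m) Q) ((T\<^sub>o ^^ m) P)" by (rule Tn_hom[OF h])
    show "(T\<^sub>a ^^ m) h \<cdot> (T\<^sub>a ^^ m) a = (T\<^sub>a ^^ m) d \<cdot> (T\<^sub>a ^^ m) k"
      using Tn_seq[OF h homs(2)] Tn_seq[OF homs(4) k] ha by simp
    show "(T\<^sub>a ^^ m) h \<cdot> (T\<^sub>a ^^ m) b = (T\<^sub>a ^^ m) c"
      using Tn_seq[OF h homs(3)] hb by simp
  qed
qed

lemma tangent_displayD:
  assumes "tangent_display X E M q" and "f \<in> hom X N ((T\<^sub>o ^^ n) M)"
  obtains P a b where
    "tangent_pullback X ((T\<^sub>o ^^ n) E) N ((T\<^sub>o ^^ n) M) ((T\<^sub>a ^^ n) q) f P a b"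
  using assms unfolding tangent_display_def by blast

lemma display_pullback:
  assumes "tangent_display X E M q" and "f \<in> hom X N M"
  obtains P a b where "tangent_pullback X E N M q f P a b"
  using tangent_displayD[OF assms(1), of f N 0] assms(2) by auto

lemma display_identity: "E \<in> ob X \<Longrightarrow> tangent_display X E E (ide X E)"
  unfolding tangent_display_def
  using tangent_pullback_of_identity by (simp add: ide_hom Tn_ide) blast

lemma display_seq:
  assumes q: "tangent_display X E M q" and r: "tangent_display X M N r"
  shows "tangent_display X E N (q \<cdot> r)"
proof -
  have homs: "q \<in> hom X E M" "r \<in> hom X M N"
    using q r by (auto simp: tangent_display_def)
  have "\<exists>P a b. tangent_pullback X ((T\<^sub>o ^^ n) E) K ((T\<^sub>o ^^ n) N) ((T\<^sub>a ^^ n) (q \<cdot> r)) f P a b"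
    if f: "f \<in> hom X K ((T\<^sub>o ^^ n) N)" for n K f
  proof -
    obtain Q c d where Q: "tangent_pullback X ((T\<^sub>o ^^ n) M) K ((T\<^sub>o ^^ n) N) ((T\<^sub>a ^^ n) r) f Q c d"
      using tangent_displayD[OF r f] .
    then have "c \<in> hom X Q ((T\<^sub>o ^^ n) M)"
      using tangent_pullback_pullback by (auto simp: pullback_def)
    then obtain R a b where
      "tangent_pullback X ((T\<^sub>o ^^ n) E) Q ((T\<^sub>o ^^ n) M) ((T\<^sub>a ^^ n) q) c R a b"
      using tangent_displayD[OF q] by blast
    from tangent_pullback_paste[OF Q this] show ?thesis
      using Tn_seq[OF homs] by auto
  qed
  then show ?thesis using seq_hom[OF homs] by (simp add: tangent_display_def)
qed

text \<open>By pasting, a pullback of the pulled-back arrow along \<open>k\<close> is a pullback of the original arrow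
  along a composite, which exists because that arrow is a display map.\<close>

lemma display_stable:
  assumes r: "tangent_display X B D r" and P: "tangent_pullback X A B D f r P a b"
  shows "tangent_display X P A a"
proof -
  have homs: "f \<in> hom X A D" "a \<in> hom X P A"
    using P[THEN tangent_pullback_pullback] by (auto simp: pullback_def)
  have "\<exists>Q h d. tangent_pullback X ((T\<^sub>o ^^ n) P) K ((T\<^sub>o ^^ n) A) ((T\<^sub>a ^^ n) a) k Q h d"
    if k: "k \<in> hom X K ((T\<^sub>o ^^ n) A)" for n K k
  proof -
    let ?f = "(T\<^sub>a ^^ n) f"
    note Pn = tangent_pullback_shift[OF P, of n]
    obtain Q c d where
      Q: "tangent_pullback X ((T\<^sub>o ^^ n) B) K ((T\<^sub>o ^^ n) D) ((T\<^sub>a ^^ n) r) (k \<cdot> ?f) Q c d"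
      using tangent_displayD[OF r seq_hom[OF k Tn_hom[OF homs(1)]]] .
    note Q0 = tangent_pullback_pullback[OF Q]
    have cd: "c \<in> hom X Q ((T\<^sub>o ^^ n) B)" "d \<in> hom X Q K"
      "c \<cdot> (T\<^sub>a ^^ n) r = d \<cdot> (k \<cdot> ?f)"
      using Q0 by (auto simp: pullback_def)
    have "(d \<cdot> k) \<cdot> ?f = c \<cdot> (T\<^sub>a ^^ n) r"
      using seq_assoc[OF cd(2) k Tn_hom[OF homs(1)]] cd(3) by simp
    note h = pullback_pairing[OF tangent_pullback_pullback[OF Pn] seq_hom[OF cd(2) k] cd(1) this]
    show ?thesis
      using tangent_pullback_cancel[OF Pn k tangent_pullback_flip[OF Q] h] by blast
  qed
  then show ?thesis using homs by (simp add: tangent_display_def)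
qed

text \<open>Iterated pullbacks of a display map along itself are tangent pullbacks at every step, so the
  condition on fibre powers in the definition of a differential bundle comes with display.\<close>

lemma display_fibre_powers:
  assumes q: "tangent_display X E M q"
  shows "has_tangent_fibre_powers X E M q"
proof -
  have qh: "q \<in> hom X E M" using q by (simp add: tangent_display_def)
  have "\<exists>P w pr. \<forall>m. fibre_power X ((T\<^sub>o ^^ m) E) ((T\<^sub>o ^^ m) M) ((T\<^sub>a ^^ m) q) n
        ((T\<^sub>o ^^ m) P) ((T\<^sub>a ^^ m) w) (\<lambda>i. (T\<^sub>a ^^ m) (pr i))" for n
  proof (induction n)
    case 0
    have "fibre_power X ((T\<^sub>o ^^ m) E) ((T\<^sub>o ^^ m) M) ((T\<^sub>a ^^ m) q) 0
        ((T\<^sub>o ^^ m) M) ((T\<^sub>a ^^ m) (ide X M)) (\<lambda>i. (T\<^sub>a ^^ m) (pr i))" for m pr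
      using fibre_power_0[OF Tn_hom[OF qh]] hom_ob[OF qh] by (simp add: Tn_ide)
    then show ?case by blast
  next
    case (Suc n)
    then obtain P w pr where
      F: "\<And>m. fibre_power X ((T\<^sub>o ^^ m) E) ((T\<^sub>o ^^ m) M) ((T\<^sub>a ^^ m) q) n
        ((T\<^sub>o ^^ m) P) ((T\<^sub>a ^^ m) w) (\<lambda>i. (T\<^sub>a ^^ m) (pr i))" by blast
    from F[of 0] have wh: "w \<in> hom X P M" and prh: "\<And>i. i < n \<Longrightarrow> pr i \<in> hom X P E"
      by (auto simp: fibre_power_def)
    obtain Q a b where Q: "tangent_pullback X E P M q w Q a b"
      using display_pullback[OF q wh] .
    have b: "b \<in> hom X Q P" using Q[THEN tangent_pullback_pullback] by (auto simp: pullback_def)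
    have "fibre_power X ((T\<^sub>o ^^ m) E) ((T\<^sub>o ^^ m) M) ((T\<^sub>a ^^ m) q) (Suc n) ((T\<^sub>o ^^ m) Q)
        ((T\<^sub>a ^^ m) (b \<cdot> w)) (\<lambda>i. (T\<^sub>a ^^ m) (if i < n then b \<cdot> pr i else a))" for m
    proof -
      have "fibre_power X ((T\<^sub>o ^^ m) E) ((T\<^sub>o ^^ m) M) ((T\<^sub>a ^^ m) q) (Suc n) ((T\<^sub>o ^^ m) Q)
          ((T\<^sub>a ^^ m) b \<cdot> (T\<^sub>a ^^ m) w)
          (\<lambda>i. if i < n then (T\<^sub>a ^^ m) b \<cdot> (T\<^sub>a ^^ m) (pr i) else (T\<^sub>a ^^ m) a)"
        by (rule fibre_power_Suc[OF F tangent_pullback_at[OF Q]])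
      then show ?thesis
        using fibre_power_cong[of "Suc n"
            "\<lambda>i. if i < n then (T\<^sub>a ^^ m) b \<cdot> (T\<^sub>a ^^ m) (pr i) else (T\<^sub>a ^^ m) a"
            "\<lambda>i. (T\<^sub>a ^^ m) (if i < n then b \<cdot> pr i else a)"]
          Tn_seq[OF b wh] Tn_seq[OF b prh] by simp
    qed
    then show ?case
      by (intro exI[of _ Q] exI[of _ "b \<cdot> w"] exI[of _ "\<lambda>i. if i < n then b \<cdot> pr i else a"] allI)
  qed
  then show ?thesis by (simp add: has_tangent_fibre_powers_def)
qed

end

section \<open>Fibrewise sums\<close>

text \<open>The part of an additive bundle on which sums of generalized elements depend, without the monoid
  laws; in contrast to these it passes at once from a bundle to its image under \<open>T\<close>.\<close>

definition preadditive_bundle :: "('o, 'm) tangent \<Rightarrow> ('o, 'm, 'y) add_bundle_scheme \<Rightarrow> bool" where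
  "preadditive_bundle X b \<longleftrightarrow>
     tangent_pullback X (totB b) (totB b) (baseB b) (projB b) (projB b)
       (totB2 b) (prB1 b) (prB2 b) \<and>
     zeroB b \<in> hom X (baseB b) (totB b) \<and> zeroB b \<cdot> projB b = ide X (baseB b) \<and>
     sumB b \<in> hom X (totB2 b) (totB b) \<and> sumB b \<cdot> projB b = prB1 b \<cdot> projB b"
  for X (structure)

lemma T_bundle_simps [simp]:
  "totB (T_bundle X b) = T_ob X (totB b)" "baseB (T_bundle X b) = T_ob X (baseB b)"
  "projB (T_bundle X b) = T_ar X (projB b)" "totB2 (T_bundle X b) = T_ob X (totB2 b)"
  "prB1 (T_bundle X b) = T_ar X (prB1 b)" "prB2 (T_bundle X b) = T_ar X (prB2 b)"
  "zeroB (T_bundle X b) = T_ar X (zeroB b)" "sumB (T_bundle X b) = T_ar X (sumB b)"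
  by (simp_all add: T_bundle_def)

lemma tangent_bundle_simps [simp]:
  "totB (tangent_bundle X M) = T_ob X M" "baseB (tangent_bundle X M) = M"
  "projB (tangent_bundle X M) = tan_p X M" "totB2 (tangent_bundle X M) = tan_2 X M"
  "prB1 (tangent_bundle X M) = tan_pr1 X M" "prB2 (tangent_bundle X M) = tan_pr2 X M"
  "zeroB (tangent_bundle X M) = tan_z X M" "sumB (tangent_bundle X M) = tan_s X M"
  "liftB (tangent_bundle X M) = tan_l X M"
  by (simp_all add: tangent_bundle_def)

lemma trivial_bundle_simps [simp]:
  "totB (trivial_bundle X E) = E" "baseB (trivial_bundle X E) = E"
  "projB (trivial_bundle X E) = ide X E" "totB2 (trivial_bundle X E) = E"
  "prB1 (trivial_bundle X E) = ide X E" "prB2 (trivial_bundle X E) = ide X E"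
  "zeroB (trivial_bundle X E) = ide X E" "sumB (trivial_bundle X E) = ide X E"
  "liftB (trivial_bundle X E) = tan_z X E"
  by (simp_all add: trivial_bundle_def)

context tangent_category
begin

lemma preadditive_bundle_homs:
  assumes "preadditive_bundle X b"
  shows "totB b \<in> ob X" and "baseB b \<in> ob X" and "totB2 b \<in> ob X"
    and "projB b \<in> hom X (totB b) (baseB b)" and "zeroB b \<in> hom X (baseB b) (totB b)"
    and "prB1 b \<in> hom X (totB2 b) (totB b)" and "prB2 b \<in> hom X (totB2 b) (totB b)"
    and "sumB b \<in> hom X (totB2 b) (totB b)"
  using assms[unfolded preadditive_bundle_def] tangent_pullback_pullback hom_ob
  by (auto simp: pullback_def)

lemma preadditive_bundle_pullback:
  "preadditive_bundle X b \<Longrightarrow>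
   pullback X (totB b) (totB b) (baseB b) (projB b) (projB b) (totB2 b) (prB1 b) (prB2 b)"
  by (simp add: preadditive_bundle_def tangent_pullback_pullback)

lemma preadditive_bundle_T:
  assumes "preadditive_bundle X b"
  shows "preadditive_bundle X (T_bundle X b)"
proof -
  note h = preadditive_bundle_homs[OF assms]
  have eq: "zeroB b \<cdot> projB b = ide X (baseB b)" "sumB b \<cdot> projB b = prB1 b \<cdot> projB b"
    using assms by (auto simp: preadditive_bundle_def)
  have "T\<^sub>a (zeroB b) \<cdot> T\<^sub>a (projB b) = ide X (T\<^sub>o (baseB b))"
    using T_seq[OF h(5,4)] T_ide[OF h(2)] eq by simp
  moreover have "T\<^sub>a (sumB b) \<cdot> T\<^sub>a (projB b) = T\<^sub>a (prB1 b) \<cdot> T\<^sub>a (projB b)"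
    using T_seq[OF h(8,4)] T_seq[OF h(6,4)] eq by simp
  ultimately show ?thesis
    using assms by (simp add: preadditive_bundle_def tangent_pullback_T T_hom)
qed

lemma preadditive_tangent_bundle: "M \<in> ob X \<Longrightarrow> preadditive_bundle X (tangent_bundle X M)"
  using tangent_2[of M] p_additive[of M]
  by (simp add: preadditive_bundle_def additive_bundle_def)

lemma fib_sum_hom:
  assumes b: "preadditive_bundle X b" and u: "u \<in> hom X Y (totB b)" and v: "v \<in> hom X Y (totB b)"
    and uv: "u \<cdot> projB b = v \<cdot> projB b"
  shows "fib_sum X b Y u v \<in> hom X Y (totB b)"
    and "fib_sum X b Y u v \<cdot> projB b = u \<cdot> projB b"
proof -
  note h = preadditive_bundle_homs[OF b]
  note p = pullback_pairing[OF preadditive_bundle_pullback[OF b] u v uv]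
  show "fib_sum X b Y u v \<in> hom X Y (totB b)"
    unfolding fib_sum_def by (rule seq_hom[OF p(1) h(8)])
  show "fib_sum X b Y u v \<cdot> projB b = u \<cdot> projB b"
    using seq_assoc[OF p(1) h(8,4)] seq_assoc[OF p(1) h(6,4)] p(2) b
    by (simp add: fib_sum_def preadditive_bundle_def)
qed

lemma seq_fib_sum:
  assumes b: "preadditive_bundle X b" and u: "u \<in> hom X Y (totB b)" and v: "v \<in> hom X Y (totB b)"
    and uv: "u \<cdot> projB b = v \<cdot> projB b" and k: "k \<in> hom X Z Y"
  shows "k \<cdot> fib_sum X b Y u v = fib_sum X b Z (k \<cdot> u) (k \<cdot> v)"
proof -
  note h = preadditive_bundle_homs[OF b]
  note p = pullback_pairing[OF preadditive_bundle_pullback[OF b] u v uv]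
  have "pairing X Z (totB2 b) (prB1 b) (prB2 b) (k \<cdot> u) (k \<cdot> v) =
      k \<cdot> pairing X Y (totB2 b) (prB1 b) (prB2 b) u v"
    by (rule pairing_eqI[OF preadditive_bundle_pullback[OF b] seq_hom[OF k p(1)]])
      (use seq_assoc[OF k p(1) h(6)] seq_assoc[OF k p(1) h(7)] p in auto)
  then show ?thesis by (simp add: fib_sum_def seq_assoc[OF k p(1) h(8)])
qed

lemma additive_morphism_homs:
  "additive_bundle_morphism X b b' f g \<Longrightarrow> f \<in> hom X (baseB b) (baseB b')"
  "additive_bundle_morphism X b b' f g \<Longrightarrow> g \<in> hom X (totB b) (totB b')"
  by (auto simp: additive_bundle_morphism_def)

lemma same_fibre_morphism:
  assumes b: "preadditive_bundle X b" and b': "preadditive_bundle X b'"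
    and g: "additive_bundle_morphism X b b' f g"
    and u: "u \<in> hom X Y (totB b)" and v: "v \<in> hom X Y (totB b)"
    and uv: "u \<cdot> projB b = v \<cdot> projB b"
  shows "(u \<cdot> g) \<cdot> projB b' = (v \<cdot> g) \<cdot> projB b'"
proof -
  have sq: "commuting_square X (totB b) (totB b') (baseB b) (baseB b') g (projB b') (projB b) f"
    using g preadditive_bundle_homs[OF b] preadditive_bundle_homs[OF b']
    by (simp add: commuting_square_def additive_bundle_morphism_def)
  show ?thesis using seq_square[OF sq u] seq_square[OF sq v] uv by simp
qed

text \<open>A morphism of additive bundles preserves the sum of the universal pair of projections by
  definition; every other sum is a reindexing of that one.\<close>

lemma fib_sum_seq:
  assumes b: "preadditive_bundle X b" and b': "preadditive_bundle X b'"
    and g: "additive_bundle_morphism X b b' f g"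
    and u: "u \<in> hom X Y (totB b)" and v: "v \<in> hom X Y (totB b)"
    and uv: "u \<cdot> projB b = v \<cdot> projB b"
  shows "fib_sum X b Y u v \<cdot> g = fib_sum X b' Y (u \<cdot> g) (v \<cdot> g)"
proof -
  note h = preadditive_bundle_homs[OF b]
  note gh = additive_morphism_homs[OF g]
  note p = pullback_pairing[OF preadditive_bundle_pullback[OF b] u v uv]
  let ?p = "pairing X Y (totB2 b) (prB1 b) (prB2 b) u v"
  have sq: "prB1 b \<cdot> projB b = prB2 b \<cdot> projB b"
    using preadditive_bundle_pullback[OF b] by (simp add: pullback_def)
  have "fib_sum X b Y u v \<cdot> g = ?p \<cdot> (sumB b \<cdot> g)"
    using seq_assoc[OF p(1) h(8) gh(2)] by (simp add: fib_sum_def)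
  also have "\<dots> = ?p \<cdot> fib_sum X b' (totB2 b) (prB1 b \<cdot> g) (prB2 b \<cdot> g)"
    using g by (simp add: additive_bundle_morphism_def)
  also have "\<dots> = fib_sum X b' Y (?p \<cdot> (prB1 b \<cdot> g)) (?p \<cdot> (prB2 b \<cdot> g))"
    by (rule seq_fib_sum[OF b' seq_hom[OF h(6) gh(2)] seq_hom[OF h(7) gh(2)]
          same_fibre_morphism[OF b b' g h(6,7) sq] p(1)])
  also have "\<dots> = fib_sum X b' Y (u \<cdot> g) (v \<cdot> g)"
    using seq_assoc[OF p(1) h(6) gh(2)] seq_assoc[OF p(1) h(7) gh(2)] p by simp
  finally show ?thesis .
qed

lemma T_fib_sum:
  assumes b: "preadditive_bundle X b" and u: "u \<in> hom X Y (totB b)" and v: "v \<in> hom X Y (totB b)"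
    and uv: "u \<cdot> projB b = v \<cdot> projB b"
  shows "T\<^sub>a (fib_sum X b Y u v) = fib_sum X (T_bundle X b) (T\<^sub>o Y) (T\<^sub>a u) (T\<^sub>a v)"
proof -
  note h = preadditive_bundle_homs[OF b]
  note p = pullback_pairing[OF preadditive_bundle_pullback[OF b] u v uv]
  let ?p = "pairing X Y (totB2 b) (prB1 b) (prB2 b) u v"
  have "pairing X (T\<^sub>o Y) (T\<^sub>o (totB2 b)) (T\<^sub>a (prB1 b)) (T\<^sub>a (prB2 b)) (T\<^sub>a u) (T\<^sub>a v) = T\<^sub>a ?p"
    using pairing_eqI[OF preadditive_bundle_pullback[OF preadditive_bundle_T[OF b]], of "T\<^sub>a ?p"]
      T_hom[OF p(1)] T_seq[OF p(1) h(6)] T_seq[OF p(1) h(7)] p by simp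
  then show ?thesis by (simp add: fib_sum_def T_seq[OF p(1) h(8)])
qed

lemma T_additive_morphism:
  assumes b: "preadditive_bundle X b" and b': "preadditive_bundle X b'"
    and g: "additive_bundle_morphism X b b' f g"
  shows "additive_bundle_morphism X (T_bundle X b) (T_bundle X b') (T\<^sub>a f) (T\<^sub>a g)"
proof -
  note h = preadditive_bundle_homs[OF b] and h' = preadditive_bundle_homs[OF b']
  note gh = additive_morphism_homs[OF g]
  have sq: "prB1 b \<cdot> projB b = prB2 b \<cdot> projB b"
    using preadditive_bundle_pullback[OF b] by (simp add: pullback_def)
  have "T\<^sub>a (fib_sum X b' (totB2 b) (prB1 b \<cdot> g) (prB2 b \<cdot> g)) =
      fib_sum X (T_bundle X b') (T\<^sub>o (totB2 b)) (T\<^sub>a (prB1 b) \<cdot> T\<^sub>a g) (T\<^sub>a (prB2 b) \<cdot> T\<^sub>a g)"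
    using T_fib_sum[OF b' seq_hom[OF h(6) gh(2)] seq_hom[OF h(7) gh(2)]
        same_fibre_morphism[OF b b' g h(6,7) sq]] T_seq[OF h(6) gh(2)] T_seq[OF h(7) gh(2)] by simp
  moreover have "T\<^sub>a (projB b) \<cdot> T\<^sub>a f = T\<^sub>a g \<cdot> T\<^sub>a (projB b')"
    "T\<^sub>a (zeroB b) \<cdot> T\<^sub>a g = T\<^sub>a f \<cdot> T\<^sub>a (zeroB b')"
    using g T_seq[OF h(4) gh(1)] T_seq[OF gh(2) h'(4)] T_seq[OF h(5) gh(2)] T_seq[OF gh(1) h'(5)]
    by (simp_all add: additive_bundle_morphism_def)
  ultimately show ?thesis
    using g T_hom[OF gh(1)] T_hom[OF gh(2)] T_seq[OF h(8) gh(2)]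
    by (simp add: additive_bundle_morphism_def)
qed

lemma tangent_additive_morphism:
  assumes "f \<in> hom X M N"
  shows "additive_bundle_morphism X (tangent_bundle X M) (tangent_bundle X N) f (T\<^sub>a f)"
  using assms p_natural[OF assms] z_natural[OF assms] s_natural[OF assms] T_hom[OF assms]
  by (simp add: additive_bundle_morphism_def)

lemma fib_sum_zero:
  assumes "additive_bundle X b" and "u \<in> hom X Y (totB b)"
  shows "fib_sum X b Y u ((u \<cdot> projB b) \<cdot> zeroB b) = u"
  using assms unfolding additive_bundle_def by blast

lemma fib_sum_commute:
  assumes "additive_bundle X b" and "u \<in> hom X Y (totB b)" and "v \<in> hom X Y (totB b)"
    and "u \<cdot> projB b = v \<cdot> projB b"
  shows "fib_sum X b Y u v = fib_sum X b Y v u"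
  using assms unfolding additive_bundle_def by blast

lemma fib_zero_hom:
  assumes b: "preadditive_bundle X b" and u: "u \<in> hom X Y (totB b)"
  shows "(u \<cdot> projB b) \<cdot> zeroB b \<in> hom X Y (totB b)"
    and "((u \<cdot> projB b) \<cdot> zeroB b) \<cdot> projB b = u \<cdot> projB b"
proof -
  note h = preadditive_bundle_homs[OF b]
  show "(u \<cdot> projB b) \<cdot> zeroB b \<in> hom X Y (totB b)" by (intro seq_hom[OF _ h(5)] seq_hom[OF u h(4)])
  show "((u \<cdot> projB b) \<cdot> zeroB b) \<cdot> projB b = u \<cdot> projB b"
    using seq_assoc[OF seq_hom[OF u h(4)] h(5,4)] seq_ide[OF seq_hom[OF u h(4)]] b
    by (simp add: preadditive_bundle_def)
qed

lemma zero_fib_sum: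
  assumes a: "additive_bundle X b" and b: "preadditive_bundle X b" and u: "u \<in> hom X Y (totB b)"
  shows "fib_sum X b Y ((u \<cdot> projB b) \<cdot> zeroB b) u = u"
  using fib_sum_commute[OF a fib_zero_hom(1)[OF b u] u fib_zero_hom(2)[OF b u]]
    fib_sum_zero[OF a u] by simp

text \<open>The unit laws in \<open>Tb\<close> hold for the identity arrow by functoriality, hence for every arrow
  into the total space.\<close>

lemma T_fib_sum_zero:
  assumes a: "additive_bundle X b" and b: "preadditive_bundle X b" and u: "u \<in> hom X Y (T\<^sub>o (totB b))"
  shows "fib_sum X (T_bundle X b) Y u ((u \<cdot> T\<^sub>a (projB b)) \<cdot> T\<^sub>a (zeroB b)) = u"
    and "fib_sum X (T_bundle X b) Y ((u \<cdot> T\<^sub>a (projB b)) \<cdot> T\<^sub>a (zeroB b)) u = u"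
proof -
  note h = preadditive_bundle_homs[OF b]
  note Tb = preadditive_bundle_T[OF b]
  have i: "ide X (totB b) \<in> hom X (totB b) (totB b)" by (rule ide_hom[OF h(1)])
  have iz: "(ide X (totB b) \<cdot> projB b) \<cdot> zeroB b = projB b \<cdot> zeroB b" using ide_seq[OF h(4)] by simp
  note z = fib_zero_hom[OF b i, unfolded iz]
  have Ti: "T\<^sub>a (ide X (totB b)) = ide X (T\<^sub>o (totB b))" by (rule T_ide[OF h(1)])
  have Tz: "T\<^sub>a (projB b \<cdot> zeroB b) = T\<^sub>a (projB b) \<cdot> T\<^sub>a (zeroB b)" by (rule T_seq[OF h(4,5)])
  have uz: "u \<cdot> (T\<^sub>a (projB b) \<cdot> T\<^sub>a (zeroB b)) = (u \<cdot> T\<^sub>a (projB b)) \<cdot> T\<^sub>a (zeroB b)"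
    using seq_assoc[OF u T_hom[OF h(4)] T_hom[OF h(5)]] by simp
  note Th = T_hom[OF i] T_hom[OF z(1)]
  have pr: "T\<^sub>a (ide X (totB b)) \<cdot> T\<^sub>a (projB b) = T\<^sub>a (projB b \<cdot> zeroB b) \<cdot> T\<^sub>a (projB b)"
    using T_seq[OF i h(4)] T_seq[OF z(1) h(4)] z(2) by simp
  show "fib_sum X (T_bundle X b) Y u ((u \<cdot> T\<^sub>a (projB b)) \<cdot> T\<^sub>a (zeroB b)) = u"
    using seq_fib_sum[OF Tb, of "T\<^sub>a (ide X (totB b))" "T\<^sub>o (totB b)" "T\<^sub>a (projB b \<cdot> zeroB b)" u Y] Th pr u
      T_fib_sum[OF b i z(1) z(2)[symmetric]] fib_sum_zero[OF a i] iz uz Tz Ti seq_ide[OF u] by simp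
  show "fib_sum X (T_bundle X b) Y ((u \<cdot> T\<^sub>a (projB b)) \<cdot> T\<^sub>a (zeroB b)) u = u"
    using seq_fib_sum[OF Tb, of "T\<^sub>a (projB b \<cdot> zeroB b)" "T\<^sub>o (totB b)" "T\<^sub>a (ide X (totB b))" u Y] Th pr u
      T_fib_sum[OF b z(1) i z(2)] zero_fib_sum[OF a b i] iz uz Tz Ti seq_ide[OF u] by simp
qed

end

section \<open>Linear maps of differential bundles are additive\<close>

text \<open>The vertical bundle is a pullback involving \<open>p\<^sub>M\<close>, which need not be a display map; hence the
  algebraic part of a differential bundle is separated from the conditions on display and on fibre
  powers.\<close>

definition differential_structure :: "('o, 'm) tangent \<Rightarrow> ('o, 'm) diff_bundle \<Rightarrow> bool" where
  "differential_structure X b \<longleftrightarrow>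
     additive_bundle X b \<and>
     tangent_pullback X (totB b) (totB b) (baseB b) (projB b) (projB b)
       (totB2 b) (prB1 b) (prB2 b) \<and>
     additive_bundle_morphism X b (T_bundle X b) (\<zz> (baseB b)) (liftB b) \<and>
     additive_bundle_morphism X b (tangent_bundle X (totB b)) (zeroB b) (liftB b) \<and>
     liftB b \<cdot> \<ll> (totB b) = liftB b \<cdot> T\<^sub>a (liftB b) \<and>
     universal_lift X b"
  for X (structure)

text \<open>A morphism between data of differential bundles on which the axioms are not yet known, so that
  additivity has to be asked for along with linearity.\<close>

definition bundle_morphism ::
  "('o, 'm) tangent \<Rightarrow> ('o, 'm) diff_bundle \<Rightarrow> ('o, 'm) diff_bundle \<Rightarrow> 'm \<Rightarrow> 'm \<Rightarrow> bool" where
  "bundle_morphism X b b' f g \<longleftrightarrow>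
     additive_bundle_morphism X b b' f g \<and> g \<cdot> liftB b' = liftB b \<cdot> T\<^sub>a g"
  for X (structure)

context tangent_category
begin

lemma projections_same_fibre:
  assumes "preadditive_bundle X b"
  shows "prB1 b \<cdot> projB b = prB2 b \<cdot> projB b"
  using preadditive_bundle_pullback[OF assms] unfolding pullback_def by (elim conjE)

lemma additive_morphism_eqs:
  assumes "additive_bundle_morphism X b b' f g"
  shows "projB b \<cdot> f = g \<cdot> projB b'" and "zeroB b \<cdot> g = f \<cdot> zeroB b'"
    and "sumB b \<cdot> g = fib_sum X b' (totB2 b) (prB1 b \<cdot> g) (prB2 b \<cdot> g)"
  using assms unfolding additive_bundle_morphism_def by blast+

lemma differential_bundle_iff:
  "differential_bundle X b \<longleftrightarrow>
     differential_structure X b \<and> tangent_display X (totB b) (baseB b) (projB b)"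
  unfolding differential_bundle_def differential_structure_def
  using display_fibre_powers by blast

lemma differential_structure_preadditive:
  "differential_structure X b \<Longrightarrow> preadditive_bundle X b"
  by (simp add: differential_structure_def preadditive_bundle_def additive_bundle_def)

lemma differential_structure_additive:
  "differential_structure X b \<Longrightarrow> additive_bundle X b"
  by (simp add: differential_structure_def)

lemma lift_hom: "differential_structure X b \<Longrightarrow> liftB b \<in> hom X (totB b) (T\<^sub>o (totB b))"
  by (simp add: differential_structure_def additive_bundle_morphism_def)

lemma lift_proj:
  assumes "differential_structure X b"
  shows "liftB b \<cdot> T\<^sub>a (projB b) = projB b \<cdot> \<zz> (baseB b)"
    and "zeroB b \<cdot> liftB b = \<zz> (baseB b) \<cdot> T\<^sub>a (zeroB b)"
    and "zeroB b \<cdot> liftB b = zeroB b \<cdot> \<zz> (totB b)"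
    and "liftB b \<cdot> \<pp> (totB b) = projB b \<cdot> zeroB b"
proof -
  have M: "additive_bundle_morphism X b (T_bundle X b) (\<zz> (baseB b)) (liftB b)"
    and E: "additive_bundle_morphism X b (tangent_bundle X (totB b)) (zeroB b) (liftB b)"
    using assms unfolding differential_structure_def by blast+
  show "liftB b \<cdot> T\<^sub>a (projB b) = projB b \<cdot> \<zz> (baseB b)"
    and "zeroB b \<cdot> liftB b = \<zz> (baseB b) \<cdot> T\<^sub>a (zeroB b)"
    using additive_morphism_eqs(1,2)[OF M] by simp_all
  show "zeroB b \<cdot> liftB b = zeroB b \<cdot> \<zz> (totB b)"
    and "liftB b \<cdot> \<pp> (totB b) = projB b \<cdot> zeroB b"
    using additive_morphism_eqs(1,2)[OF E] by simp_all
qed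

lemma z_p: "A \<in> ob X \<Longrightarrow> \<zz> A \<cdot> \<pp> A = ide X A"
  using p_additive[of A] by (simp add: additive_bundle_def)

context
  fixes b
  assumes b: "differential_structure X b"
begin

private lemmas pre = differential_structure_preadditive[OF b]
private lemmas Tpre = preadditive_bundle_T[OF pre]
private lemmas add = differential_structure_additive[OF b]
private lemmas h = preadditive_bundle_homs[OF pre]
private lemmas zM = z_hom[OF h(2)]
private lemmas zE = z_hom[OF h(1)]
private lemmas l = lift_hom[OF b]

private lemma pr_sq: "prB1 b \<cdot> projB b = prB2 b \<cdot> projB b"
  by (rule projections_same_fibre[OF pre])

private lemma lift_zero_proj:
  assumes u: "u \<in> hom X Y (totB b)" and v: "v \<in> hom X Y (totB b)"
    and uv: "u \<cdot> projB b = v \<cdot> projB b"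
  shows "(u \<cdot> liftB b) \<cdot> T\<^sub>a (projB b) = (v \<cdot> \<zz> (totB b)) \<cdot> T\<^sub>a (projB b)"
    and "(u \<cdot> liftB b) \<cdot> T\<^sub>a (projB b) = (u \<cdot> projB b) \<cdot> \<zz> (baseB b)"
proof -
  show *: "(u \<cdot> liftB b) \<cdot> T\<^sub>a (projB b) = (u \<cdot> projB b) \<cdot> \<zz> (baseB b)"
    using seq_assoc[OF u l T_hom[OF h(4)]] seq_assoc[OF u h(4) zM] lift_proj(1)[OF b] by simp
  show "(u \<cdot> liftB b) \<cdot> T\<^sub>a (projB b) = (v \<cdot> \<zz> (totB b)) \<cdot> T\<^sub>a (projB b)"
    using * uv seq_assoc[OF v zE T_hom[OF h(4)]] seq_assoc[OF v h(4) zM] z_natural[OF h(4)] by simp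
qed

private lemmas xi_proj =
  lift_zero_proj[OF h(6,7) pr_sq]

lemma xi_hom:
  shows "bundle_xi X b \<in> hom X (totB2 b) (T\<^sub>o (totB b))"
    and "bundle_xi X b \<cdot> T\<^sub>a (projB b) = (prB1 b \<cdot> projB b) \<cdot> \<zz> (baseB b)"
  using fib_sum_hom[OF Tpre, of "prB1 b \<cdot> liftB b" "totB2 b" "prB2 b \<cdot> \<zz> (totB b)"]
    seq_hom[OF h(6) l] seq_hom[OF h(7) zE] xi_proj
  by (simp_all add: bundle_xi_def)

lemma pairing_xi:
  assumes u: "u \<in> hom X Y (totB b)" and v: "v \<in> hom X Y (totB b)"
    and uv: "u \<cdot> projB b = v \<cdot> projB b"
  shows "pairing X Y (totB2 b) (prB1 b) (prB2 b) u v \<cdot> bundle_xi X b =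
    fib_sum X (T_bundle X b) Y (u \<cdot> liftB b) (v \<cdot> \<zz> (totB b))"
proof -
  note p = pullback_pairing[OF preadditive_bundle_pullback[OF pre] u v uv]
  show ?thesis
    using seq_fib_sum[OF Tpre, of "prB1 b \<cdot> liftB b" "totB2 b" "prB2 b \<cdot> \<zz> (totB b)"]
      seq_hom[OF h(6) l] seq_hom[OF h(7) zE] xi_proj p
      seq_assoc[OF p(1) h(6) l] seq_assoc[OF p(1) h(7) zE]
    by (simp add: bundle_xi_def)
qed

text \<open>The second leg \<open>\<pi>\<^sub>1 q\<close> of the universal square is determined by the first, because
  \<open>z\<close> is a section.\<close>

lemma xi_monic:
  assumes k: "k \<in> hom X Y (totB2 b)" and k': "k' \<in> hom X Y (totB2 b)"
    and eq: "k \<cdot> bundle_xi X b = k' \<cdot> bundle_xi X b"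
  shows "k = k'"
proof -
  have U: "pullback X (T\<^sub>o (totB b)) (baseB b) (T\<^sub>o (baseB b)) (T\<^sub>a (projB b)) (\<zz> (baseB b))
       (totB2 b) (bundle_xi X b) (prB1 b \<cdot> projB b)"
    using b tangent_pullback_pullback by (simp add: differential_structure_def universal_lift_def)
  note w = seq_hom[OF h(6,4)]
  have "k \<cdot> (prB1 b \<cdot> projB b) = ((k \<cdot> bundle_xi X b) \<cdot> T\<^sub>a (projB b)) \<cdot> \<pp> (baseB b)"
    if k: "k \<in> hom X Y (totB2 b)" for k
    using seq_square[OF pullback_square[OF U] k] seq_assoc[OF seq_hom[OF k w] zM p_hom[OF h(2)]]
      z_p[OF h(2)] seq_ide[OF seq_hom[OF k w]] by simp
  from this[OF k] this[OF k'] eq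
  show ?thesis by (intro pullback_unique[OF U k k' eq]) simp
qed

private lemma fib_zero_lift:
  assumes u: "u \<in> hom X Y (totB b)"
  shows "((u \<cdot> projB b) \<cdot> zeroB b) \<cdot> liftB b = ((u \<cdot> projB b) \<cdot> \<zz> (baseB b)) \<cdot> T\<^sub>a (zeroB b)"
    and "((u \<cdot> projB b) \<cdot> zeroB b) \<cdot> \<zz> (totB b) = ((u \<cdot> projB b) \<cdot> \<zz> (baseB b)) \<cdot> T\<^sub>a (zeroB b)"
  using seq_assoc[OF seq_hom[OF u h(4)] h(5) l] seq_assoc[OF seq_hom[OF u h(4)] h(5) zE]
    seq_assoc[OF seq_hom[OF u h(4)] zM T_hom[OF h(5)]] lift_proj(2,3)[OF b] by simp_all

text \<open>The lift of the bundle and the zero section \<open>z\<close> of the tangent bundle of its total space are the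
  restrictions of \<open>\<xi>\<close> to the pairs \<open>\<langle>u, 0\<rangle>\<close> and \<open>\<langle>0, u\<rangle>\<close>.  That \<open>\<xi>\<close> is monic then shows that the lift is
  monic, and that \<open>u l = u z\<close> forces \<open>\<langle>u, 0\<rangle> = \<langle>0, u\<rangle>\<close>.\<close>

lemma lift_eq_xi:
  assumes u: "u \<in> hom X Y (totB b)"
  shows "u \<cdot> liftB b =
    pairing X Y (totB2 b) (prB1 b) (prB2 b) u ((u \<cdot> projB b) \<cdot> zeroB b) \<cdot> bundle_xi X b"
  using pairing_xi[OF u fib_zero_hom(1)[OF pre u] fib_zero_hom(2)[OF pre u, symmetric]]
    T_fib_sum_zero(1)[OF add pre seq_hom[OF u l]] fib_zero_lift(2)[OF u]
    lift_zero_proj(2)[OF u u refl] by simp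

lemma zero_eq_xi:
  assumes u: "u \<in> hom X Y (totB b)"
  shows "u \<cdot> \<zz> (totB b) =
    pairing X Y (totB2 b) (prB1 b) (prB2 b) ((u \<cdot> projB b) \<cdot> zeroB b) u \<cdot> bundle_xi X b"
  using pairing_xi[OF fib_zero_hom(1)[OF pre u] u fib_zero_hom(2)[OF pre u]]
    T_fib_sum_zero(2)[OF add pre seq_hom[OF u zE]] fib_zero_lift(1)[OF u]
    lift_zero_proj[OF u u refl] by simp

lemma lift_monic:
  assumes u: "u \<in> hom X Y (totB b)" and v: "v \<in> hom X Y (totB b)"
    and eq: "u \<cdot> liftB b = v \<cdot> liftB b"
  shows "u = v"
proof -
  note pu = pullback_pairing[OF preadditive_bundle_pullback[OF pre] u
      fib_zero_hom(1)[OF pre u] fib_zero_hom(2)[OF pre u, symmetric]]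
  note pv = pullback_pairing[OF preadditive_bundle_pullback[OF pre] v
      fib_zero_hom(1)[OF pre v] fib_zero_hom(2)[OF pre v, symmetric]]
  have "pairing X Y (totB2 b) (prB1 b) (prB2 b) u ((u \<cdot> projB b) \<cdot> zeroB b) =
      pairing X Y (totB2 b) (prB1 b) (prB2 b) v ((v \<cdot> projB b) \<cdot> zeroB b)"
    by (rule xi_monic[OF pu(1) pv(1) eq[unfolded lift_eq_xi[OF u] lift_eq_xi[OF v]]])
  from arg_cong[OF this, of "\<lambda>k. k \<cdot> prB1 b"] show ?thesis unfolding pu(2) pv(2) .
qed

lemma zero_if_lift_eq_zero:
  assumes u: "u \<in> hom X Y (totB b)" and eq: "u \<cdot> liftB b = u \<cdot> \<zz> (totB b)"
  shows "u = (u \<cdot> projB b) \<cdot> zeroB b"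
proof -
  note z = fib_zero_hom[OF pre u]
  note p = pullback_pairing[OF preadditive_bundle_pullback[OF pre] u z(1) z(2)[symmetric]]
  note p' = pullback_pairing[OF preadditive_bundle_pullback[OF pre] z(1) u z(2)]
  have "pairing X Y (totB2 b) (prB1 b) (prB2 b) u ((u \<cdot> projB b) \<cdot> zeroB b) =
      pairing X Y (totB2 b) (prB1 b) (prB2 b) ((u \<cdot> projB b) \<cdot> zeroB b) u"
    by (rule xi_monic[OF p(1) p'(1) eq[unfolded lift_eq_xi[OF u] zero_eq_xi[OF u]]])
  from arg_cong[OF this, of "\<lambda>k. k \<cdot> prB1 b"] show ?thesis unfolding p(2) p'(2) .
qed

end

text \<open>The lift \<open>l'\<close> is monic, so it suffices to compare after \<open>l'\<close>.  There linearity
  replaces \<open>g l'\<close> by \<open>l Tg\<close>; the lift \<open>l\<close> takes the sum of the bundle to the sum of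
  tangent vectors, which every \<open>Tg\<close> preserves.\<close>

lemma linear_additive:
  assumes b: "differential_structure X b" and b': "differential_structure X b'"
    and f: "f \<in> hom X (baseB b) (baseB b')" and g: "g \<in> hom X (totB b) (totB b')"
    and pg: "projB b \<cdot> f = g \<cdot> projB b'"
    and lin: "g \<cdot> liftB b' = liftB b \<cdot> T\<^sub>a g"
  shows "additive_bundle_morphism X b b' f g"
proof -
  note pre = differential_structure_preadditive[OF b]
  note pre' = differential_structure_preadditive[OF b']
  note h = preadditive_bundle_homs[OF pre] and h' = preadditive_bundle_homs[OF pre']
  note l = lift_hom[OF b] and l' = lift_hom[OF b']
  note z = z_hom[OF h(1)] and z' = z_hom[OF h'(1)]
  note Tp = preadditive_tangent_bundle[OF h(1)] and Tp' = preadditive_tangent_bundle[OF h'(1)]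
  have sq: "prB1 b \<cdot> projB b = prB2 b \<cdot> projB b"
    by (rule projections_same_fibre[OF pre])
  have zg: "zeroB b \<cdot> g \<in> hom X (baseB b) (totB b')" by (rule seq_hom[OF h(5) g])
  have "(zeroB b \<cdot> g) \<cdot> liftB b' = (zeroB b \<cdot> liftB b) \<cdot> T\<^sub>a g"
    using seq_assoc[OF h(5) g l'] seq_assoc[OF h(5) l T_hom[OF g]] lin by simp
  also have "\<dots> = (zeroB b \<cdot> g) \<cdot> \<zz> (totB b')"
    using lift_proj(3)[OF b] seq_assoc[OF h(5) z T_hom[OF g]] seq_assoc[OF h(5) g z']
      z_natural[OF g] by simp
  finally have "zeroB b \<cdot> g = ((zeroB b \<cdot> g) \<cdot> projB b') \<cdot> zeroB b'"
    by (rule zero_if_lift_eq_zero[OF b' zg])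
  moreover have "(zeroB b \<cdot> g) \<cdot> projB b' = f"
    using seq_assoc[OF h(5) g h'(4)] seq_assoc[OF h(5,4) f] pg ide_seq[OF f] pre
    by (simp add: preadditive_bundle_def)
  ultimately have zero: "zeroB b \<cdot> g = f \<cdot> zeroB b'" by simp

  have pr_g: "(prB1 b \<cdot> g) \<cdot> projB b' = (prB2 b \<cdot> g) \<cdot> projB b'"
    using seq_assoc[OF h(6) g h'(4)] seq_assoc[OF h(7) g h'(4)] seq_assoc[OF h(6,4) f]
      seq_assoc[OF h(7,4) f] pg sq by simp
  note pgh = seq_hom[OF h(6) g] seq_hom[OF h(7) g]
  have add_l: "additive_bundle_morphism X b (tangent_bundle X (totB b)) (zeroB b) (liftB b)"
    and add_l': "additive_bundle_morphism X b' (tangent_bundle X (totB b')) (zeroB b') (liftB b')"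
    using b b' by (simp_all add: differential_structure_def)
  have "(sumB b \<cdot> g) \<cdot> liftB b' = (sumB b \<cdot> liftB b) \<cdot> T\<^sub>a g"
    using seq_assoc[OF h(8) g l'] seq_assoc[OF h(8) l T_hom[OF g]] lin by simp
  also have "sumB b \<cdot> liftB b = fib_sum X (tangent_bundle X (totB b)) (totB2 b)
      (prB1 b \<cdot> liftB b) (prB2 b \<cdot> liftB b)"
    using add_l by (simp add: additive_bundle_morphism_def)
  also have "\<dots> \<cdot> T\<^sub>a g = fib_sum X (tangent_bundle X (totB b')) (totB2 b)
      ((prB1 b \<cdot> liftB b) \<cdot> T\<^sub>a g) ((prB2 b \<cdot> liftB b) \<cdot> T\<^sub>a g)"
    using fib_sum_seq[OF Tp Tp' tangent_additive_morphism[OF g], of "prB1 b \<cdot> liftB b" "totB2 b"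
        "prB2 b \<cdot> liftB b"] seq_hom[OF h(6) l] seq_hom[OF h(7) l]
      same_fibre_morphism[OF pre Tp add_l h(6,7) sq] by simp
  also have "(prB1 b \<cdot> liftB b) \<cdot> T\<^sub>a g = (prB1 b \<cdot> g) \<cdot> liftB b'"
    using seq_assoc[OF h(6) g l'] seq_assoc[OF h(6) l T_hom[OF g]] lin by simp
  also have "(prB2 b \<cdot> liftB b) \<cdot> T\<^sub>a g = (prB2 b \<cdot> g) \<cdot> liftB b'"
    using seq_assoc[OF h(7) g l'] seq_assoc[OF h(7) l T_hom[OF g]] lin by simp
  also have "fib_sum X (tangent_bundle X (totB b')) (totB2 b)
      ((prB1 b \<cdot> g) \<cdot> liftB b') ((prB2 b \<cdot> g) \<cdot> liftB b') =
      fib_sum X b' (totB2 b) (prB1 b \<cdot> g) (prB2 b \<cdot> g) \<cdot> liftB b'"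
    by (rule fib_sum_seq[OF pre' Tp' add_l' pgh pr_g, symmetric])
  finally have "sumB b \<cdot> g = fib_sum X b' (totB2 b) (prB1 b \<cdot> g) (prB2 b \<cdot> g)"
    by (rule lift_monic[OF b' seq_hom[OF h(8) g] fib_sum_hom(1)[OF pre' pgh pr_g]])
  with f g pg zero show ?thesis by (simp add: additive_bundle_morphism_def)
qed

text \<open>Additivity of the lift over the zero section is not an axiom for \<open>p\<^sub>M\<close>; since \<open>l c = l\<close>, it
  follows from additivity over \<open>z\<^sub>M\<close> by composing with the additive flip \<open>c : Tp\<^sub>M \<rightarrow> p\<^bsub>TM\<^esub>\<close>.\<close>

lemma differential_structure_tangent_bundle:
  assumes M: "M \<in> ob X"
  shows "differential_structure X (tangent_bundle X M)"
proof -
  let ?p = "tangent_bundle X M"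
  note pre = preadditive_tangent_bundle[OF M]
  note T = T_obj[OF M]
  note preT = preadditive_bundle_T[OF pre] and preTT = preadditive_tangent_bundle[OF T]
  note h = preadditive_bundle_homs[OF pre, simplified]
  note ladd = l_additive[OF M] and cadd = c_additive[OF M]
  note l = l_hom[OF M] and c = c_hom[OF M]
  have sq: "tan_pr1 X M \<cdot> \<pp> M = tan_pr2 X M \<cdot> \<pp> M"
    using projections_same_fibre[OF pre] by simp
  have lc: "(tan_pr1 X M \<cdot> \<ll> M) \<cdot> \<cc> M = tan_pr1 X M \<cdot> \<ll> M"
    "(tan_pr2 X M \<cdot> \<ll> M) \<cdot> \<cc> M = tan_pr2 X M \<cdot> \<ll> M"
    using seq_assoc[OF h(6) l c] seq_assoc[OF h(7) l c] l_c[OF M] by simp_all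
  have "\<ss> M \<cdot> \<ll> M = (\<ss> M \<cdot> \<ll> M) \<cdot> \<cc> M"
    using seq_assoc[OF h(8) l c] l_c[OF M] by simp
  also have "\<dots> = fib_sum X (tangent_bundle X (T\<^sub>o M)) (tan_2 X M)
      (tan_pr1 X M \<cdot> \<ll> M) (tan_pr2 X M \<cdot> \<ll> M)"
    using fib_sum_seq[OF preT preTT cadd, of "tan_pr1 X M \<cdot> \<ll> M" "tan_2 X M" "tan_pr2 X M \<cdot> \<ll> M"]
      ladd seq_hom[OF h(6) l] seq_hom[OF h(7) l] lc
      same_fibre_morphism[OF pre preT ladd, of "tan_pr1 X M" "tan_2 X M" "tan_pr2 X M"] h sq
    by (simp add: additive_bundle_morphism_def)
  finally have sum: "\<ss> M \<cdot> \<ll> M = fib_sum X (tangent_bundle X (T\<^sub>o M)) (tan_2 X M)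
      (tan_pr1 X M \<cdot> \<ll> M) (tan_pr2 X M \<cdot> \<ll> M)" .
  have "\<ll> M \<cdot> \<pp> (T\<^sub>o M) = \<ll> M \<cdot> (\<cc> M \<cdot> \<pp> (T\<^sub>o M))"
    using seq_assoc[OF l c p_hom[OF T]] l_c[OF M] by simp
  also have "\<cc> M \<cdot> \<pp> (T\<^sub>o M) = T\<^sub>a (\<pp> M)"
    using cadd seq_ide[OF T_hom[OF h(4)]] by (simp add: additive_bundle_morphism_def)
  also have "\<ll> M \<cdot> T\<^sub>a (\<pp> M) = \<pp> M \<cdot> \<zz> M"
    using ladd by (simp add: additive_bundle_morphism_def)
  finally have proj: "\<ll> M \<cdot> \<pp> (T\<^sub>o M) = \<pp> M \<cdot> \<zz> M" .
  have zero: "\<zz> M \<cdot> \<ll> M = \<zz> M \<cdot> \<zz> (T\<^sub>o M)"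
    using ladd z_natural[OF z_hom[OF M]] by (simp add: additive_bundle_morphism_def)
  show ?thesis
    using p_additive[OF M] tangent_2[OF M] ladd l_l[OF M] l_universal[OF M] sum proj zero h l
    by (simp add: differential_structure_def additive_bundle_morphism_def)
qed

lemma fib_sum_trivial:
  assumes "u \<in> hom X Y E"
  shows "fib_sum X (trivial_bundle X E) Y u u = u"
  using pairing_eqI[OF pullback_of_identity[OF ide_hom] assms, of u u] assms hom_ob[OF assms]
  by (simp add: fib_sum_def seq_ide)

lemma T_trivial_bundle:
  assumes "E \<in> ob X"
  shows "fib_sum X (T_bundle X (trivial_bundle X E)) = fib_sum X (trivial_bundle X (T\<^sub>o E))"
  by (intro ext) (simp add: fib_sum_def T_ide[OF assms])

lemma differential_structure_trivial_bundle:
  assumes E: "E \<in> ob X"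
  shows "differential_structure X (trivial_bundle X E)"
proof -
  let ?E = "trivial_bundle X E"
  note i = ide_hom[OF E] and z = z_hom[OF E]
  note T = T_obj[OF E]
  have pb: "tangent_pullback X E E E (ide X E) (ide X E) E (ide X E) (ide X E)"
    by (rule tangent_pullback_of_identity[OF i])
  have "additive_bundle X ?E"
    using tangent_pullback_pullback[OF pb] i fib_sum_trivial
    by (simp add: additive_bundle_def seq_ide ide_seq)
  moreover have "additive_bundle_morphism X ?E (T_bundle X ?E) (\<zz> E) (\<zz> E)"
    using fib_sum_trivial[OF z] z
    by (simp add: additive_bundle_morphism_def T_trivial_bundle[OF E] T_ide[OF E] seq_ide ide_seq)
  moreover have "\<zz> E = fib_sum X (tangent_bundle X E) E (\<zz> E) (\<zz> E)"
    using fib_sum_zero[OF p_additive[OF E], of "\<zz> E" E] z z_p[OF E] ide_seq[OF z] by simp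
  then have "additive_bundle_morphism X ?E (tangent_bundle X E) (ide X E) (\<zz> E)"
    using z i z_p[OF E] by (simp add: additive_bundle_morphism_def ide_seq seq_ide)
  moreover have "\<zz> E \<cdot> \<ll> E = \<zz> E \<cdot> T\<^sub>a (\<zz> E)"
    using l_additive[OF E] by (simp add: additive_bundle_morphism_def)
  moreover have "bundle_xi X ?E = \<zz> E"
    using fib_sum_trivial[OF z] by (simp add: bundle_xi_def T_trivial_bundle[OF E] ide_seq[OF z])
  then have "universal_lift X ?E"
    using tangent_pullback_of_identity[OF z] T_ide[OF E] ide_seq[OF i]
    by (simp add: universal_lift_def)
  ultimately show ?thesis using pb by (simp add: differential_structure_def)
qed

end

section \<open>Pullbacks of differential bundles\<close>

text \<open>The arrow \<open>g \<times> g\<close> between the chosen fibre squares.\<close>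

definition fibre_square_map ::
  "('o, 'm) tangent \<Rightarrow> ('o, 'm) diff_bundle \<Rightarrow> ('o, 'm) diff_bundle \<Rightarrow> 'm \<Rightarrow> 'm" where
  "fibre_square_map X b b' g =
     pairing X (totB2 b) (totB2 b') (prB1 b') (prB2 b') (prB1 b \<cdot> g) (prB2 b \<cdot> g)"
  for X (structure)

context tangent_category
begin

lemma bundle_morphism_additive: "bundle_morphism X b b' f g \<Longrightarrow> additive_bundle_morphism X b b' f g"
  by (simp add: bundle_morphism_def)

lemma bundle_morphism_lift: "bundle_morphism X b b' f g \<Longrightarrow> g \<cdot> liftB b' = liftB b \<cdot> T\<^sub>a g"
  by (simp add: bundle_morphism_def)

context
  fixes P A e m
  assumes A: "differential_structure X A"
    and P: "preadditive_bundle X P" and lP: "liftB P \<in> hom X (totB P) (T\<^sub>o (totB P))"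
    and m: "bundle_morphism X P A e m"
begin

private lemmas preA = differential_structure_preadditive[OF A]
private lemmas hA = preadditive_bundle_homs[OF preA]
private lemmas hP = preadditive_bundle_homs[OF P]
private lemmas ma = bundle_morphism_additive[OF m]
private lemmas mh = additive_morphism_homs[OF ma]
private lemmas me = additive_morphism_eqs[OF ma]
private lemmas ml = bundle_morphism_lift[OF m]
private lemmas lA = lift_hom[OF A]

lemma fibre_square_map:
  shows "fibre_square_map X P A m \<in> hom X (totB2 P) (totB2 A)"
    and "fibre_square_map X P A m \<cdot> prB1 A = prB1 P \<cdot> m"
    and "fibre_square_map X P A m \<cdot> prB2 A = prB2 P \<cdot> m"
  using pullback_pairing[OF preadditive_bundle_pullback[OF preA] seq_hom[OF hP(6) mh(2)]
      seq_hom[OF hP(7) mh(2)] same_fibre_morphism[OF P preA ma hP(6,7) projections_same_fibre[OF P]]]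
  by (simp_all add: fibre_square_map_def)

text \<open>The following lemmas state the axioms of a differential bundle for \<open>P\<close> after composition with a
  morphism \<open>m : P \<rightarrow> A\<close> into a differential bundle.  Two such morphisms, jointly monic along with
  their images under \<open>T\<close> and \<open>T\<^sup>2\<close>, give the axioms themselves.\<close>

lemma lift_proj_after:
  "(liftB P \<cdot> T\<^sub>a (projB P)) \<cdot> T\<^sub>a e = (projB P \<cdot> \<zz> (baseB P)) \<cdot> T\<^sub>a e"
proof -
  have "(liftB P \<cdot> T\<^sub>a (projB P)) \<cdot> T\<^sub>a e = liftB P \<cdot> T\<^sub>a (m \<cdot> projB A)"
    using seq_assoc[OF lP T_hom[OF hP(4)] T_hom[OF mh(1)]] T_seq[OF hP(4) mh(1)] me(1) by simp
  also have "\<dots> = (m \<cdot> liftB A) \<cdot> T\<^sub>a (projB A)"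
    using T_seq[OF mh(2) hA(4)] seq_assoc[OF lP T_hom[OF mh(2)] T_hom[OF hA(4)]] ml by simp
  also have "\<dots> = (m \<cdot> projB A) \<cdot> \<zz> (baseB A)"
    using seq_assoc[OF mh(2) lA T_hom[OF hA(4)]] seq_assoc[OF mh(2) hA(4) z_hom[OF hA(2)]]
      lift_proj(1)[OF A] by simp
  also have "\<dots> = (projB P \<cdot> \<zz> (baseB P)) \<cdot> T\<^sub>a e"
    using me(1) seq_assoc[OF hP(4) mh(1) z_hom[OF hA(2)]]
      seq_assoc[OF hP(4) z_hom[OF hP(2)] T_hom[OF mh(1)]] z_natural[OF mh(1)] by simp
  finally show ?thesis .
qed

lemma zero_lift_after:
  shows "(zeroB P \<cdot> liftB P) \<cdot> T\<^sub>a m = (\<zz> (baseB P) \<cdot> T\<^sub>a (zeroB P)) \<cdot> T\<^sub>a m"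
    and "(zeroB P \<cdot> liftB P) \<cdot> T\<^sub>a m = (zeroB P \<cdot> \<zz> (totB P)) \<cdot> T\<^sub>a m"
proof -
  note zA = z_hom[OF hA(2)] and zP = z_hom[OF hP(2)] and zt = z_hom[OF hP(1)]
  have "(zeroB P \<cdot> liftB P) \<cdot> T\<^sub>a m = (e \<cdot> zeroB A) \<cdot> liftB A"
    using seq_assoc[OF hP(5) lP T_hom[OF mh(2)]] ml seq_assoc[OF hP(5) mh(2) lA] me(2) by simp
  also have "\<dots> = (e \<cdot> \<zz> (baseB A)) \<cdot> T\<^sub>a (zeroB A)"
    using seq_assoc[OF mh(1) hA(5) lA] seq_assoc[OF mh(1) zA T_hom[OF hA(5)]] lift_proj(2)[OF A]
    by simp
  also have "\<dots> = \<zz> (baseB P) \<cdot> T\<^sub>a (zeroB P \<cdot> m)"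
    using z_natural[OF mh(1)] seq_assoc[OF zP T_hom[OF mh(1)] T_hom[OF hA(5)]]
      T_seq[OF mh(1) hA(5)] me(2) by simp
  finally have *: "(zeroB P \<cdot> liftB P) \<cdot> T\<^sub>a m = \<zz> (baseB P) \<cdot> T\<^sub>a (zeroB P \<cdot> m)" .
  then show "(zeroB P \<cdot> liftB P) \<cdot> T\<^sub>a m = (\<zz> (baseB P) \<cdot> T\<^sub>a (zeroB P)) \<cdot> T\<^sub>a m"
    using T_seq[OF hP(5) mh(2)] seq_assoc[OF zP T_hom[OF hP(5)] T_hom[OF mh(2)]] by simp
  then show "(zeroB P \<cdot> liftB P) \<cdot> T\<^sub>a m = (zeroB P \<cdot> \<zz> (totB P)) \<cdot> T\<^sub>a m"
    using z_natural[OF hP(5)] by simp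
qed

lemma lift_p_after: "(liftB P \<cdot> \<pp> (totB P)) \<cdot> m = (projB P \<cdot> zeroB P) \<cdot> m"
proof -
  have "(liftB P \<cdot> \<pp> (totB P)) \<cdot> m = (m \<cdot> liftB A) \<cdot> \<pp> (totB A)"
    using seq_assoc[OF lP p_hom[OF hP(1)] mh(2)] p_natural[OF mh(2)]
      seq_assoc[OF lP T_hom[OF mh(2)] p_hom[OF hA(1)]] ml by simp
  also have "\<dots> = (m \<cdot> projB A) \<cdot> zeroB A"
    using seq_assoc[OF mh(2) lA p_hom[OF hA(1)]] lift_proj(4)[OF A] seq_assoc[OF mh(2) hA(4,5)]
    by simp
  also have "\<dots> = (projB P \<cdot> zeroB P) \<cdot> m"
    using me(1,2) seq_assoc[OF hP(4) mh(1) hA(5)] seq_assoc[OF hP(4,5) mh(2)] by simp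
  finally show ?thesis .
qed

lemma lift_lift_after:
  "(liftB P \<cdot> \<ll> (totB P)) \<cdot> T\<^sub>a (T\<^sub>a m) = (liftB P \<cdot> T\<^sub>a (liftB P)) \<cdot> T\<^sub>a (T\<^sub>a m)"
proof -
  note Tm = T_hom[OF mh(2)]
  have "(liftB P \<cdot> \<ll> (totB P)) \<cdot> T\<^sub>a (T\<^sub>a m) = (m \<cdot> liftB A) \<cdot> \<ll> (totB A)"
    using seq_assoc[OF lP l_hom[OF hP(1)] T_hom[OF Tm]] l_natural[OF mh(2)]
      seq_assoc[OF lP Tm l_hom[OF hA(1)]] ml by simp
  also have "\<dots> = (m \<cdot> liftB A) \<cdot> T\<^sub>a (liftB A)"
    using A seq_assoc[OF mh(2) lA l_hom[OF hA(1)]] seq_assoc[OF mh(2) lA T_hom[OF lA]]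
    by (simp add: differential_structure_def)
  also have "\<dots> = liftB P \<cdot> T\<^sub>a (m \<cdot> liftB A)"
    using ml seq_assoc[OF lP Tm T_hom[OF lA]] T_seq[OF mh(2) lA] by simp
  also have "\<dots> = (liftB P \<cdot> T\<^sub>a (liftB P)) \<cdot> T\<^sub>a (T\<^sub>a m)"
    using ml T_seq[OF lP Tm] seq_assoc[OF lP T_hom[OF lP] T_hom[OF Tm]] by simp
  finally show ?thesis .
qed

context
  assumes lift_proj_P: "liftB P \<cdot> T\<^sub>a (projB P) = projB P \<cdot> \<zz> (baseB P)"
    and lift_p_P: "liftB P \<cdot> \<pp> (totB P) = projB P \<cdot> zeroB P"
begin

private lemma pr_lift:
  shows "(prB1 P \<cdot> liftB P) \<cdot> T\<^sub>a (projB P) = (prB2 P \<cdot> liftB P) \<cdot> T\<^sub>a (projB P)"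
    and "(prB1 P \<cdot> liftB P) \<cdot> T\<^sub>a (projB P) = (prB2 P \<cdot> \<zz> (totB P)) \<cdot> T\<^sub>a (projB P)"
    and "(prB1 P \<cdot> liftB P) \<cdot> \<pp> (totB P) = (prB2 P \<cdot> liftB P) \<cdot> \<pp> (totB P)"
proof -
  have *: "(u \<cdot> liftB P) \<cdot> T\<^sub>a (projB P) = (u \<cdot> projB P) \<cdot> \<zz> (baseB P)"
    "(u \<cdot> \<zz> (totB P)) \<cdot> T\<^sub>a (projB P) = (u \<cdot> projB P) \<cdot> \<zz> (baseB P)"
    "(u \<cdot> liftB P) \<cdot> \<pp> (totB P) = (u \<cdot> projB P) \<cdot> zeroB P"
    if u: "u \<in> hom X Y (totB P)" for u Y
    using seq_assoc[OF u lP T_hom[OF hP(4)]] seq_assoc[OF u z_hom[OF hP(1)] T_hom[OF hP(4)]]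
      seq_assoc[OF u lP p_hom[OF hP(1)]] seq_assoc[OF u hP(4) z_hom[OF hP(2)]]
      seq_assoc[OF u hP(4,5)] lift_proj_P lift_p_P z_natural[OF hP(4)] by simp_all
  show "(prB1 P \<cdot> liftB P) \<cdot> T\<^sub>a (projB P) = (prB2 P \<cdot> liftB P) \<cdot> T\<^sub>a (projB P)"
    and "(prB1 P \<cdot> liftB P) \<cdot> T\<^sub>a (projB P) = (prB2 P \<cdot> \<zz> (totB P)) \<cdot> T\<^sub>a (projB P)"
    and "(prB1 P \<cdot> liftB P) \<cdot> \<pp> (totB P) = (prB2 P \<cdot> liftB P) \<cdot> \<pp> (totB P)"
    using *[OF hP(6)] *[OF hP(7)] projections_same_fibre[OF P] by simp_all
qed

private lemma pr_lift_after:
  shows "(prB1 P \<cdot> liftB P) \<cdot> T\<^sub>a m = (prB1 P \<cdot> m) \<cdot> liftB A"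
    and "(prB2 P \<cdot> liftB P) \<cdot> T\<^sub>a m = (prB2 P \<cdot> m) \<cdot> liftB A"
  using seq_assoc[OF hP(6) lP T_hom[OF mh(2)]] seq_assoc[OF hP(7) lP T_hom[OF mh(2)]]
    seq_assoc[OF hP(6) mh(2) lA] seq_assoc[OF hP(7) mh(2) lA] ml by simp_all

private lemmas pm = seq_hom[OF hP(6) mh(2)] seq_hom[OF hP(7) mh(2)]
  same_fibre_morphism[OF P preA ma hP(6,7) projections_same_fibre[OF P]]

private lemma sum_lift: "(sumB P \<cdot> liftB P) \<cdot> T\<^sub>a m =
    fib_sum X A (totB2 P) (prB1 P \<cdot> m) (prB2 P \<cdot> m) \<cdot> liftB A"
  using seq_assoc[OF hP(8) lP T_hom[OF mh(2)]] ml seq_assoc[OF hP(8) mh(2) lA] me(3) by simp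

lemma sum_lift_after:
  shows "(sumB P \<cdot> liftB P) \<cdot> T\<^sub>a m =
      fib_sum X (T_bundle X P) (totB2 P) (prB1 P \<cdot> liftB P) (prB2 P \<cdot> liftB P) \<cdot> T\<^sub>a m"
    and "(sumB P \<cdot> liftB P) \<cdot> T\<^sub>a m =
      fib_sum X (tangent_bundle X (totB P)) (totB2 P) (prB1 P \<cdot> liftB P) (prB2 P \<cdot> liftB P) \<cdot> T\<^sub>a m"
proof -
  have lA1: "additive_bundle_morphism X A (T_bundle X A) (\<zz> (baseB A)) (liftB A)"
    and lA2: "additive_bundle_morphism X A (tangent_bundle X (totB A)) (zeroB A) (liftB A)"
    using A by (simp_all add: differential_structure_def)
  note l12 = seq_hom[OF hP(6) lP] seq_hom[OF hP(7) lP]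
  note tP = preadditive_tangent_bundle[OF hP(1)] and tA = preadditive_tangent_bundle[OF hA(1)]
  note TP = preadditive_bundle_T[OF P] and TA = preadditive_bundle_T[OF preA]
  show "(sumB P \<cdot> liftB P) \<cdot> T\<^sub>a m =
      fib_sum X (T_bundle X P) (totB2 P) (prB1 P \<cdot> liftB P) (prB2 P \<cdot> liftB P) \<cdot> T\<^sub>a m"
    using sum_lift fib_sum_seq[OF preA TA lA1 pm] pr_lift_after pr_lift(1) l12
      fib_sum_seq[OF TP TA T_additive_morphism[OF P preA ma],
        of "prB1 P \<cdot> liftB P" "totB2 P" "prB2 P \<cdot> liftB P"]
    by simp
  show "(sumB P \<cdot> liftB P) \<cdot> T\<^sub>a m =
      fib_sum X (tangent_bundle X (totB P)) (totB2 P) (prB1 P \<cdot> liftB P) (prB2 P \<cdot> liftB P) \<cdot> T\<^sub>a m"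
    using sum_lift fib_sum_seq[OF preA tA lA2 pm] pr_lift_after pr_lift(3) l12
      fib_sum_seq[OF tP tA tangent_additive_morphism[OF mh(2)],
        of "prB1 P \<cdot> liftB P" "totB2 P" "prB2 P \<cdot> liftB P"]
    by simp
qed

lemma bundle_xi_hom:
  shows "bundle_xi X P \<in> hom X (totB2 P) (T\<^sub>o (totB P))"
  using fib_sum_hom(1)[OF preadditive_bundle_T[OF P], of "prB1 P \<cdot> liftB P" "totB2 P"
      "prB2 P \<cdot> \<zz> (totB P)"] seq_hom[OF hP(6) lP] seq_hom[OF hP(7) z_hom[OF hP(1)]] pr_lift(2)
  by (simp add: bundle_xi_def)

lemma xi_natural:
  "bundle_xi X P \<cdot> T\<^sub>a m = fibre_square_map X P A m \<cdot> bundle_xi X A"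
proof -
  note zP = z_hom[OF hP(1)] and zA = z_hom[OF hA(1)]
  note TP = preadditive_bundle_T[OF P] and TA = preadditive_bundle_T[OF preA]
  have zz: "(prB2 P \<cdot> \<zz> (totB P)) \<cdot> T\<^sub>a m = (prB2 P \<cdot> m) \<cdot> \<zz> (totB A)"
    using seq_assoc[OF hP(7) zP T_hom[OF mh(2)]] seq_assoc[OF hP(7) mh(2) zA] z_natural[OF mh(2)]
    by simp
  have "bundle_xi X P \<cdot> T\<^sub>a m =
      fib_sum X (T_bundle X A) (totB2 P) ((prB1 P \<cdot> m) \<cdot> liftB A) ((prB2 P \<cdot> m) \<cdot> \<zz> (totB A))"
    using fib_sum_seq[OF TP TA T_additive_morphism[OF P preA ma],
        of "prB1 P \<cdot> liftB P" "totB2 P" "prB2 P \<cdot> \<zz> (totB P)"]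
      seq_hom[OF hP(6) lP] seq_hom[OF hP(7) zP] pr_lift(2) pr_lift_after(1) zz
    by (simp add: bundle_xi_def)
  also have "\<dots> = fibre_square_map X P A m \<cdot> bundle_xi X A"
    using pairing_xi[OF A pm] by (simp add: fibre_square_map_def)
  finally show ?thesis .
qed

end

end

end

text \<open>The bases may differ, as they do for the vertical and the Finsler bundle of \<open>q\<close>.  Of \<open>P\<close> only
  the data are given; its axioms are the conclusion.\<close>

locale bundle_pullback = tangent_category X
  for X :: "('o, 'm) tangent" (structure) +
  fixes A B D P :: "('o, 'm) diff_bundle" and f\<^sub>A f\<^sub>B e\<^sub>A e\<^sub>B g k a b :: 'm
  assumes A: "differential_structure X A" and B: "differential_structure X B"
    and D: "differential_structure X D"
    and g: "bundle_morphism X A D f\<^sub>A g" and k: "bundle_morphism X B D f\<^sub>B k"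
    and a: "bundle_morphism X P A e\<^sub>A a" and b: "bundle_morphism X P B e\<^sub>B b"
    and base: "tangent_pullback X (baseB A) (baseB B) (baseB D) f\<^sub>A f\<^sub>B (baseB P) e\<^sub>A e\<^sub>B"
    and tot: "tangent_pullback X (totB A) (totB B) (totB D) g k (totB P) a b"
    and fibre2: "tangent_pullback X (totB P) (totB P) (baseB P) (projB P) (projB P)
       (totB2 P) (prB1 P) (prB2 P)"
    and zero_P: "zeroB P \<in> hom X (baseB P) (totB P)"
    and sum_P: "sumB P \<in> hom X (totB2 P) (totB P)"
    and lift_P: "liftB P \<in> hom X (totB P) (T\<^sub>o (totB P))"
begin

lemmas a_homs = additive_morphism_homs[OF bundle_morphism_additive[OF a]]
lemmas b_homs = additive_morphism_homs[OF bundle_morphism_additive[OF b]]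
lemmas a_eqs = additive_morphism_eqs[OF bundle_morphism_additive[OF a]]
lemmas b_eqs = additive_morphism_eqs[OF bundle_morphism_additive[OF b]]
lemmas pre_A = differential_structure_preadditive[OF A]
lemmas pre_B = differential_structure_preadditive[OF B]
lemmas pre_D = differential_structure_preadditive[OF D]

lemmas base_eqI = pullback_unique[OF tangent_pullback_pullback[OF base]]
lemmas tot_eqI = pullback_unique[OF tangent_pullback_pullback[OF tot]]
lemmas T_base_eqI = pullback_unique[OF tangent_pullback_pullback[OF tangent_pullback_T[OF base]]]
lemmas T_tot_eqI = pullback_unique[OF tangent_pullback_pullback[OF tangent_pullback_T[OF tot]]]
lemmas TT_tot_eqI = pullback_unique[OF tangent_pullback_pullback[OF
      tangent_pullback_T[OF tangent_pullback_T[OF tot]]]]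

lemma fibre2_homs:
  shows "projB P \<in> hom X (totB P) (baseB P)" and "prB1 P \<in> hom X (totB2 P) (totB P)"
    and "prB2 P \<in> hom X (totB2 P) (totB P)" and "prB1 P \<cdot> projB P = prB2 P \<cdot> projB P"
  using tangent_pullback_pullback[OF fibre2] unfolding pullback_def by auto

lemma zero_proj_after:
  assumes C: "preadditive_bundle X C" and m: "additive_bundle_morphism X P C e m"
  shows "(zeroB P \<cdot> projB P) \<cdot> e = ide X (baseB P) \<cdot> e"
proof -
  note h = preadditive_bundle_homs[OF C]
  note mh = additive_morphism_homs[OF m] and me = additive_morphism_eqs[OF m]
  have "(zeroB P \<cdot> projB P) \<cdot> e = (e \<cdot> zeroB C) \<cdot> projB C"
    using seq_assoc[OF zero_P fibre2_homs(1) mh(1)] seq_assoc[OF zero_P mh(2) h(4)] me by simp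
  then show ?thesis
    using seq_assoc[OF mh(1) h(5,4)] C seq_ide[OF mh(1)] ide_seq[OF mh(1)]
    by (simp add: preadditive_bundle_def)
qed

lemma sum_proj_after:
  assumes C: "preadditive_bundle X C" and m: "additive_bundle_morphism X P C e m"
  shows "(sumB P \<cdot> projB P) \<cdot> e = (prB1 P \<cdot> projB P) \<cdot> e"
proof -
  note h = preadditive_bundle_homs[OF C]
  note mh = additive_morphism_homs[OF m] and me = additive_morphism_eqs[OF m]
  have "(prB1 P \<cdot> m) \<cdot> projB C = (prB2 P \<cdot> m) \<cdot> projB C"
    using seq_assoc[OF fibre2_homs(2) mh(2) h(4)] seq_assoc[OF fibre2_homs(3) mh(2) h(4)]
      seq_assoc[OF fibre2_homs(2,1) mh(1)] seq_assoc[OF fibre2_homs(3,1) mh(1)] me(1) fibre2_homs(4)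
    by simp
  note s = fib_sum_hom[OF C seq_hom[OF fibre2_homs(2) mh(2)] seq_hom[OF fibre2_homs(3) mh(2)] this]
  have "(sumB P \<cdot> projB P) \<cdot> e = (sumB P \<cdot> m) \<cdot> projB C"
    using seq_assoc[OF sum_P fibre2_homs(1) mh(1)] seq_assoc[OF sum_P mh(2) h(4)] me(1) by simp
  also have "\<dots> = (prB1 P \<cdot> m) \<cdot> projB C" using s(2) me(3) by simp
  also have "\<dots> = (prB1 P \<cdot> projB P) \<cdot> e"
    using seq_assoc[OF fibre2_homs(2) mh(2) h(4)] seq_assoc[OF fibre2_homs(2,1) mh(1)] me(1) by simp
  finally show ?thesis .
qed

lemma preadditive_P: "preadditive_bundle X P"
proof -
  note am = bundle_morphism_additive[OF a] and bm = bundle_morphism_additive[OF b]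
  note i = ide_hom[OF conjunct1[OF hom_ob[OF zero_P]]]
  have "zeroB P \<cdot> projB P = ide X (baseB P)"
    by (rule base_eqI[OF seq_hom[OF zero_P fibre2_homs(1)] i
          zero_proj_after[OF pre_A am] zero_proj_after[OF pre_B bm]])
  moreover have "sumB P \<cdot> projB P = prB1 P \<cdot> projB P"
    by (rule base_eqI[OF seq_hom[OF sum_P fibre2_homs(1)] seq_hom[OF fibre2_homs(2,1)]
          sum_proj_after[OF pre_A am] sum_proj_after[OF pre_B bm]])
  ultimately show ?thesis using fibre2 zero_P sum_P by (simp add: preadditive_bundle_def)
qed

lemmas P_homs = preadditive_bundle_homs[OF preadditive_P]
lemmas P_sum = fib_sum_hom[OF preadditive_P]
lemmas sum_a = fib_sum_seq[OF preadditive_P pre_A bundle_morphism_additive[OF a]]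
lemmas sum_b = fib_sum_seq[OF preadditive_P pre_B bundle_morphism_additive[OF b]]
lemmas proj_a = same_fibre_morphism[OF preadditive_P pre_A bundle_morphism_additive[OF a]]
lemmas proj_b = same_fibre_morphism[OF preadditive_P pre_B bundle_morphism_additive[OF b]]

lemma additive_P: "additive_bundle X P"
proof -
  have addA: "additive_bundle X A" and addB: "additive_bundle X B"
    using A B by (simp_all add: differential_structure_additive)
  note hA = a_homs(2) and hB = b_homs(2)
  have assoc: "fib_sum X P Y (fib_sum X P Y u v) w = fib_sum X P Y u (fib_sum X P Y v w)"
    if u: "u \<in> hom X Y (totB P)" and v: "v \<in> hom X Y (totB P)" and w: "w \<in> hom X Y (totB P)"
      and uv: "u \<cdot> projB P = v \<cdot> projB P" and vw: "v \<cdot> projB P = w \<cdot> projB P" for Y u v w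
  proof -
    note s1 = P_sum[OF u v uv] and s2 = P_sum[OF v w vw]
    have c1: "fib_sum X P Y u v \<cdot> projB P = w \<cdot> projB P"
      and c2: "u \<cdot> projB P = fib_sum X P Y v w \<cdot> projB P"
      using s1 s2 uv vw by simp_all
    show ?thesis
    proof (rule tot_eqI[OF P_sum(1)[OF s1(1) w c1] P_sum(1)[OF u s2(1) c2]])
      show "fib_sum X P Y (fib_sum X P Y u v) w \<cdot> a = fib_sum X P Y u (fib_sum X P Y v w) \<cdot> a"
        unfolding sum_a[OF s1(1) w c1] sum_a[OF u s2(1) c2] sum_a[OF u v uv] sum_a[OF v w vw]
        using addA seq_hom[OF u hA] seq_hom[OF v hA] seq_hom[OF w hA] proj_a[OF u v uv]
          proj_a[OF v w vw] unfolding additive_bundle_def by blast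
      show "fib_sum X P Y (fib_sum X P Y u v) w \<cdot> b = fib_sum X P Y u (fib_sum X P Y v w) \<cdot> b"
        unfolding sum_b[OF s1(1) w c1] sum_b[OF u s2(1) c2] sum_b[OF u v uv] sum_b[OF v w vw]
        using addB seq_hom[OF u hB] seq_hom[OF v hB] seq_hom[OF w hB] proj_b[OF u v uv]
          proj_b[OF v w vw] unfolding additive_bundle_def by blast
    qed
  qed
  have comm: "fib_sum X P Y u v = fib_sum X P Y v u"
    if u: "u \<in> hom X Y (totB P)" and v: "v \<in> hom X Y (totB P)"
      and uv: "u \<cdot> projB P = v \<cdot> projB P" for Y u v
  proof (rule tot_eqI[OF P_sum(1)[OF u v uv] P_sum(1)[OF v u uv[symmetric]]])
    show "fib_sum X P Y u v \<cdot> a = fib_sum X P Y v u \<cdot> a"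
      unfolding sum_a[OF u v uv] sum_a[OF v u uv[symmetric]]
      by (rule fib_sum_commute[OF addA seq_hom[OF u hA] seq_hom[OF v hA] proj_a[OF u v uv]])
    show "fib_sum X P Y u v \<cdot> b = fib_sum X P Y v u \<cdot> b"
      unfolding sum_b[OF u v uv] sum_b[OF v u uv[symmetric]]
      by (rule fib_sum_commute[OF addB seq_hom[OF u hB] seq_hom[OF v hB] proj_b[OF u v uv]])
  qed
  have zero_after: "((u \<cdot> projB P) \<cdot> zeroB P) \<cdot> m = ((u \<cdot> m) \<cdot> projB C) \<cdot> zeroB C"
    if u: "u \<in> hom X Y (totB P)" and C: "preadditive_bundle X C"
      and m: "additive_bundle_morphism X P C e m" for u Y C e m
  proof -
    note h = preadditive_bundle_homs[OF C]
    note mh = additive_morphism_homs[OF m] and me = additive_morphism_eqs[OF m]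
    note up = seq_hom[OF u fibre2_homs(1)]
    show ?thesis
      using seq_assoc[OF up zero_P mh(2)] seq_assoc[OF up mh(1) h(5)]
        seq_assoc[OF u fibre2_homs(1) mh(1)] seq_assoc[OF u mh(2) h(4)] me by simp
  qed
  have unit: "fib_sum X P Y u ((u \<cdot> projB P) \<cdot> zeroB P) = u" if u: "u \<in> hom X Y (totB P)" for Y u
  proof -
    note z = fib_zero_hom[OF preadditive_P u]
    show ?thesis
    proof (rule tot_eqI[OF P_sum(1)[OF u z(1) z(2)[symmetric]] u])
      show "fib_sum X P Y u ((u \<cdot> projB P) \<cdot> zeroB P) \<cdot> a = u \<cdot> a"
        unfolding sum_a[OF u z(1) z(2)[symmetric]]
          zero_after[OF u pre_A bundle_morphism_additive[OF a]]
        by (rule fib_sum_zero[OF addA seq_hom[OF u hA]])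
      show "fib_sum X P Y u ((u \<cdot> projB P) \<cdot> zeroB P) \<cdot> b = u \<cdot> b"
        unfolding sum_b[OF u z(1) z(2)[symmetric]]
          zero_after[OF u pre_B bundle_morphism_additive[OF b]]
        by (rule fib_sum_zero[OF addB seq_hom[OF u hB]])
    qed
  qed
  have "zeroB P \<cdot> projB P = ide X (baseB P)" and "sumB P \<cdot> projB P = prB1 P \<cdot> projB P"
    using preadditive_P by (simp_all add: preadditive_bundle_def)
  then show ?thesis
    unfolding additive_bundle_def
    using preadditive_bundle_pullback[OF preadditive_P] zero_P sum_P assoc comm unit by blast
qed

lemma lift_proj_P: "liftB P \<cdot> T\<^sub>a (projB P) = projB P \<cdot> \<zz> (baseB P)"
  by (rule T_base_eqI[OF seq_hom[OF lift_P T_hom[OF P_homs(4)]] seq_hom[OF P_homs(4) z_hom[OF P_homs(2)]]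
        lift_proj_after[OF A preadditive_P lift_P a] lift_proj_after[OF B preadditive_P lift_P b]])

lemma lift_p_P: "liftB P \<cdot> \<pp> (totB P) = projB P \<cdot> zeroB P"
  by (rule tot_eqI[OF seq_hom[OF lift_P p_hom[OF P_homs(1)]] seq_hom[OF P_homs(4,5)]
        lift_p_after[OF A preadditive_P lift_P a] lift_p_after[OF B preadditive_P lift_P b]])

lemma lift_morphisms_P:
  shows "additive_bundle_morphism X P (T_bundle X P) (\<zz> (baseB P)) (liftB P)"
    and "additive_bundle_morphism X P (tangent_bundle X (totB P)) (zeroB P) (liftB P)"
proof -
  note sa = sum_lift_after[OF A preadditive_P lift_P a lift_proj_P lift_p_P]
  note sb = sum_lift_after[OF B preadditive_P lift_P b lift_proj_P lift_p_P]
  note za = zero_lift_after[OF A preadditive_P lift_P a]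
  note zb = zero_lift_after[OF B preadditive_P lift_P b]
  note l1 = seq_hom[OF P_homs(6) lift_P] and l2 = seq_hom[OF P_homs(7) lift_P]
  note sl = seq_hom[OF sum_P lift_P] and zl = seq_hom[OF zero_P lift_P]
  note zP = z_hom[OF P_homs(2)] and zt = z_hom[OF P_homs(1)]
  have pr: "(prB1 P \<cdot> liftB P) \<cdot> T\<^sub>a (projB P) = (prB2 P \<cdot> liftB P) \<cdot> T\<^sub>a (projB P)"
    "(prB1 P \<cdot> liftB P) \<cdot> \<pp> (totB P) = (prB2 P \<cdot> liftB P) \<cdot> \<pp> (totB P)"
    using seq_assoc[OF P_homs(6) lift_P T_hom[OF P_homs(4)]]
      seq_assoc[OF P_homs(7) lift_P T_hom[OF P_homs(4)]]
      seq_assoc[OF P_homs(6) lift_P p_hom[OF P_homs(1)]]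
      seq_assoc[OF P_homs(7) lift_P p_hom[OF P_homs(1)]]
      seq_assoc[OF P_homs(6,4) zP] seq_assoc[OF P_homs(7,4) zP]
      seq_assoc[OF P_homs(6,4,5)] seq_assoc[OF P_homs(7,4,5)]
      lift_proj_P lift_p_P projections_same_fibre[OF preadditive_P] by simp_all
  have zero: "zeroB P \<cdot> liftB P = \<zz> (baseB P) \<cdot> T\<^sub>a (zeroB P)"
    by (rule T_tot_eqI[OF zl seq_hom[OF zP T_hom[OF P_homs(5)]] za(1) zb(1)])
  have zero': "zeroB P \<cdot> liftB P = zeroB P \<cdot> \<zz> (totB P)"
    by (rule T_tot_eqI[OF zl seq_hom[OF P_homs(5) zt] za(2) zb(2)])
  have sum: "sumB P \<cdot> liftB P =
      fib_sum X (T_bundle X P) (totB2 P) (prB1 P \<cdot> liftB P) (prB2 P \<cdot> liftB P)"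
    using fib_sum_hom(1)[OF preadditive_bundle_T[OF preadditive_P], of "prB1 P \<cdot> liftB P" "totB2 P"
        "prB2 P \<cdot> liftB P"] l1 l2 pr(1)
    by (intro T_tot_eqI[OF sl _ sa(1) sb(1)]) simp
  have sum': "sumB P \<cdot> liftB P =
      fib_sum X (tangent_bundle X (totB P)) (totB2 P) (prB1 P \<cdot> liftB P) (prB2 P \<cdot> liftB P)"
    using fib_sum_hom(1)[OF preadditive_tangent_bundle[OF P_homs(1)], of "prB1 P \<cdot> liftB P"
        "totB2 P" "prB2 P \<cdot> liftB P"] l1 l2 pr(2)
    by (intro T_tot_eqI[OF sl _ sa(2) sb(2)]) simp
  show "additive_bundle_morphism X P (T_bundle X P) (\<zz> (baseB P)) (liftB P)"
    unfolding additive_bundle_morphism_def T_bundle_simps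
    using zP lift_P lift_proj_P[symmetric] zero sum by blast
  show "additive_bundle_morphism X P (tangent_bundle X (totB P)) (zeroB P) (liftB P)"
    unfolding additive_bundle_morphism_def tangent_bundle_simps
    using zero_P lift_P lift_p_P[symmetric] zero' sum' by blast
qed

lemma lift_lift_P: "liftB P \<cdot> \<ll> (totB P) = liftB P \<cdot> T\<^sub>a (liftB P)"
  by (rule TT_tot_eqI[OF seq_hom[OF lift_P l_hom[OF P_homs(1)]] seq_hom[OF lift_P T_hom[OF lift_P]]
        lift_lift_after[OF A preadditive_P lift_P a] lift_lift_after[OF B preadditive_P lift_P b]])

text \<open>The fibre squares are themselves pullbacks of bundle projections, so this is the interchange of
  two pullbacks.\<close>

lemma fibre_squares_pullback:
  "tangent_pullback X (totB2 A) (totB2 B) (totB2 D) (fibre_square_map X A D g)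
     (fibre_square_map X B D k) (totB2 P) (fibre_square_map X P A a) (fibre_square_map X P B b)"
proof -
  note hA = preadditive_bundle_homs[OF pre_A] and hB = preadditive_bundle_homs[OF pre_B]
    and hD = preadditive_bundle_homs[OF pre_D]
  note ga = bundle_morphism_additive[OF g] and ka = bundle_morphism_additive[OF k]
  note gh = additive_morphism_homs[OF ga] and kh = additive_morphism_homs[OF ka]
  note sqa = fibre_square_map[OF A preadditive_P lift_P a]
    and sqb = fibre_square_map[OF B preadditive_P lift_P b]
    and sqg = fibre_square_map[OF D pre_A lift_hom[OF A] g]
    and sqk = fibre_square_map[OF D pre_B lift_hom[OF B] k]
  have fib: "tangent_pullback X (totB b) (totB b) (baseB b) (projB b) (projB b) (totB2 b) (prB1 b) (prB2 b)"
    if "preadditive_bundle X b" for b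
    using that by (simp add: preadditive_bundle_def)
  show ?thesis
    by (rule tangent_pullback_of_pullbacks[OF tot tot base fib[OF preadditive_P] fib[OF pre_A]
          fib[OF pre_B] fib[OF pre_D]])
      (use sqa sqb sqg sqk hA hB hD P_homs a_homs b_homs gh kh
        additive_morphism_eqs(1)[OF ga] additive_morphism_eqs(1)[OF ka] a_eqs(1) b_eqs(1)
        in \<open>auto simp: commuting_square_def\<close>)
qed

text \<open>The universal square of \<open>P\<close> is the pullback of the universal squares of \<open>A\<close>, \<open>B\<close> and \<open>D\<close>,
  by naturality of \<open>\<xi>\<close>.\<close>

lemma universal_P: "universal_lift X P"
proof -
  note hA = preadditive_bundle_homs[OF pre_A] and hB = preadditive_bundle_homs[OF pre_B]
    and hD = preadditive_bundle_homs[OF pre_D]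
  note ga = bundle_morphism_additive[OF g] and ka = bundle_morphism_additive[OF k]
  note gh = additive_morphism_homs[OF ga] and kh = additive_morphism_homs[OF ka]
  note sqa = fibre_square_map[OF A preadditive_P lift_P a]
    and sqb = fibre_square_map[OF B preadditive_P lift_P b]
    and sqg = fibre_square_map[OF D pre_A lift_hom[OF A] g]
    and sqk = fibre_square_map[OF D pre_B lift_hom[OF B] k]
  note xa = xi_natural[OF A preadditive_P lift_P a lift_proj_P lift_p_P]
    and xb = xi_natural[OF B preadditive_P lift_P b lift_proj_P lift_p_P]
    and xg = xi_natural[OF D pre_A lift_hom[OF A] g lift_proj(1)[OF A] lift_proj(4)[OF A]]
    and xk = xi_natural[OF D pre_B lift_hom[OF B] k lift_proj(1)[OF B] lift_proj(4)[OF B]]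
  note xh = xi_hom(1)[OF A] xi_hom(1)[OF B] xi_hom(1)[OF D]
    bundle_xi_hom[OF A preadditive_P lift_P a lift_proj_P lift_p_P]
  have U: "tangent_pullback X (T\<^sub>o (totB b)) (baseB b) (T\<^sub>o (baseB b)) (T\<^sub>a (projB b)) (\<zz> (baseB b))
       (totB2 b) (bundle_xi X b) (prB1 b \<cdot> projB b)" if "differential_structure X b" for b
    using that by (simp add: differential_structure_def universal_lift_def)
  have bdry: "(prB1 Q \<cdot> projB Q) \<cdot> e = fibre_square_map X Q C m \<cdot> (prB1 C \<cdot> projB C)"
    if Q: "preadditive_bundle X Q" "liftB Q \<in> hom X (totB Q) (T\<^sub>o (totB Q))"
      and C: "differential_structure X C" and m: "bundle_morphism X Q C e m" for Q C e m
  proof -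
    note hQ = preadditive_bundle_homs[OF Q(1)]
      and hC = preadditive_bundle_homs[OF differential_structure_preadditive[OF C]]
    note mh = additive_morphism_homs[OF bundle_morphism_additive[OF m]]
    note s = fibre_square_map[OF C Q m]
    show ?thesis
      using seq_assoc[OF hQ(6,4) mh(1)] seq_assoc[OF hQ(6) mh(2) hC(4)] seq_assoc[OF s(1) hC(6,4)]
        s(2) additive_morphism_eqs(1)[OF bundle_morphism_additive[OF m]] by simp
  qed
  have T_proj: "T\<^sub>a (projB Q) \<cdot> T\<^sub>a e = T\<^sub>a m \<cdot> T\<^sub>a (projB C)"
    if Q: "preadditive_bundle X Q" and C: "preadditive_bundle X C"
      and m: "bundle_morphism X Q C e m" for Q C e m
    using T_additive_morphism[OF Q C bundle_morphism_additive[OF m]]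
      additive_morphism_eqs(1) by fastforce
  note w = seq_hom[OF P_homs(6,4)] seq_hom[OF hA(6,4)] seq_hom[OF hB(6,4)] seq_hom[OF hD(6,4)]
  have Th: "T\<^sub>a (projB b) \<in> hom X (T\<^sub>o (totB b)) (T\<^sub>o (baseB b))" "\<zz> (baseB b) \<in> hom X (baseB b) (T\<^sub>o (baseB b))"
    if "preadditive_bundle X b" for b
    using preadditive_bundle_homs[OF that] T_hom z_hom by auto
  show ?thesis
    unfolding universal_lift_def
  proof (rule tangent_pullback_of_pullbacks[OF U[OF A] U[OF B] U[OF D] fibre_squares_pullback
          tangent_pullback_T[OF tot] base tangent_pullback_T[OF base]])
    show "commuting_square X (totB2 A) (totB2 D) (T\<^sub>o (totB A)) (T\<^sub>o (totB D))
        (fibre_square_map X A D g) (bundle_xi X D) (bundle_xi X A) (T\<^sub>a g)"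
      using sqg(1) xh xg T_hom[OF gh(2)] by (simp add: commuting_square_def)
    show "commuting_square X (totB2 B) (totB2 D) (T\<^sub>o (totB B)) (T\<^sub>o (totB D))
        (fibre_square_map X B D k) (bundle_xi X D) (bundle_xi X B) (T\<^sub>a k)"
      using sqk(1) xh xk T_hom[OF kh(2)] by (simp add: commuting_square_def)
    show "commuting_square X (totB2 P) (totB2 A) (T\<^sub>o (totB P)) (T\<^sub>o (totB A))
        (fibre_square_map X P A a) (bundle_xi X A) (bundle_xi X P) (T\<^sub>a a)"
      using sqa(1) xh xa T_hom[OF a_homs(2)] by (simp add: commuting_square_def)
    show "commuting_square X (totB2 P) (totB2 B) (T\<^sub>o (totB P)) (T\<^sub>o (totB B))
        (fibre_square_map X P B b) (bundle_xi X B) (bundle_xi X P) (T\<^sub>a b)"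
      using sqb(1) xh xb T_hom[OF b_homs(2)] by (simp add: commuting_square_def)
    show "commuting_square X (totB2 A) (totB2 D) (baseB A) (baseB D)
        (fibre_square_map X A D g) (prB1 D \<cdot> projB D) (prB1 A \<cdot> projB A) f\<^sub>A"
      using sqg(1) w gh(1) bdry[OF pre_A lift_hom[OF A] D g] by (simp add: commuting_square_def)
    show "commuting_square X (totB2 B) (totB2 D) (baseB B) (baseB D)
        (fibre_square_map X B D k) (prB1 D \<cdot> projB D) (prB1 B \<cdot> projB B) f\<^sub>B"
      using sqk(1) w kh(1) bdry[OF pre_B lift_hom[OF B] D k] by (simp add: commuting_square_def)
    show "commuting_square X (totB2 P) (totB2 A) (baseB P) (baseB A)
        (fibre_square_map X P A a) (prB1 A \<cdot> projB A) (prB1 P \<cdot> projB P) e\<^sub>A"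
      using sqa(1) w a_homs(1) bdry[OF preadditive_P lift_P A a] by (simp add: commuting_square_def)
    show "commuting_square X (totB2 P) (totB2 B) (baseB P) (baseB B)
        (fibre_square_map X P B b) (prB1 B \<cdot> projB B) (prB1 P \<cdot> projB P) e\<^sub>B"
      using sqb(1) w b_homs(1) bdry[OF preadditive_P lift_P B b] by (simp add: commuting_square_def)
    show "commuting_square X (T\<^sub>o (totB P)) (T\<^sub>o (totB A)) (T\<^sub>o (baseB P)) (T\<^sub>o (baseB A))
        (T\<^sub>a a) (T\<^sub>a (projB A)) (T\<^sub>a (projB P)) (T\<^sub>a e\<^sub>A)"
      using a_homs T_hom Th(1)[OF pre_A] Th(1)[OF preadditive_P] T_proj[OF preadditive_P pre_A a]
      by (simp add: commuting_square_def)
    show "commuting_square X (T\<^sub>o (totB P)) (T\<^sub>o (totB B)) (T\<^sub>o (baseB P)) (T\<^sub>o (baseB B))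
        (T\<^sub>a b) (T\<^sub>a (projB B)) (T\<^sub>a (projB P)) (T\<^sub>a e\<^sub>B)"
      using b_homs T_hom Th(1)[OF pre_B] Th(1)[OF preadditive_P] T_proj[OF preadditive_P pre_B b]
      by (simp add: commuting_square_def)
    show "commuting_square X (baseB P) (baseB A) (T\<^sub>o (baseB P)) (T\<^sub>o (baseB A))
        e\<^sub>A (\<zz> (baseB A)) (\<zz> (baseB P)) (T\<^sub>a e\<^sub>A)"
      using a_homs(1) T_hom[OF a_homs(1)] Th(2)[OF pre_A] Th(2)[OF preadditive_P] z_natural[OF a_homs(1)]
      by (simp add: commuting_square_def)
    show "commuting_square X (baseB P) (baseB B) (T\<^sub>o (baseB P)) (T\<^sub>o (baseB B))
        e\<^sub>B (\<zz> (baseB B)) (\<zz> (baseB P)) (T\<^sub>a e\<^sub>B)"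
      using b_homs(1) T_hom[OF b_homs(1)] Th(2)[OF pre_B] Th(2)[OF preadditive_P] z_natural[OF b_homs(1)]
      by (simp add: commuting_square_def)
  qed
qed

theorem differential_structure_pullback: "differential_structure X P"
  unfolding differential_structure_def
  using additive_P fibre2 lift_morphisms_P lift_lift_P universal_P by blast

end

section \<open>Vertical, Finsler and Whitney sum bundles\<close>

context tangent_category
begin

lemma bundle_morphism_linear:
  assumes "differential_structure X b" and "differential_structure X b'"
    and "f \<in> hom X (baseB b) (baseB b')" and "g \<in> hom X (totB b) (totB b')"
    and "projB b \<cdot> f = g \<cdot> projB b'" and "g \<cdot> liftB b' = liftB b \<cdot> T\<^sub>a g"
  shows "bundle_morphism X b b' f g"
  using linear_additive[OF assms] assms(6) by (simp add: bundle_morphism_def)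

lemma bundle_morphism_proj:
  assumes b: "differential_structure X b"
  shows "bundle_morphism X b (trivial_bundle X (baseB b)) (ide X (baseB b)) (projB b)"
proof -
  note h = preadditive_bundle_homs[OF differential_structure_preadditive[OF b]]
  show ?thesis
    using bundle_morphism_linear[OF b differential_structure_trivial_bundle[OF h(2)],
        of "ide X (baseB b)" "projB b"] ide_hom[OF h(2)] h(4) lift_proj(1)[OF b]
    by simp
qed

lemma bundle_morphism_trivial:
  assumes q: "q \<in> hom X E M"
  shows "bundle_morphism X (trivial_bundle X E) (trivial_bundle X M) q q"
  using bundle_morphism_linear[of "trivial_bundle X E" "trivial_bundle X M" q q]
    differential_structure_trivial_bundle hom_ob[OF q] q z_natural[OF q]
  by (simp add: ide_seq[OF q] seq_ide[OF q])

lemma bundle_morphism_zero_section: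
  assumes M: "M \<in> ob X"
  shows "bundle_morphism X (trivial_bundle X M) (tangent_bundle X M) (ide X M) (\<zz> M)"
  using bundle_morphism_linear[OF differential_structure_trivial_bundle[OF M]
      differential_structure_tangent_bundle[OF M], of "ide X M" "\<zz> M"]
    ide_hom[OF M] z_hom[OF M] z_p[OF M] ide_seq[OF ide_hom[OF M]]
    lift_proj(2)[OF differential_structure_tangent_bundle[OF M]]
  by simp

lemma bundle_morphism_tangent:
  assumes q: "q \<in> hom X E M"
  shows "bundle_morphism X (tangent_bundle X E) (tangent_bundle X M) q (T\<^sub>a q)"
  using tangent_additive_morphism[OF q] l_natural[OF q] by (simp add: bundle_morphism_def)

lemma base_pullback_over_identity:
  "q \<in> hom X E M \<Longrightarrow> tangent_pullback X E M M q (ide X M) E (ide X E) q"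
  by (rule tangent_pullback_flip[OF tangent_pullback_of_identity])

text \<open>\<open>Vq\<close> is the kernel of \<open>Tq\<close>: the pullback of \<open>Tq : p\<^sub>E \<rightarrow> p\<^sub>M\<close> along the zero section, seen as a
  linear map from the trivial bundle on \<open>M\<close>.\<close>

lemma differential_structure_vertical:
  assumes q: "q \<in> hom X E M" and V: "vertical_bundle X E M q V \<iota> t"
  shows "differential_structure X V" and "linear_over X V (tangent_bundle X E) \<iota>"
proof -
  have E: "E \<in> ob X" and M: "M \<in> ob X" using hom_ob[OF q] by auto
  have tot: "tangent_pullback X (T\<^sub>o E) M (T\<^sub>o M) (T\<^sub>a q) (\<zz> M) (totB V) \<iota> t"
    and base: "baseB V = E" and proj: "projB V = \<iota> \<cdot> \<pp> E"
    and fib: "tangent_pullback X (totB V) (totB V) E (projB V) (projB V) (totB2 V) (prB1 V) (prB2 V)"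
    and zero: "zeroB V \<in> hom X E (totB V)" "zeroB V \<cdot> \<iota> = \<zz> E"
    and sum: "sumB V \<in> hom X (totB2 V) (totB V)"
      "sumB V \<cdot> \<iota> = fib_sum X (tangent_bundle X E) (totB2 V) (prB1 V \<cdot> \<iota>) (prB2 V \<cdot> \<iota>)"
    and lift: "liftB V \<in> hom X (totB V) (T\<^sub>o (totB V))" "liftB V \<cdot> T\<^sub>a \<iota> = \<iota> \<cdot> \<ll> E"
    using V unfolding vertical_bundle_def by blast+
  have i: "\<iota> \<in> hom X (totB V) (T\<^sub>o E)" and th: "t \<in> hom X (totB V) M"
    and it: "\<iota> \<cdot> T\<^sub>a q = t \<cdot> \<zz> M"
    using tangent_pullback_pullback[OF tot] unfolding pullback_def by auto
  have pr: "prB1 V \<in> hom X (totB2 V) (totB V)" "prB2 V \<in> hom X (totB2 V) (totB V)"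
    "projB V \<in> hom X (totB V) E" "prB1 V \<cdot> projB V = prB2 V \<cdot> projB V"
    using tangent_pullback_pullback[OF fib] unfolding pullback_def by auto
  note p = p_hom[OF E] and tE = preadditive_tangent_bundle[OF E]
    and dE = differential_structure_tangent_bundle[OF E]
  \<comment> \<open>Compose \<open>\<iota> Tq = t z\<^sub>M\<close> with \<open>p\<^sub>M\<close>; every condition on \<open>t\<close> then is one on \<open>projB V\<close>.\<close>
  have t: "t = projB V \<cdot> q"
    using proj seq_assoc[OF i p q] p_natural[OF q] seq_assoc[OF i T_hom[OF q] p_hom[OF M]] it
      seq_assoc[OF th z_hom[OF M] p_hom[OF M]] z_p[OF M] seq_ide[OF th] by simp
  have pr_p: "(prB1 V \<cdot> \<iota>) \<cdot> \<pp> E = (prB2 V \<cdot> \<iota>) \<cdot> \<pp> E"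
    using seq_assoc[OF pr(1) i p] seq_assoc[OF pr(2) i p] pr(4) proj by simp
  have zero_proj: "zeroB V \<cdot> projB V = ide X E"
    using proj seq_assoc[OF zero(1) i p] zero(2) z_p[OF E] by simp
  have sum_proj: "sumB V \<cdot> projB V = prB1 V \<cdot> projB V"
    using proj seq_assoc[OF sum(1) i p] sum(2) seq_assoc[OF pr(1) i p] pr_p
      fib_sum_hom(2)[OF tE, of "prB1 V \<cdot> \<iota>" "totB2 V" "prB2 V \<cdot> \<iota>"] seq_hom[OF pr(1) i] seq_hom[OF pr(2) i]
    by simp
  have lift_proj: "liftB V \<cdot> T\<^sub>a (projB V) = projB V \<cdot> \<zz> E"
    using proj T_seq[OF i p] seq_assoc[OF lift(1) T_hom[OF i] T_hom[OF p]] lift(2)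
      seq_assoc[OF i l_hom[OF E] T_hom[OF p]] lift_proj(1)[OF dE]
      seq_assoc[OF i p z_hom[OF E]] by simp
  have zt: "zeroB V \<cdot> t = q"
    using t seq_assoc[OF zero(1) pr(3) q] zero_proj ide_seq[OF q] by simp
  have prt: "prB1 V \<cdot> t = prB2 V \<cdot> t" "sumB V \<cdot> t = prB1 V \<cdot> t"
    using t seq_assoc[OF pr(1,3) q] seq_assoc[OF pr(2,3) q] seq_assoc[OF sum(1) pr(3) q] pr(4) sum_proj
    by simp_all
  have lt: "t \<cdot> \<zz> M = liftB V \<cdot> T\<^sub>a t"
    using t T_seq[OF pr(3) q] seq_assoc[OF lift(1) T_hom[OF pr(3)] T_hom[OF q]] lift_proj
      seq_assoc[OF pr(3) z_hom[OF E] T_hom[OF q]] seq_assoc[OF pr(3) q z_hom[OF M]] z_natural[OF q]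
    by simp
  have a: "bundle_morphism X V (tangent_bundle X E) (ide X E) \<iota>"
    unfolding bundle_morphism_def additive_bundle_morphism_def tangent_bundle_simps base
    using ide_hom[OF E] i seq_ide[OF pr(3)] proj zero(2) ide_seq[OF z_hom[OF E]] sum(2) lift(2)
    by simp
  have b: "bundle_morphism X V (trivial_bundle X M) q t"
    using q th t seq_ide[OF th] seq_ide[OF q] zt prt fib_sum_trivial[OF seq_hom[OF pr(1) th]] lt base
    by (simp add: bundle_morphism_def additive_bundle_morphism_def)
  have "bundle_pullback X (tangent_bundle X E) (trivial_bundle X M) (tangent_bundle X M) V
      q (ide X M) (ide X E) q (T\<^sub>a q) (\<zz> M) \<iota> t"
    by unfold_locales
      (use dE differential_structure_trivial_bundle[OF M] differential_structure_tangent_bundle[OF M]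
        bundle_morphism_tangent[OF q] bundle_morphism_zero_section[OF M] a b
        base_pullback_over_identity[OF q] tot base fib zero sum lift in simp_all)
  then show "differential_structure X V" by (rule bundle_pullback.differential_structure_pullback)
  show "linear_over X V (tangent_bundle X E) \<iota>"
    using i proj lift by (simp add: linear_over_def)
qed

text \<open>\<open>Fq\<close> is the reindexing of \<open>p\<^sub>M\<close> along \<open>q\<close>: the pullback of \<open>p\<^sub>M\<close> and the trivial bundle on \<open>E\<close>
  over the trivial bundle on \<open>M\<close>.\<close>

lemma differential_structure_finsler:
  assumes q: "q \<in> hom X E M" and F: "finsler_bundle X E M q F t"
  shows "differential_structure X F"
proof -
  have E: "E \<in> ob X" and M: "M \<in> ob X" using hom_ob[OF q] by auto
  have tot: "tangent_pullback X E (T\<^sub>o M) M q (\<pp> M) (totB F) (projB F) t"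
    and base: "baseB F = E"
    and fib: "tangent_pullback X (totB F) (totB F) E (projB F) (projB F) (totB2 F) (prB1 F) (prB2 F)"
    and zero: "zeroB F \<in> hom X E (totB F)" "zeroB F \<cdot> projB F = ide X E" "zeroB F \<cdot> t = q \<cdot> \<zz> M"
    and sum: "sumB F \<in> hom X (totB2 F) (totB F)" "sumB F \<cdot> projB F = prB1 F \<cdot> projB F"
      "sumB F \<cdot> t = fib_sum X (tangent_bundle X M) (totB2 F) (prB1 F \<cdot> t) (prB2 F \<cdot> t)"
    and lift: "liftB F \<in> hom X (totB F) (T\<^sub>o (totB F))" "liftB F \<cdot> T\<^sub>a (projB F) = projB F \<cdot> \<zz> E"
      "liftB F \<cdot> T\<^sub>a t = t \<cdot> \<ll> M"
    using F unfolding finsler_bundle_def by blast+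
  have th: "t \<in> hom X (totB F) (T\<^sub>o M)" and tp: "projB F \<cdot> q = t \<cdot> \<pp> M"
    using tangent_pullback_pullback[OF tot] unfolding pullback_def by auto
  have pr: "prB1 F \<in> hom X (totB2 F) (totB F)" "projB F \<in> hom X (totB F) E"
    "prB1 F \<cdot> projB F = prB2 F \<cdot> projB F"
    using tangent_pullback_pullback[OF fib] unfolding pullback_def by auto
  have a: "bundle_morphism X F (trivial_bundle X E) (ide X E) (projB F)"
    using ide_hom[OF E] pr base zero sum lift fib_sum_trivial[OF seq_hom[OF pr(1,2)]]
      ide_seq[OF ide_hom[OF E]]
    by (simp add: bundle_morphism_def additive_bundle_morphism_def)
  have b: "bundle_morphism X F (tangent_bundle X M) q t"
    using q th tp base zero sum lift by (simp add: bundle_morphism_def additive_bundle_morphism_def)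
  have "bundle_pullback X (trivial_bundle X E) (tangent_bundle X M) (trivial_bundle X M) F
      q (ide X M) (ide X E) q q (\<pp> M) (projB F) t"
    by unfold_locales
      (use differential_structure_trivial_bundle[OF M] differential_structure_tangent_bundle[OF M]
        differential_structure_trivial_bundle[OF E] bundle_morphism_trivial[OF q]
        bundle_morphism_proj[OF differential_structure_tangent_bundle[OF M]] a b
        base_pullback_over_identity[OF q] tot base fib zero sum lift in simp_all)
  then show ?thesis by (rule bundle_pullback.differential_structure_pullback)
qed

lemma linear_horizontal_descent:
  assumes q: "q \<in> hom X E M" and F: "finsler_bundle X E M q F t"
  shows "linear_over X (tangent_bundle X E) F (horizontal_descent X E q F t)"
proof -
  have E: "E \<in> ob X" and M: "M \<in> ob X" using hom_ob[OF q] by auto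
  have tot: "tangent_pullback X E (T\<^sub>o M) M q (\<pp> M) (totB F) (projB F) t"
    and lift: "liftB F \<in> hom X (totB F) (T\<^sub>o (totB F))" "liftB F \<cdot> T\<^sub>a (projB F) = projB F \<cdot> \<zz> E"
      "liftB F \<cdot> T\<^sub>a t = t \<cdot> \<ll> M"
    using F unfolding finsler_bundle_def by blast+
  note pb = tangent_pullback_pullback[OF tot]
  have th: "t \<in> hom X (totB F) (T\<^sub>o M)" and ph: "projB F \<in> hom X (totB F) E"
    using pb unfolding pullback_def by auto
  note p = p_hom[OF E] and l = l_hom[OF E] and Tq = T_hom[OF q]
  let ?d = "horizontal_descent X E q F t"
  have d: "?d \<in> hom X (T\<^sub>o E) (totB F)" "?d \<cdot> projB F = \<pp> E" "?d \<cdot> t = T\<^sub>a q"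
    unfolding horizontal_descent_def
    using pullback_pairing[OF pb p Tq] p_natural[OF q] by simp_all
  have "?d \<cdot> liftB F = \<ll> E \<cdot> T\<^sub>a ?d"
  proof (rule pullback_unique[OF tangent_pullback_pullback[OF tangent_pullback_T[OF tot]]])
    show "?d \<cdot> liftB F \<in> hom X (T\<^sub>o E) (T\<^sub>o (totB F))" "\<ll> E \<cdot> T\<^sub>a ?d \<in> hom X (T\<^sub>o E) (T\<^sub>o (totB F))"
      using d lift l T_hom seq_hom by blast+
    show "(?d \<cdot> liftB F) \<cdot> T\<^sub>a (projB F) = (\<ll> E \<cdot> T\<^sub>a ?d) \<cdot> T\<^sub>a (projB F)"
      using seq_assoc[OF d(1) lift(1) T_hom[OF ph]] lift(2) seq_assoc[OF d(1) ph z_hom[OF E]] d(2)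
        seq_assoc[OF l T_hom[OF d(1)] T_hom[OF ph]] T_seq[OF d(1) ph]
        lift_proj(1)[OF differential_structure_tangent_bundle[OF E]] by simp
    show "(?d \<cdot> liftB F) \<cdot> T\<^sub>a t = (\<ll> E \<cdot> T\<^sub>a ?d) \<cdot> T\<^sub>a t"
      using seq_assoc[OF d(1) lift(1) T_hom[OF th]] lift(3) seq_assoc[OF d(1) th l_hom[OF M]] d(3)
        seq_assoc[OF l T_hom[OF d(1)] T_hom[OF th]] T_seq[OF d(1) th] l_natural[OF q] by simp
  qed
  with d show ?thesis by (simp add: linear_over_def)
qed

text \<open>The Whitney sum is the pullback of \<open>A\<close> and \<open>B\<close> over the trivial bundle.  Its projection factors as
  \<open>P \<rightarrow> A \<rightarrow> E\<close>, a pullback of a display map followed by a display map.\<close>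

lemma whitney_sum_exists:
  assumes A: "differential_bundle X A" "baseB A = E" and B: "differential_bundle X B" "baseB B = E"
  obtains P a b where "differential_bundle X P" and "baseB P = E"
    and "linear_over X P A a" and "linear_over X P B b"
    and "tangent_pullback X (totB A) (totB B) E (projB A) (projB B) (totB P) a b"
proof -
  have dA: "differential_structure X A" "tangent_display X (totB A) E (projB A)"
    and dB: "differential_structure X B" "tangent_display X (totB B) E (projB B)"
    using A B by (auto simp: differential_bundle_iff)
  note preA = differential_structure_preadditive[OF dA(1)]
    and preB = differential_structure_preadditive[OF dB(1)]
  note hA = preadditive_bundle_homs[OF preA, unfolded A(2)]
    and hB = preadditive_bundle_homs[OF preB, unfolded B(2)]
  note E = hA(2)
  obtain W a b where W: "tangent_pullback X (totB A) (totB B) E (projB A) (projB B) W a b"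
    using display_pullback[OF dA(2) hB(4)] .
  note W0 = tangent_pullback_pullback[OF W]
  note W1 = tangent_pullback_pullback[OF tangent_pullback_T[OF W]]
  have a: "a \<in> hom X W (totB A)" and b: "b \<in> hom X W (totB B)" and ab: "a \<cdot> projB A = b \<cdot> projB B"
    using W0 by (auto simp: pullback_def)
  define r where "r = a \<cdot> projB A"
  have rb: "r = b \<cdot> projB B" using r_def ab by simp
  have r: "r \<in> hom X W E" unfolding r_def by (rule seq_hom[OF a hA(4)])
  have disp: "tangent_display X W E r"
    unfolding r_def by (rule display_seq[OF display_stable[OF dB(2) W] dA(2)])
  obtain Q r1 r2 where Q: "tangent_pullback X W W E r r Q r1 r2"
    using display_pullback[OF disp r] .
  have r12: "r1 \<in> hom X Q W" "r2 \<in> hom X Q W" "r1 \<cdot> r = r2 \<cdot> r"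
    using tangent_pullback_pullback[OF Q] by (auto simp: pullback_def)
  have zAB: "zeroB A \<cdot> projB A = zeroB B \<cdot> projB B"
    using preA preB A(2) B(2) by (simp add: preadditive_bundle_def)
  note zero = pullback_pairing[OF W0 hA(5) hB(5) zAB]
  note ra = seq_hom[OF r12(1) a] seq_hom[OF r12(2) a] and rbh = seq_hom[OF r12(1) b] seq_hom[OF r12(2) b]
  have rA: "(r1 \<cdot> a) \<cdot> projB A = (r2 \<cdot> a) \<cdot> projB A"
    using seq_assoc[OF r12(1) a hA(4)] seq_assoc[OF r12(2) a hA(4)] r12(3) r_def by simp
  have rB: "(r1 \<cdot> b) \<cdot> projB B = (r2 \<cdot> b) \<cdot> projB B"
    using seq_assoc[OF r12(1) b hB(4)] seq_assoc[OF r12(2) b hB(4)] r12(3) rb by simp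
  note sA = fib_sum_hom[OF preA ra rA] and sB = fib_sum_hom[OF preB rbh rB]
  have sAB: "fib_sum X A Q (r1 \<cdot> a) (r2 \<cdot> a) \<cdot> projB A = fib_sum X B Q (r1 \<cdot> b) (r2 \<cdot> b) \<cdot> projB B"
    using sA(2) sB(2) seq_assoc[OF r12(1) a hA(4)] seq_assoc[OF r12(1) b hB(4)] ab by simp
  note sum = pullback_pairing[OF W0 sA(1) sB(1) sAB]
  note lA = lift_hom[OF dA(1)] and lB = lift_hom[OF dB(1)]
  have lAB: "(a \<cdot> liftB A) \<cdot> T\<^sub>a (projB A) = (b \<cdot> liftB B) \<cdot> T\<^sub>a (projB B)"
    using seq_assoc[OF a lA T_hom[OF hA(4)]] seq_assoc[OF b lB T_hom[OF hB(4)]]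
      lift_proj(1)[OF dA(1)] lift_proj(1)[OF dB(1)] A(2) B(2)
      seq_assoc[OF a hA(4) z_hom[OF E]] seq_assoc[OF b hB(4) z_hom[OF E]] ab by simp
  note lift = pullback_pairing[OF W1 seq_hom[OF a lA] seq_hom[OF b lB] lAB]
  define P where "P = \<lparr>totB = W, baseB = E, projB = r, totB2 = Q, prB1 = r1, prB2 = r2,
     zeroB = pairing X E W a b (zeroB A) (zeroB B),
     sumB = pairing X Q W a b (fib_sum X A Q (r1 \<cdot> a) (r2 \<cdot> a)) (fib_sum X B Q (r1 \<cdot> b) (r2 \<cdot> b)),
     liftB = pairing X W (T\<^sub>o W) (T\<^sub>a a) (T\<^sub>a b) (a \<cdot> liftB A) (b \<cdot> liftB B)\<rparr>"
  note i = ide_hom[OF E]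
  have ma: "bundle_morphism X P A (ide X E) a" and mb: "bundle_morphism X P B (ide X E) b"
    unfolding bundle_morphism_def additive_bundle_morphism_def
    using A(2) B(2) i a b r_def rb seq_ide[OF r] zero sum lift ide_seq[OF hA(5)] ide_seq[OF hB(5)]
    by (simp_all add: P_def)
  have "bundle_pullback X A B (trivial_bundle X E) P (ide X E) (ide X E) (ide X E) (ide X E)
      (projB A) (projB B) a b"
    by unfold_locales
      (use dA dB A(2) B(2) differential_structure_trivial_bundle[OF E]
        bundle_morphism_proj[OF dA(1)] bundle_morphism_proj[OF dB(1)] ma mb W
        tangent_pullback_of_identity[OF i] zero sum lift Q in \<open>simp_all add: P_def\<close>)
  then have "differential_structure X P" by (rule bundle_pullback.differential_structure_pullback)
  then have "differential_bundle X P"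
    using disp by (simp add: differential_bundle_iff P_def)
  moreover have "linear_over X P A a" "linear_over X P B b"
    using a b r_def rb lift by (simp_all add: linear_over_def P_def)
  ultimately show thesis using that[of P a b] W by (simp add: P_def)
qed

section \<open>The category of differential bundles over an object\<close>

lemma DB_simps [simp]:
  "hom (DB X E) b b' = {f. differential_bundle X b \<and> baseB b = E \<and>
     differential_bundle X b' \<and> baseB b' = E \<and> linear_over X b b' f}"
  "ob (DB X E) = {b. differential_bundle X b \<and> baseB b = E}"
  "ide (DB X E) b = ide X (totB b)"
  "seq (DB X E) = seq X"
  by (simp_all add: DB_def)

lemma DB_homD:
  assumes "f \<in> hom (DB X E) A B"
  shows "differential_structure X A" and "differential_structure X B"
    and "baseB A = E" and "baseB B = E" and "f \<in> hom X (totB A) (totB B)"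
    and "f \<cdot> projB B = projB A" and "f \<cdot> liftB B = liftB A \<cdot> T\<^sub>a f"
  using assms by (auto simp: differential_bundle_iff linear_over_def)

lemma DB_hom_additive:
  assumes f: "f \<in> hom (DB X E) A B"
  shows "additive_bundle_morphism X A B (ide X E) f"
proof -
  note d = DB_homD[OF f]
  note h = preadditive_bundle_homs[OF differential_structure_preadditive[OF d(1)], unfolded d(3)]
  show ?thesis
    using linear_additive[OF d(1,2), of "ide X E" f] d ide_hom[OF h(2)] seq_ide[OF h(4)] by simp
qed

text \<open>The lift is additive as a morphism to \<open>T\<close> of the bundle, and \<open>T\<close> preserves sums.\<close>

lemma DB_sum_hom:
  assumes f: "f \<in> hom (DB X E) A B" and g: "g \<in> hom (DB X E) A B"
  shows "fib_sum X B (totB A) f g \<in> hom (DB X E) A B"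
proof -
  note df = DB_homD[OF f] and dg = DB_homD[OF g]
  note pre = differential_structure_preadditive[OF df(2)]
  note hA = preadditive_bundle_homs[OF differential_structure_preadditive[OF df(1)]]
  note lA = lift_hom[OF df(1)] and lB = lift_hom[OF df(2)]
  have fg: "f \<cdot> projB B = g \<cdot> projB B" using df(6) dg(6) by simp
  note s = fib_sum_hom[OF pre df(5) dg(5) fg]
  note Tpre = preadditive_bundle_T[OF pre]
  have l: "additive_bundle_morphism X B (T_bundle X B) (\<zz> (baseB B)) (liftB B)"
    using df(2) by (simp add: differential_structure_def)
  have "fib_sum X B (totB A) f g \<cdot> liftB B =
      fib_sum X (T_bundle X B) (totB A) (liftB A \<cdot> T\<^sub>a f) (liftB A \<cdot> T\<^sub>a g)"
    using fib_sum_seq[OF pre Tpre l df(5) dg(5) fg] df(7) dg(7) by simp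
  also have "\<dots> = liftB A \<cdot> fib_sum X (T_bundle X B) (T\<^sub>o (totB A)) (T\<^sub>a f) (T\<^sub>a g)"
    using seq_fib_sum[OF Tpre, of "T\<^sub>a f" "T\<^sub>o (totB A)" "T\<^sub>a g" "liftB A" "totB A"] lA
      T_hom[OF df(5)] T_hom[OF dg(5)] T_seq[OF df(5) preadditive_bundle_homs(4)[OF pre]]
      T_seq[OF dg(5) preadditive_bundle_homs(4)[OF pre]] fg by simp
  also have "\<dots> = liftB A \<cdot> T\<^sub>a (fib_sum X B (totB A) f g)"
    using T_fib_sum[OF pre df(5) dg(5) fg] by simp
  finally show ?thesis
    using f s df(6) by (simp add: linear_over_def)
qed

lemma DB_proj_hom:
  assumes "differential_bundle X A" and "baseB A = E"
  shows "projB A \<in> hom (DB X E) A (trivial_bundle X E)"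
    and "zeroB A \<in> hom (DB X E) (trivial_bundle X E) A"
proof -
  have A: "differential_structure X A" using assms by (simp add: differential_bundle_iff)
  note pre = differential_structure_preadditive[OF A]
  note h = preadditive_bundle_homs[OF pre, unfolded assms]
  have t: "differential_bundle X (trivial_bundle X E)"
    using differential_structure_trivial_bundle[OF h(2)] display_identity[OF h(2)]
    by (simp add: differential_bundle_iff)
  show "projB A \<in> hom (DB X E) A (trivial_bundle X E)"
    using assms t h seq_ide[OF h(4)] lift_proj(1)[OF A] by (simp add: linear_over_def)
  show "zeroB A \<in> hom (DB X E) (trivial_bundle X E) A"
    using assms t h pre lift_proj(2)[OF A] by (simp add: linear_over_def preadditive_bundle_def)
qed

text \<open>A linear map \<open>0 \<rightarrow> A\<close> is a section \<open>v\<close> of the projection with \<open>v l = v z\<close>, which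
  forces it to be the zero section.\<close>

lemma zero_object_DB:
  assumes E: "E \<in> ob X"
  shows "zero_object (DB X E) (trivial_bundle X E)"
proof -
  have "differential_bundle X (trivial_bundle X E)"
    using differential_structure_trivial_bundle[OF E] display_identity[OF E]
    by (simp add: differential_bundle_iff)
  moreover have "\<exists>!f. f \<in> hom (DB X E) A (trivial_bundle X E)"
    if "A \<in> ob (DB X E)" for A
  proof (rule ex1I)
    show "projB A \<in> hom (DB X E) A (trivial_bundle X E)" by (rule DB_proj_hom) (use that in simp_all)
    fix f assume "f \<in> hom (DB X E) A (trivial_bundle X E)"
    from DB_homD(5,6)[OF this] show "f = projB A" by (simp add: seq_ide)
  qed
  moreover have "\<exists>!f. f \<in> hom (DB X E) (trivial_bundle X E) A"
    if "A \<in> ob (DB X E)" for A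
  proof (rule ex1I)
    show "zeroB A \<in> hom (DB X E) (trivial_bundle X E) A" by (rule DB_proj_hom) (use that in simp_all)
    fix f assume f: "f \<in> hom (DB X E) (trivial_bundle X E) A"
    note d = DB_homD[OF f]
    have fh: "f \<in> hom X E (totB A)" and fp: "f \<cdot> projB A = ide X E"
      and fl: "f \<cdot> liftB A = \<zz> E \<cdot> T\<^sub>a f" using d by simp_all
    have z: "zeroB A \<in> hom X E (totB A)"
      using preadditive_bundle_homs(5)[OF differential_structure_preadditive[OF d(2)]] d(4) by simp
    have "f = (f \<cdot> projB A) \<cdot> zeroB A"
      using zero_if_lift_eq_zero[OF d(2) fh] fl z_natural[OF fh] by simp
    then show "f = zeroB A" using fp ide_seq[OF z] by simp
  qed
  ultimately show ?thesis by (simp add: zero_object_def)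
qed

text \<open>A zero arrow may factor through any zero object \<open>Z\<close>; its second factor is then the arrow
  \<open>Z \<rightarrow> 0 \<rightarrow> B\<close>, because \<open>Z\<close> is initial.\<close>

lemma zero_arrow_DB_iff:
  assumes A: "A \<in> ob (DB X E)" and B: "B \<in> ob (DB X E)"
  shows "zero_arrow (DB X E) A B f \<longleftrightarrow> f = projB A \<cdot> zeroB B"
proof
  assume "zero_arrow (DB X E) A B f"
  then obtain Z u v where Z: "zero_object (DB X E) Z" and u: "u \<in> hom (DB X E) A Z"
    and v: "v \<in> hom (DB X E) Z B" and f: "f = u \<cdot> v"
    unfolding zero_arrow_def DB_simps(4) by blast
  note du = DB_homD[OF u] and dv = DB_homD[OF v]
  have hZ: "projB Z \<in> hom X (totB Z) E" and hB: "zeroB B \<in> hom X E (totB B)"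
    using preadditive_bundle_homs(4)[OF differential_structure_preadditive[OF du(2)]]
      preadditive_bundle_homs(5)[OF differential_structure_preadditive[OF dv(2)]] du(4) dv(4)
    by simp_all
  have "projB Z \<cdot> zeroB B \<in> hom (DB X E) Z B"
    using category.seq_hom[OF category_DB DB_proj_hom(1) DB_proj_hom(2), of Z E B] u v by simp
  then have "v = projB Z \<cdot> zeroB B"
    using Z v B unfolding zero_object_def by blast
  then show "f = projB A \<cdot> zeroB B"
    using f seq_assoc[OF du(5) hZ hB] du(6) by simp
next
  assume f: "f = projB A \<cdot> zeroB B"
  have "differential_structure X A" and "baseB A = E"
    using A by (simp_all add: differential_bundle_iff)
  then have "E \<in> ob X"
    using preadditive_bundle_homs(2)[OF differential_structure_preadditive] by blast
  moreover have "projB A \<in> hom (DB X E) A (trivial_bundle X E)"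
    and "zeroB B \<in> hom (DB X E) (trivial_bundle X E) B"
    using A B by (intro DB_proj_hom; simp)+
  ultimately show "zero_arrow (DB X E) A B f"
    unfolding zero_arrow_def DB_simps(4) using zero_object_DB f by blast
qed

text \<open>In \<open>p\<^sub>1 i\<^sub>1 + p\<^sub>2 i\<^sub>2 = id\<close> the two sides have the same composites with the projections of a
  product, because linear maps are additive.\<close>

lemma DB_product_identity:
  assumes i1: "i1 \<in> hom (DB X E) A P" and i2: "i2 \<in> hom (DB X E) B P"
    and p1: "p1 \<in> hom (DB X E) P A" and p2: "p2 \<in> hom (DB X E) P B"
    and jm: "\<And>h h'. h \<in> hom (DB X E) P P \<Longrightarrow> h' \<in> hom (DB X E) P P \<Longrightarrow>
      h \<cdot> p1 = h' \<cdot> p1 \<Longrightarrow> h \<cdot> p2 = h' \<cdot> p2 \<Longrightarrow> h = h'"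
    and i1p1: "i1 \<cdot> p1 = ide X (totB A)" and i2p2: "i2 \<cdot> p2 = ide X (totB B)"
    and i1p2: "i1 \<cdot> p2 = projB A \<cdot> zeroB B" and i2p1: "i2 \<cdot> p1 = projB B \<cdot> zeroB A"
  shows "fib_sum X P (totB P) (p1 \<cdot> i1) (p2 \<cdot> i2) = ide X (totB P)"
proof -
  note d1 = DB_homD[OF p1] and d2 = DB_homD[OF p2] and e1 = DB_homD[OF i1] and e2 = DB_homD[OF i2]
  note preP = differential_structure_preadditive[OF d1(1)]
    and preA = differential_structure_preadditive[OF d1(2)]
    and preB = differential_structure_preadditive[OF d2(2)]
  note hP = preadditive_bundle_homs[OF preP] and hA = preadditive_bundle_homs[OF preA]
    and hB = preadditive_bundle_homs[OF preB]
  note addA = differential_structure_additive[OF d1(2)] and addB = differential_structure_additive[OF d2(2)]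
  have q1: "p1 \<cdot> i1 \<in> hom (DB X E) P P" and q2: "p2 \<cdot> i2 \<in> hom (DB X E) P P"
    using category.seq_hom[OF category_DB p1 i1] category.seq_hom[OF category_DB p2 i2] by simp_all
  note f1 = DB_homD(5,6)[OF q1] and f2 = DB_homD(5,6)[OF q2]
  have f12: "(p1 \<cdot> i1) \<cdot> projB P = (p2 \<cdot> i2) \<cdot> projB P" using f1 f2 by simp
  have zA: "zeroB A \<in> hom X E (totB A)" and zB: "zeroB B \<in> hom X E (totB B)"
    and pA: "projB A \<in> hom X (totB A) E" and pB: "projB B \<in> hom X (totB B) E"
    using hA(4,5) hB(4,5) d1(4) d2(4) by simp_all
  have "(p2 \<cdot> i2) \<cdot> p1 = (p1 \<cdot> projB A) \<cdot> zeroB A"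
    using seq_assoc[OF d2(5) e2(5) d1(5)] i2p1 seq_assoc[OF d2(5) pB zA] d1(6) d2(6) by simp
  moreover have "(p1 \<cdot> i1) \<cdot> p1 = p1"
    using seq_assoc[OF d1(5) e1(5) d1(5)] i1p1 seq_ide[OF d1(5)] by simp
  ultimately have a: "fib_sum X P (totB P) (p1 \<cdot> i1) (p2 \<cdot> i2) \<cdot> p1 = ide X (totB P) \<cdot> p1"
    using fib_sum_seq[OF preP preA DB_hom_additive[OF p1] f1(1) f2(1) f12]
      fib_sum_zero[OF addA d1(5)] ide_seq[OF d1(5)] by simp
  have "(p1 \<cdot> i1) \<cdot> p2 = (p2 \<cdot> projB B) \<cdot> zeroB B"
    using seq_assoc[OF d1(5) e1(5) d2(5)] i1p2 seq_assoc[OF d1(5) pA zB] d1(6) d2(6) by simp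
  moreover have "(p2 \<cdot> i2) \<cdot> p2 = p2"
    using seq_assoc[OF d2(5) e2(5) d2(5)] i2p2 seq_ide[OF d2(5)] by simp
  ultimately have b: "fib_sum X P (totB P) (p1 \<cdot> i1) (p2 \<cdot> i2) \<cdot> p2 = ide X (totB P) \<cdot> p2"
    using fib_sum_seq[OF preP preB DB_hom_additive[OF p2] f1(1) f2(1) f12]
      zero_fib_sum[OF addB preB d2(5)] ide_seq[OF d2(5)] by simp
  have i: "ide X (totB P) \<in> hom (DB X E) P P"
    using category.ide_hom[OF category_DB, of P E] q1 by simp
  show ?thesis by (rule jm[OF DB_sum_hom[OF q1 q2] i a b])
qed

lemma DB_seq: "f \<in> hom (DB X E) A B \<Longrightarrow> g \<in> hom (DB X E) B D \<Longrightarrow> f \<cdot> g \<in> hom (DB X E) A D"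
  using category.seq_hom[OF category_DB, of f E A B g D] by simp

lemma DB_ide: "A \<in> ob (DB X E) \<Longrightarrow> ide X (totB A) \<in> hom (DB X E) A A"
  using category.ide_hom[OF category_DB, of A E] by simp

lemma DB_zero_hom:
  "A \<in> ob (DB X E) \<Longrightarrow> B \<in> ob (DB X E) \<Longrightarrow> projB A \<cdot> zeroB B \<in> hom (DB X E) A B"
  by (rule DB_seq[OF DB_proj_hom]) auto

lemma DB_pairing_hom:
  assumes a: "a \<in> hom (DB X E) P A" and b: "b \<in> hom (DB X E) P B"
    and W: "tangent_pullback X (totB A) (totB B) E (projB A) (projB B) (totB P) a b"
    and u: "u \<in> hom (DB X E) Y A" and v: "v \<in> hom (DB X E) Y B"
  shows "\<exists>h \<in> hom (DB X E) Y P. h \<cdot> a = u \<and> h \<cdot> b = v"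
proof -
  note da = DB_homD[OF a] and db = DB_homD[OF b] and du = DB_homD[OF u] and dv = DB_homD[OF v]
  note lY = lift_hom[OF du(1)] and lP = lift_hom[OF da(1)]
    and lA = lift_hom[OF da(2)] and lB = lift_hom[OF db(2)]
  have pA: "projB A \<in> hom X (totB A) E"
    using preadditive_bundle_homs(4)[OF differential_structure_preadditive[OF da(2)]] da(4) by simp
  obtain h where h: "h \<in> hom X (totB Y) (totB P)" "h \<cdot> a = u" "h \<cdot> b = v"
    using pullback_pairing[OF tangent_pullback_pullback[OF W] du(5) dv(5)] du(6) dv(6) by auto
  have "h \<cdot> projB P = projB Y"
    using seq_assoc[OF h(1) da(5) pA] h(2) da(6) du(6) by simp
  moreover have "h \<cdot> liftB P = liftB Y \<cdot> T\<^sub>a h"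
  proof (rule pullback_unique[OF tangent_pullback_pullback[OF tangent_pullback_T[OF W]]
        seq_hom[OF h(1) lP] seq_hom[OF lY T_hom[OF h(1)]]])
    show "(h \<cdot> liftB P) \<cdot> T\<^sub>a a = (liftB Y \<cdot> T\<^sub>a h) \<cdot> T\<^sub>a a"
      using seq_assoc[OF h(1) lP T_hom[OF da(5)]] da(7) seq_assoc[OF h(1) da(5) lA]
        seq_assoc[OF lY T_hom[OF h(1)] T_hom[OF da(5)]] T_seq[OF h(1) da(5)] h(2) du(7) by simp
    show "(h \<cdot> liftB P) \<cdot> T\<^sub>a b = (liftB Y \<cdot> T\<^sub>a h) \<cdot> T\<^sub>a b"
      using seq_assoc[OF h(1) lP T_hom[OF db(5)]] db(7) seq_assoc[OF h(1) db(5) lB]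
        seq_assoc[OF lY T_hom[OF h(1)] T_hom[OF db(5)]] T_seq[OF h(1) db(5)] h(3) dv(7) by simp
  qed
  ultimately have "h \<in> hom (DB X E) Y P" using h a u by (simp add: linear_over_def)
  then show ?thesis using h by blast
qed

lemma DB_sum_seq:
  assumes f: "f \<in> hom (DB X E) A B" and g: "g \<in> hom (DB X E) A B" and k: "k \<in> hom (DB X E) B D"
  shows "fib_sum X B (totB A) f g \<cdot> k = fib_sum X D (totB A) (f \<cdot> k) (g \<cdot> k)"
  using fib_sum_seq[OF differential_structure_preadditive differential_structure_preadditive
      DB_hom_additive[OF k], of f "totB A" g] DB_homD[OF f] DB_homD[OF g] DB_homD[OF k] by simp

lemma DB_seq_sum:
  assumes f: "f \<in> hom (DB X E) A B" and g: "g \<in> hom (DB X E) A B" and k: "k \<in> hom (DB X E) D A"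
  shows "k \<cdot> fib_sum X B (totB A) f g = fib_sum X B (totB D) (k \<cdot> f) (k \<cdot> g)"
  using seq_fib_sum[OF differential_structure_preadditive, of B f "totB A" g k "totB D"]
    DB_homD[OF f] DB_homD[OF g] DB_homD[OF k] by simp

text \<open>The arrow out of the Whitney sum with components \<open>u\<close> and \<open>v\<close> is \<open>a u + b v\<close>; it is the only one
  since every linear map preserves the decomposition \<open>a i\<^sub>1 + b i\<^sub>2 = id\<close>.\<close>

lemma whitney_sum_biproduct:
  assumes a: "a \<in> hom (DB X E) P A" and b: "b \<in> hom (DB X E) P B"
    and W: "tangent_pullback X (totB A) (totB B) E (projB A) (projB B) (totB P) a b"
  obtains i1 i2 where "biproduct (DB X E) A B P i1 i2 a b"
proof -
  have obs: "A \<in> ob (DB X E)" "B \<in> ob (DB X E)" "P \<in> ob (DB X E)" using a b by simp_all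
  note W0 = tangent_pullback_pullback[OF W]
  have jm: "h = h'" if "h \<in> hom (DB X E) Y P" "h' \<in> hom (DB X E) Y P" "h \<cdot> a = h' \<cdot> a" "h \<cdot> b = h' \<cdot> b"
    for Y h h'
    using pullback_unique[OF W0 _ _ that(3,4)] DB_homD(5)[OF that(1)] DB_homD(5)[OF that(2)] by blast
  obtain i1 where i1: "i1 \<in> hom (DB X E) A P" "i1 \<cdot> a = ide X (totB A)" "i1 \<cdot> b = projB A \<cdot> zeroB B"
    using DB_pairing_hom[OF a b W DB_ide[OF obs(1)] DB_zero_hom[OF obs(1,2)]] by blast
  obtain i2 where i2: "i2 \<in> hom (DB X E) B P" "i2 \<cdot> a = projB B \<cdot> zeroB A" "i2 \<cdot> b = ide X (totB B)"
    using DB_pairing_hom[OF a b W DB_zero_hom[OF obs(2,1)] DB_ide[OF obs(2)]] by blast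
  have id: "fib_sum X P (totB P) (a \<cdot> i1) (b \<cdot> i2) = ide X (totB P)"
    by (rule DB_product_identity[OF i1(1) i2(1) a b jm i1(2) i2(3) i1(3) i2(2)])
  have prod: "\<exists>!h. h \<in> hom (DB X E) Y P \<and> h \<cdot> a = u \<and> h \<cdot> b = v"
    if "u \<in> hom (DB X E) Y A" "v \<in> hom (DB X E) Y B" for Y u v
  proof (rule ex_ex1I)
    show "\<exists>h. h \<in> hom (DB X E) Y P \<and> h \<cdot> a = u \<and> h \<cdot> b = v"
      using DB_pairing_hom[OF a b W that] by blast
    fix h h'
    assume h: "h \<in> hom (DB X E) Y P \<and> h \<cdot> a = u \<and> h \<cdot> b = v"
      and h': "h' \<in> hom (DB X E) Y P \<and> h' \<cdot> a = u \<and> h' \<cdot> b = v"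
    show "h = h'" by (rule jm[of h Y h']) (use h h' in simp_all)
  qed
  have coprod: "\<exists>!h. h \<in> hom (DB X E) P Y \<and> i1 \<cdot> h = u \<and> i2 \<cdot> h = v"
    if u: "u \<in> hom (DB X E) A Y" and v: "v \<in> hom (DB X E) B Y" for Y u v
  proof (rule ex1I)
    note du = DB_homD[OF u] and dv = DB_homD[OF v]
    note addY = differential_structure_additive[OF du(2)]
      and preY = differential_structure_preadditive[OF du(2)]
    note au = DB_seq[OF a u] and bv = DB_seq[OF b v]
    have pA: "projB A \<in> hom X (totB A) E" and pB: "projB B \<in> hom X (totB B) E"
      and zA: "zeroB A \<in> hom X E (totB A)" and zB: "zeroB B \<in> hom X E (totB B)"
      using preadditive_bundle_homs(4,5)[OF differential_structure_preadditive[OF du(1)]]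
        preadditive_bundle_homs(4,5)[OF differential_structure_preadditive[OF dv(1)]] du(3) dv(3)
      by simp_all
    have zu: "zeroB A \<cdot> u = zeroB Y" and zv: "zeroB B \<cdot> v = zeroB Y"
      using additive_morphism_eqs(2)[OF DB_hom_additive[OF u]] ide_seq
        additive_morphism_eqs(2)[OF DB_hom_additive[OF v]] du(4)
        preadditive_bundle_homs(5)[OF preY] by simp_all
    have iu: "i1 \<cdot> (a \<cdot> u) = u" and iv: "i2 \<cdot> (b \<cdot> v) = v"
      using seq_assoc[OF DB_homD(5)[OF i1(1)] DB_homD(5)[OF a] du(5)] i1(2) ide_seq[OF du(5)]
        seq_assoc[OF DB_homD(5)[OF i2(1)] DB_homD(5)[OF b] dv(5)] i2(3) ide_seq[OF dv(5)] by simp_all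
    have iv0: "i1 \<cdot> (b \<cdot> v) = (u \<cdot> projB Y) \<cdot> zeroB Y"
      using seq_assoc[OF DB_homD(5)[OF i1(1)] DB_homD(5)[OF b] dv(5)] i1(3)
        seq_assoc[OF pA zB dv(5)] zv du(6) by simp
    have iu0: "i2 \<cdot> (a \<cdot> u) = (v \<cdot> projB Y) \<cdot> zeroB Y"
      using seq_assoc[OF DB_homD(5)[OF i2(1)] DB_homD(5)[OF a] du(5)] i2(2)
        seq_assoc[OF pB zA du(5)] zu dv(6) by simp
    show "fib_sum X Y (totB P) (a \<cdot> u) (b \<cdot> v) \<in> hom (DB X E) P Y \<and>
        i1 \<cdot> fib_sum X Y (totB P) (a \<cdot> u) (b \<cdot> v) = u \<and> i2 \<cdot> fib_sum X Y (totB P) (a \<cdot> u) (b \<cdot> v) = v"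
      unfolding DB_seq_sum[OF au bv i1(1)] DB_seq_sum[OF au bv i2(1)] iu iv iu0 iv0
        fib_sum_zero[OF addY du(5)] zero_fib_sum[OF addY preY dv(5)]
      using DB_sum_hom[OF au bv] by blast
    fix h assume h: "h \<in> hom (DB X E) P Y \<and> i1 \<cdot> h = u \<and> i2 \<cdot> h = v"
    then have hh: "h \<in> hom (DB X E) P Y" by blast
    note dh = DB_homD[OF hh]
    have "h = fib_sum X P (totB P) (a \<cdot> i1) (b \<cdot> i2) \<cdot> h"
      unfolding id by (rule ide_seq[OF dh(5), symmetric])
    also have "\<dots> = fib_sum X Y (totB P) ((a \<cdot> i1) \<cdot> h) ((b \<cdot> i2) \<cdot> h)"
      by (rule DB_sum_seq[OF DB_seq[OF a i1(1)] DB_seq[OF b i2(1)] hh])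
    also have "(a \<cdot> i1) \<cdot> h = a \<cdot> u"
      using seq_assoc[OF DB_homD(5)[OF a] DB_homD(5)[OF i1(1)] dh(5)] h by simp
    also have "(b \<cdot> i2) \<cdot> h = b \<cdot> v"
      using seq_assoc[OF DB_homD(5)[OF b] DB_homD(5)[OF i2(1)] dh(5)] h by simp
    finally show "h = fib_sum X Y (totB P) (a \<cdot> u) (b \<cdot> v)" .
  qed
  have "biproduct (DB X E) A B P i1 i2 a b"
    unfolding biproduct_def DB_simps(3,4) zero_arrow_DB_iff[OF obs(1,2)] zero_arrow_DB_iff[OF obs(2,1)]
    using a b i1 i2 prod coprod by blast
  then show thesis by (rule that)
qed

text \<open>The codiagonal of a biproduct with itself is the fibrewise sum of the two projections, whichever
  biproduct is chosen.  For the converse it suffices that some biproduct exists, since the first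
  part then computes its sum.\<close>

lemma arrow_sum_DB_iff:
  assumes f: "f \<in> hom (DB X E) A B" and g: "g \<in> hom (DB X E) A B"
  shows "arrow_sum (DB X E) A B f g h \<longleftrightarrow> h = fib_sum X B (totB A) f g"
proof -
  have sum: "h = fib_sum X B (totB A) f g" if s: "arrow_sum (DB X E) A B f g h" for h
  proof -
    have B: "B \<in> ob (DB X E)" using f by simp
    from s obtain P i1 i2 p1 p2 u d where bi: "biproduct (DB X E) B B P i1 i2 p1 p2"
      and u: "u \<in> hom (DB X E) A P" "u \<cdot> p1 = f" "u \<cdot> p2 = g"
      and d: "d \<in> hom (DB X E) P B" "i1 \<cdot> d = ide X (totB B)" "i2 \<cdot> d = ide X (totB B)"
      and h: "h = u \<cdot> d"
      unfolding arrow_sum_def DB_simps(3,4) by blast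
    have hom: "i1 \<in> hom (DB X E) B P" "i2 \<in> hom (DB X E) B P"
        "p1 \<in> hom (DB X E) P B" "p2 \<in> hom (DB X E) P B"
      and univ: "\<And>Y u v. u \<in> hom (DB X E) Y B \<Longrightarrow> v \<in> hom (DB X E) Y B \<Longrightarrow>
          \<exists>!h. h \<in> hom (DB X E) Y P \<and> h \<cdot> p1 = u \<and> h \<cdot> p2 = v"
      and eqs: "i1 \<cdot> p1 = ide X (totB B)" "i2 \<cdot> p2 = ide X (totB B)"
        "i1 \<cdot> p2 = projB B \<cdot> zeroB B" "i2 \<cdot> p1 = projB B \<cdot> zeroB B"
      using bi unfolding biproduct_def DB_simps(3,4) zero_arrow_DB_iff[OF B B] by blast+
    have jm: "k = k'" if "k \<in> hom (DB X E) P P" "k' \<in> hom (DB X E) P P"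
      "k \<cdot> p1 = k' \<cdot> p1" "k \<cdot> p2 = k' \<cdot> p2" for k k'
      using univ[OF DB_seq[OF that(1) hom(3)] DB_seq[OF that(1) hom(4)]] that by metis
    have id: "fib_sum X P (totB P) (p1 \<cdot> i1) (p2 \<cdot> i2) = ide X (totB P)"
      by (rule DB_product_identity[OF hom jm eqs])
    note dd = DB_homD(5)[OF d(1)] and hh = hom[THEN DB_homD(5)]
    have "d = fib_sum X P (totB P) (p1 \<cdot> i1) (p2 \<cdot> i2) \<cdot> d"
      unfolding id by (rule ide_seq[OF dd, symmetric])
    also have "\<dots> = fib_sum X B (totB P) ((p1 \<cdot> i1) \<cdot> d) ((p2 \<cdot> i2) \<cdot> d)"
      by (rule DB_sum_seq[OF DB_seq[OF hom(3,1)] DB_seq[OF hom(4,2)] d(1)])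
    also have "(p1 \<cdot> i1) \<cdot> d = p1"
      unfolding seq_assoc[OF hh(3,1) dd] d(2) by (rule seq_ide[OF hh(3)])
    also have "(p2 \<cdot> i2) \<cdot> d = p2"
      unfolding seq_assoc[OF hh(4,2) dd] d(3) by (rule seq_ide[OF hh(4)])
    finally show "h = fib_sum X B (totB A) f g"
      unfolding h using DB_seq_sum[OF hom(3,4) u(1)] u(2,3) by simp
  qed
  have obs: "A \<in> ob (DB X E)" "B \<in> ob (DB X E)" using f by simp_all
  then have dB: "differential_bundle X B" "baseB B = E" by simp_all
  obtain P a b where P: "differential_bundle X P" "baseB P = E"
    and "linear_over X P B a" "linear_over X P B b"
    and W: "tangent_pullback X (totB B) (totB B) E (projB B) (projB B) (totB P) a b"
    using whitney_sum_exists[OF dB dB] .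
  then have a: "a \<in> hom (DB X E) P B" and b: "b \<in> hom (DB X E) P B"
    using dB by simp_all
  obtain i1 i2 where bi: "biproduct (DB X E) B B P i1 i2 a b"
    using whitney_sum_biproduct[OF a b W] .
  note iB = DB_ide[OF obs(2)]
  obtain u where u: "u \<in> hom (DB X E) A P" "u \<cdot> a = f" "u \<cdot> b = g"
    using DB_pairing_hom[OF a b W f g] by blast
  obtain d where d: "d \<in> hom (DB X E) P B" "i1 \<cdot> d = ide X (totB B)" "i2 \<cdot> d = ide X (totB B)"
    using bi iB unfolding biproduct_def DB_simps(4) by blast
  have "arrow_sum (DB X E) A B f g (u \<cdot> d)"
    unfolding arrow_sum_def DB_simps(3,4) using bi u d by blast
  then show ?thesis using sum by metis
qed

end

theorem theorem3p21:
  fixes X :: "('o, 'm) tangent" and E M :: 'o and q \<iota> tV tF R H :: 'm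
    and V F :: "('o, 'm) diff_bundle"
  assumes "tangent_category X"
    and "tangent_display X E M q"
    and "vertical_bundle X E M q V \<iota> tV"
    and "finsler_bundle X E M q F tF"
    and "tangent_display X (T_ob X E) E (tan_p X E)"
    and "tangent_display X (totB V) E (projB V)"
    and "tangent_display X (totB F) E (projB F)"
    and "R \<in> hom X (T_ob X E) (totB V)"
    and "H \<in> hom X (totB F) (T_ob X E)"
  shows "ehresmann_connection X E V \<iota> F (horizontal_descent X E q F tF) R H \<longleftrightarrow>
    splitting (DB X E) (trivial_bundle X E) V \<iota> (tangent_bundle X E)
      (horizontal_descent X E q F tF) F R H"
proof -
  interpret tangent_category X by fact
  have q: "q \<in> hom X E M" using assms(2) by (simp add: tangent_display_def)
  then have E: "E \<in> ob X" using hom_ob by blast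
  let ?p = "tangent_bundle X E" and ?d = "horizontal_descent X E q F tF"
  have bases: "baseB V = E" "baseB F = E"
    using assms(3,4) by (simp_all add: vertical_bundle_def finsler_bundle_def)
  have bundles: "differential_bundle X V" "differential_bundle X F" "differential_bundle X ?p"
    using differential_structure_vertical(1)[OF q assms(3)] differential_structure_finsler[OF q assms(4)]
      differential_structure_tangent_bundle[OF E] assms(5-7) bases by (simp_all add: differential_bundle_iff)
  have obs: "V \<in> ob (DB X E)" "F \<in> ob (DB X E)" "?p \<in> ob (DB X E)"
    using bundles bases by simp_all
  have \<iota>: "\<iota> \<in> hom (DB X E) V ?p" and d: "?d \<in> hom (DB X E) ?p F"
    using differential_structure_vertical(2)[OF q assms(3)] linear_horizontal_descent[OF q assms(4)]
      bundles bases by simp_all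
  have R: "R \<in> hom (DB X E) ?p V \<longleftrightarrow> linear_over X ?p V R"
    and H: "H \<in> hom (DB X E) F ?p \<longleftrightarrow> linear_over X F ?p H"
    using bundles bases by simp_all
  have sum: "arrow_sum (DB X E) ?p ?p (R \<cdot>\<^bsub>X\<^esub> \<iota>) (?d \<cdot>\<^bsub>X\<^esub> H) (ide X (T_ob X E)) \<longleftrightarrow>
      fib_sum X ?p (T_ob X E) (R \<cdot>\<^bsub>X\<^esub> \<iota>) (?d \<cdot>\<^bsub>X\<^esub> H) = ide X (T_ob X E)"
    if "R \<in> hom (DB X E) ?p V" "H \<in> hom (DB X E) F ?p"
    unfolding arrow_sum_DB_iff[OF DB_seq[OF that(1) \<iota>] DB_seq[OF d that(2)]] tangent_bundle_simps
    by (rule eq_commute)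
  show ?thesis
    unfolding ehresmann_connection_def vertical_connection_def horizontal_connection_def
      splitting_def short_sequence_def DB_simps(3,4) zero_arrow_DB_iff[OF obs(2,1)]
      R[symmetric] H[symmetric] tangent_bundle_simps
    using sum zero_object_DB[OF E] \<iota> d by blast
qed

end
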